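(* Let $F\in\mathrm{End}(\mathbb{C}^n,O)$ be such that $dF_O$ is invertible and non-diagonalizable. Then there exist a complex $n$-dimensional manifold $M$, a holomorphic projection $\pi\colon M\to\mathbb{C}^n$, a point $\mathbf{e}\in M$ and a germ at $\pi^{-1}(O)$ of holomorphic self-map $\tilde F$ of $M$ such that: (i) $\pi$ restricted to $M\setminus\pi^{-1}(O)$ is a biholomorphism between $M\setminus\pi^{-1}(O)$ and $\mathbb{C}^n\setminus\{O\}$; (ii) $\pi\circ\tilde F=F\circ\pi$; (iii) $\mathbf{e}$ is a fixed point of $\tilde F$, and $d\tilde F_{\mathbf{e}}$ is diagonalizable. More precisely, if the Jordan canonical form of $dF_O$ contains $\rho\ge 1$ blocks of length $\mu_1\ge\mu_2\ge\cdots\ge\mu_\rho\ge 1$ corresponding respectively to eigenvalues $\lambda_1,\lambda_2,\ldots,\lambda_\rho\in\mathbb{C}$, then $M,\pi,\mathbf{e},\tilde F$ can be taken so that, in addition, $d\tilde F_{\mathbf{e}}$ has eigenvalues $$\tilde\lambda_1,\ 1,\ \lambda_2/\lambda_1,\ \ldots,\ \lambda_\rho/\lambda_1$$ of multiplicity respectively $1,\ \mu_1-1,\ \mu_2,\ldots,\mu_\rho$, where $\tilde\lambda_1=\lambda_1$ if $\mu_1>\mu_2$ (or $\rho=1$), and $\tilde\lambda_1=\lambda_1^2/\lambda_2$ if $\mu_1=\mu_2$.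
   Context: $\mathrm{End}(\mathbb{C}^n,O)$ denotes the set of germs at the origin $O$ of holomorphic self-maps of $\mathbb{C}^n$ sending $O$ to itself. A germ at a closed set $X$ of a complex manifold $M$ of holomorphic self-map of $M$ is represented by a holomorphic map into $M$ defined on an open neighbourhood of $X$; identities such as (ii) are identities of germs (at $\pi^{-1}(O)$). The list of eigenvalues is a list with repetitions: if some of the listed values coincide, their multiplicities add up. *)

theory Defs
  imports
    "HOL-Analysis.Analysis"
    "HOL-Computational_Algebra.Computational_Algebra"
    "Jordan_Normal_Form.Jordan_Normal_Form"
begin

section \<open>Complex matrices\<close>

text \<open>
  Differentials are matrices over the finite index type \<^typ>\<open>'n\<close>, whereas similarity, Jordan normal
  forms and characteristic polynomials are available for matrices indexed by natural numbers.
  The enumeration of \<^typ>\<open>'n\<close> used for the translation is immaterial: another one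
  conjugates the result by a permutation matrix.
\<close>

definition jnf_mat :: "complex ^ 'n ^ 'n \<Rightarrow> complex Matrix.mat" where
  "jnf_mat A = Matrix.mat CARD('n) CARD('n)
     (\<lambda>(i, j). vec_nth (vec_nth A (from_nat_into (UNIV :: 'n set) i))
                               (from_nat_into (UNIV :: 'n set) j))"

definition diagonalizable :: "complex ^ 'n ^ 'n \<Rightarrow> bool" where
  "diagonalizable A \<longleftrightarrow> (\<exists>D. diagonal_mat D \<and> similar_mat (jnf_mat A) D)"

definition eigenvalue_mset :: "complex ^ 'n ^ 'n \<Rightarrow> complex multiset" where
  "eigenvalue_mset A = proots (char_poly (jnf_mat A))"

section \<open>Complex manifolds and holomorphic maps\<close>

text \<open>Holomorphic in several variables: complex differentiable at every point. Used for open \<open>D\<close>.\<close>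

definition holomorphic_vec :: "(complex ^ 'n \<Rightarrow> complex ^ 'm) \<Rightarrow> (complex ^ 'n) set \<Rightarrow> bool" where
  "holomorphic_vec f D \<longleftrightarrow> (\<forall>z\<in>D. \<exists>A. (f has_derivative (\<lambda>v. A *v v)) (at z))"

record ('p, 'n) charted_space =
  mtop :: "'p topology"
  atlas :: "('p set \<times> ('p \<Rightarrow> complex ^ 'n)) set"

definition is_chart :: "'p topology \<Rightarrow> 'p set \<Rightarrow> ('p \<Rightarrow> complex ^ 'n) \<Rightarrow> bool" where
  "is_chart T U \<phi> \<longleftrightarrow>
     openin T U \<and> open (\<phi> ` U) \<and>
     homeomorphic_map (subtopology T U) (top_of_set (\<phi> ` U)) \<phi>"

text \<open>
  Manifolds are connected, Hausdorff and second countable. Connectedness is essential here: a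
  disconnected \<open>M\<close> could carry an extra component, unrelated to \<open>F\<close>, on which \<open>\<pi>\<close> vanishes.
\<close>

definition complex_manifold :: "('p, 'n :: finite) charted_space \<Rightarrow> bool" where
  "complex_manifold X \<longleftrightarrow>
     Hausdorff_space (mtop X) \<and> connected_space (mtop X) \<and>
     (\<exists>\<B>. countable \<B> \<and> (\<forall>B\<in>\<B>. openin (mtop X) B) \<and>
        (\<forall>U x. openin (mtop X) U \<and> x \<in> U \<longrightarrow> (\<exists>B\<in>\<B>. x \<in> B \<and> B \<subseteq> U))) \<and>
     (\<forall>(U, \<phi>)\<in>atlas X. is_chart (mtop X) U \<phi>) \<and>
     \<Union> (fst ` atlas X) = topspace (mtop X) \<and>
     (\<forall>(U, \<phi>)\<in>atlas X. \<forall>(V, \<psi>)\<in>atlas X.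
        holomorphic_vec (\<psi> \<circ> inv_into U \<phi>) (\<phi> ` (U \<inter> V)))"

definition complex_space :: "(complex ^ 'n, 'n) charted_space" where
  "complex_space = \<lparr>mtop = euclidean, atlas = {(UNIV, id)}\<rparr>"

definition holomorphic_map ::
  "('p, 'n :: finite) charted_space \<Rightarrow> 'p set \<Rightarrow> ('q, 'm :: finite) charted_space \<Rightarrow> ('p \<Rightarrow> 'q) \<Rightarrow> bool" where
  "holomorphic_map X W Y f \<longleftrightarrow>
     openin (mtop X) W \<and> continuous_map (subtopology (mtop X) W) (mtop Y) f \<and>
     (\<forall>(U, \<phi>)\<in>atlas X. \<forall>(V, \<psi>)\<in>atlas Y.
        holomorphic_vec (\<psi> \<circ> f \<circ> inv_into U \<phi>) (\<phi> ` {x \<in> U \<inter> W. f x \<in> V}))"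

definition biholomorphism ::
  "('p, 'n :: finite) charted_space \<Rightarrow> 'p set \<Rightarrow> ('q, 'm :: finite) charted_space \<Rightarrow> 'q set \<Rightarrow> ('p \<Rightarrow> 'q) \<Rightarrow> bool" where
  "biholomorphism X W Y Z f \<longleftrightarrow>
     bij_betw f W Z \<and> holomorphic_map X W Y f \<and> holomorphic_map Y Z X (inv_into W f)"

text \<open>
  \<open>A\<close> is the matrix of the differential of \<open>f\<close> at its fixed point \<open>e\<close> in some chart around \<open>e\<close>;
  changing the chart conjugates \<open>A\<close>.
\<close>

definition differential_at_fixed_point ::
  "('p, 'n :: finite) charted_space \<Rightarrow> ('p \<Rightarrow> 'p) \<Rightarrow> 'p \<Rightarrow> complex ^ 'n ^ 'n \<Rightarrow> bool" where
  "differential_at_fixed_point X f e A \<longleftrightarrow>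
     f e = e \<and>
     (\<exists>(U, \<phi>)\<in>atlas X. e \<in> U \<and>
        ((\<phi> \<circ> f \<circ> inv_into U \<phi>) has_derivative (\<lambda>v. A *v v)) (at (\<phi> e)))"

section \<open>Diagonalization of a germ\<close>

text \<open>
  A germ is given by a representative, a total function whose values matter only near the origin
  (near the fibre over the origin, for self-maps of \<open>M\<close>).
\<close>

definition holomorphic_germ_fixing_0 :: "(complex ^ 'n \<Rightarrow> complex ^ 'n) \<Rightarrow> bool" where
  "holomorphic_germ_fixing_0 F \<longleftrightarrow> (\<exists>D. open D \<and> 0 \<in> D \<and> holomorphic_vec F D) \<and> F 0 = 0"

definition fibre_over_0 :: "('p, 'n :: finite) charted_space \<Rightarrow> ('p \<Rightarrow> complex ^ 'n) \<Rightarrow> 'p set" where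
  "fibre_over_0 M \<pi> = {x \<in> topspace (mtop M). \<pi> x = 0}"

definition projection_over_0 :: "('p, 'n :: finite) charted_space \<Rightarrow> ('p \<Rightarrow> complex ^ 'n) \<Rightarrow> bool" where
  "projection_over_0 M \<pi> \<longleftrightarrow>
     holomorphic_map M (topspace (mtop M)) complex_space \<pi> \<and>
     \<pi> ` topspace (mtop M) = UNIV \<and>
     biholomorphism M (topspace (mtop M) - fibre_over_0 M \<pi>) complex_space (- {0}) \<pi>"

definition germ_lift ::
  "(complex ^ 'n \<Rightarrow> complex ^ 'n) \<Rightarrow> ('p, 'n) charted_space \<Rightarrow> ('p \<Rightarrow> complex ^ 'n) \<Rightarrow> ('p \<Rightarrow> 'p) \<Rightarrow> bool"
  where
  "germ_lift F M \<pi> G \<longleftrightarrow>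
     (\<exists>W. fibre_over_0 M \<pi> \<subseteq> W \<and> holomorphic_map M W M G) \<and>
     (\<exists>W. openin (mtop M) W \<and> fibre_over_0 M \<pi> \<subseteq> W \<and> (\<forall>x\<in>W. \<pi> (G x) = F (\<pi> x)))"

definition diagonalization ::
  "(complex ^ 'n \<Rightarrow> complex ^ 'n) \<Rightarrow> ('p, 'n) charted_space \<Rightarrow> ('p \<Rightarrow> complex ^ 'n) \<Rightarrow> 'p \<Rightarrow>
   ('p \<Rightarrow> 'p) \<Rightarrow> complex ^ 'n ^ 'n \<Rightarrow> bool" where
  "diagonalization F M \<pi> e G A \<longleftrightarrow>
     complex_manifold M \<and> projection_over_0 M \<pi> \<and> germ_lift F M \<pi> G \<and>
     e \<in> fibre_over_0 M \<pi> \<and> differential_at_fixed_point M G e A \<and> diagonalizable A"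

type_synonym 'n manifold_point = "(complex ^ 'n) list"

text \<open>
  The existence of \<open>M\<close> is asserted over a type of points, since types cannot be quantified
  existentially. The choice loses nothing: every nonempty second countable Hausdorff manifold of
  positive dimension has the cardinality of the continuum, so it is isomorphic to one whose
  points form a subset of \<^typ>\<open>'n manifold_point\<close>. No structure of this type is used.
\<close>

end

theory Submission
  imports Defs "HOL-Complex_Analysis.Cauchy_Integral_Formula"
    "Jordan_Normal_Form.Jordan_Normal_Form_Existence"
begin

text \<open>
  Choose coordinates in which \<open>dF\<close> is a Jordan matrix \<open>A\<close>, and let \<open>z\<^sub>p, z\<^sub>q\<close> be the first two
  coordinates of a Jordan block of length at least two. Consider the monomial substitution
  \<open>z\<^sub>p = x s\<^sup>N\<close>, \<open>z\<^sub>q = x s\<^sup>N\<^sup>+\<^sup>1\<close>, \<open>z\<^sub>j = x s\<^sup>N\<^sup>+\<^sup>a\<^sup>j v\<^sub>j\<close>, with \<open>0 = a\<^sub>p < 1 = a\<^sub>q\<close>, with weights \<open>a\<^sub>j\<close> that increase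
  along every Jordan chain, and with \<open>N\<close> larger than all of them. In the coordinates \<open>(x, s, v\<^sub>j)\<close> an
  off-diagonal entry \<open>A\<^sub>j\<^sub>k\<close> is multiplied by \<open>s\<close> to the power \<open>a\<^sub>k - a\<^sub>j > 0\<close>, and the nonlinear terms of \<open>F\<close>
  are multiplied by a positive power of \<open>s\<close> as well. All of them vanish to second order at the
  origin \<open>e\<close> of the new coordinates, so the lift of \<open>F\<close> has a diagonal differential there: since
  substitutions are multiplicative, \<open>x\<close> has multiplier \<open>A\<^sub>p\<^sub>p\<close>, \<open>s\<close> has \<open>A\<^sub>q\<^sub>q / A\<^sub>p\<^sub>p = 1\<close>, and \<open>v\<^sub>j\<close> has
  \<open>A\<^sub>j\<^sub>j / A\<^sub>p\<^sub>p\<close>. If the first two blocks have the same length, one more variable is inserted,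
  \<open>z\<^sub>p = x y s\<^sup>N\<close>, \<open>z\<^sub>b = x y\<^sup>2 s\<^sup>N\<^sup>+\<^sup>a\<^sup>b\<close>, \<open>z\<^sub>j = x y s\<^sup>N\<^sup>+\<^sup>a\<^sup>j v\<^sub>j\<close>, where \<open>z\<^sub>b\<close> is the last coordinate of the second
  block; then \<open>y\<close> gets the multiplier \<open>A\<^sub>b\<^sub>b / A\<^sub>p\<^sub>p\<close>, and \<open>x\<close> gets \<open>A\<^sub>p\<^sub>p\<^sup>2 / A\<^sub>b\<^sub>b\<close>.

  Geometrically, the origin of \<open>\<complex>\<^sup>n\<close> is blown up; then (in the second case) the hyperplane \<open>z\<^sub>b = 0\<close> of
  the exceptional divisor is blown up, which is invariant because row \<open>b\<close> of \<open>A\<close> is diagonal; and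
  finally the point of the first exceptional divisor given by the eigenvector \<open>e\<^sub>p\<close> is replaced by a
  divisor \<open>s = 0\<close>. Of the last divisor only an affine space \<open>\<complex>\<^sup>n\<^sup>-\<^sup>1\<close> is kept, so the projection is not
  proper. This is harmless: the lift acts on that affine space by a diagonal linear map, and it maps
  the complement of the removed points to itself, hence it is defined along the whole fibre.

  To avoid computing in many charts, \<open>M\<close> is built as the quotient of an open subset of \<open>\<complex>\<^sup>n\<^sup>+\<^sup>3\<close>, with
  coordinates \<open>(x, y, s, v)\<close>, by a torus \<open>(\<complex>\<^sup>*)\<^sup>3\<close>: these are the homogeneous coordinates of the
  modification as a toric variety. Charts are slices on which three coordinates are normalized to
  \<open>1\<close>, so that chart changes are restrictions of holomorphic maps of \<open>\<complex>\<^sup>n\<^sup>+\<^sup>3\<close> (locale \<open>quotient_atlas\<close>).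
  The lift has the single global formula \<open>(x, y, s, v) \<mapsto> (x, y, s, h)\<close>, where \<open>h\<^sub>j\<close> is \<open>F\<^sub>j\<close> divided by the
  monomial in front of \<open>v\<^sub>j\<close>. That the quotient is holomorphic follows from Hadamard's lemma
  (\<open>hadamard_second_order\<close>), the only analysis in the proof; equivariance under the torus makes it
  descend to \<open>M\<close>. The proof that the quotient is Hausdorff (\<open>hausdorff_orbits\<close>) exhibits enough
  invariants of the torus action to separate orbits.
\<close>

no_notation Matrix.vec_index (infixl \<open>$\<close> 100)
no_notation fps_nth (infixl \<open>$\<close> 75)

lemmas cart_eq_iff = Finite_Cartesian_Product.vec_eq_iff

abbreviation identity_matrix :: "complex ^ 'n ^ 'n" where
  "identity_matrix \<equiv> Finite_Cartesian_Product.mat 1"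

section \<open>Holomorphic functions of several variables\<close>

text \<open>
  Complex differentiability is used pointwise and for scalar functions, with a derivative that
  commutes with complex scalars instead of one that is given by a matrix. In this form it is closed
  under all algebraic operations and under composition; holomorphic maps are treated componentwise.
\<close>

definition cdiff_at :: "(complex ^ 'm \<Rightarrow> complex) \<Rightarrow> complex ^ 'm \<Rightarrow> bool" where
  "cdiff_at f z \<longleftrightarrow> (\<exists>D. (f has_derivative D) (at z) \<and> (\<forall>c h. D (c *s h) = c * D h))"

lemma cdiff_atI: "(f has_derivative D) (at z) \<Longrightarrow> (\<And>c h. D (c *s h) = c * D h) \<Longrightarrow> cdiff_at f z"
  unfolding cdiff_at_def by blast

lemma cdiff_at_const [simp]: "cdiff_at (\<lambda>z. c) z"
  by (rule cdiff_atI[where D = "\<lambda>_. 0"]) auto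

lemma cdiff_at_coord [simp]: "cdiff_at (\<lambda>z. z $ j) z"
  by (rule cdiff_atI[where D = "\<lambda>h. h $ j"])
    (auto intro!: bounded_linear_imp_has_derivative bounded_linear_vec_nth)

lemma cdiff_at_add [intro]: "cdiff_at f z \<Longrightarrow> cdiff_at g z \<Longrightarrow> cdiff_at (\<lambda>z. f z + g z) z"
  unfolding cdiff_at_def
proof (elim exE conjE)
  fix D E assume "(f has_derivative D) (at z)" "(g has_derivative E) (at z)"
    "\<forall>c h. D (c *s h) = c * D h" "\<forall>c h. E (c *s h) = c * E h"
  then show "\<exists>D. ((\<lambda>z. f z + g z) has_derivative D) (at z) \<and> (\<forall>c h. D (c *s h) = c * D h)"
    by (intro exI[of _ "\<lambda>h. D h + E h"]) (auto intro!: has_derivative_add simp: distrib_left)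
qed

lemma cdiff_at_mult [intro]:
  assumes "cdiff_at f z" "cdiff_at g z" shows "cdiff_at (\<lambda>z. f z * g z) z"
proof -
  obtain D E where D: "(f has_derivative D) (at z)" "\<forall>c h. D (c *s h) = c * D h"
    and E: "(g has_derivative E) (at z)" "\<forall>c h. E (c *s h) = c * E h"
    using assms unfolding cdiff_at_def by blast
  show ?thesis
    using has_derivative_mult[OF D(1) E(1)] by (rule cdiff_atI) (simp add: D(2) E(2) algebra_simps)
qed

lemma cdiff_at_uminus [intro]: "cdiff_at f z \<Longrightarrow> cdiff_at (\<lambda>z. - f z) z"
  using cdiff_at_mult[of "\<lambda>z. -1" z f] by simp

lemma cdiff_at_diff [intro]: "cdiff_at f z \<Longrightarrow> cdiff_at g z \<Longrightarrow> cdiff_at (\<lambda>z. f z - g z) z"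
  using cdiff_at_add[of f z "\<lambda>z. - g z"] cdiff_at_uminus[of g z] by simp

lemma cdiff_at_power [intro]: "cdiff_at f z \<Longrightarrow> cdiff_at (\<lambda>z. f z ^ k) z"
  by (induction k) auto

lemma cdiff_at_sum [intro]:
  "(\<And>i. i \<in> I \<Longrightarrow> cdiff_at (f i) z) \<Longrightarrow> cdiff_at (\<lambda>z. \<Sum>i\<in>I. f i z) z"
  by (induction I rule: infinite_finite_induct) auto

lemma cdiff_at_comp_field:
  assumes "cdiff_at f z" "(g has_field_derivative g') (at (f z))"
  shows "cdiff_at (\<lambda>z. g (f z)) z"
proof -
  obtain D where D: "(f has_derivative D) (at z)" "\<forall>c h. D (c *s h) = c * D h"
    using assms unfolding cdiff_at_def by blast
  have "((\<lambda>z. g (f z)) has_derivative (\<lambda>h. g' * D h)) (at z)"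
    using has_derivative_compose[OF D(1)] assms(2)[unfolded has_field_derivative_def] by fastforce
  then show ?thesis by (rule cdiff_atI) (simp add: D(2))
qed

lemma cdiff_at_inverse [intro]: "cdiff_at f z \<Longrightarrow> f z \<noteq> 0 \<Longrightarrow> cdiff_at (\<lambda>z. inverse (f z)) z"
  by (rule cdiff_at_comp_field[OF _ DERIV_inverse]) auto

lemma cdiff_at_divide [intro]:
  "cdiff_at f z \<Longrightarrow> cdiff_at g z \<Longrightarrow> g z \<noteq> 0 \<Longrightarrow> cdiff_at (\<lambda>z. f z / g z) z"
  using cdiff_at_mult[of f z "\<lambda>z. inverse (g z)"] by (simp add: cdiff_at_inverse divide_inverse)

lemma cdiff_at_isCont: "cdiff_at f z \<Longrightarrow> isCont f z"
  unfolding cdiff_at_def using has_derivative_continuous by (elim exE conjE)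

lemma cdiff_at_imp_continuous_on: "(\<And>z. z \<in> S \<Longrightarrow> cdiff_at f z) \<Longrightarrow> continuous_on S f"
  by (meson cdiff_at_isCont continuous_at_imp_continuous_on)

lemma cdiff_at_cong:
  assumes "cdiff_at f z" "open S" "z \<in> S" "\<And>w. w \<in> S \<Longrightarrow> f w = g w" shows "cdiff_at g z"
proof -
  obtain D where D: "(f has_derivative D) (at z)" "\<forall>c h. D (c *s h) = c * D h"
    using assms(1) unfolding cdiff_at_def by blast
  show ?thesis
    using has_derivative_transform_within_open[OF D(1) assms(2,3,4)] D(2)
    by (auto intro: cdiff_atI)
qed

lemma has_derivative_vec_iff:
  "(f has_derivative D) (at z) \<longleftrightarrow> (\<forall>j. ((\<lambda>z. f z $ j) has_derivative (\<lambda>h. D h $ j)) (at z))"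
  for f :: "'a::euclidean_space \<Rightarrow> complex ^ 'm"
proof
  assume "(f has_derivative D) (at z)"
  then show "\<forall>j. ((\<lambda>z. f z $ j) has_derivative (\<lambda>h. D h $ j)) (at z)"
    by (intro allI bounded_linear.has_derivative[OF bounded_linear_vec_nth])
next
  assume *: "\<forall>j. ((\<lambda>z. f z $ j) has_derivative (\<lambda>h. D h $ j)) (at z)"
  have ax: "bounded_linear (axis j :: complex \<Rightarrow> complex ^ 'm)" for j
    by (rule linear_conv_bounded_linear[THEN iffD1], rule linearI)
       (auto simp: axis_def cart_eq_iff)
  have "((\<lambda>z. \<Sum>j\<in>UNIV. axis j (f z $ j)) has_derivative (\<lambda>h. \<Sum>j\<in>UNIV. axis j (D h $ j))) (at z)"
    by (intro has_derivative_sum bounded_linear.has_derivative[OF ax] *[rule_format])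
  moreover have "(\<Sum>j\<in>UNIV. axis j (v $ j)) = v" for v :: "complex ^ 'm"
    by (auto simp: cart_eq_iff axis_def if_distrib sum.delta cong: if_cong)
  ultimately show "(f has_derivative D) (at z)" by simp
qed

lemma complex_linear_expand:
  fixes D :: "complex ^ 'm \<Rightarrow> complex"
  assumes "linear D" "\<And>c h. D (c *s h) = c * D h"
  shows "D h = (\<Sum>k\<in>UNIV. D (axis k 1) * h $ k)"
proof -
  have "h = (\<Sum>k\<in>UNIV. h $ k *s axis k 1)"
    by (auto simp: cart_eq_iff axis_def if_distrib sum.delta cong: if_cong)
  then have "D h = (\<Sum>k\<in>UNIV. D (h $ k *s axis k 1))"
    using linear_sum[OF assms(1), of "\<lambda>k. h $ k *s axis k 1" UNIV] by simp
  then show ?thesis by (simp add: assms(2) mult.commute)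
qed

lemma holomorphic_vec_iff:
  "holomorphic_vec f S \<longleftrightarrow> (\<forall>z\<in>S. \<forall>j. cdiff_at (\<lambda>w. f w $ j) z)"
proof (intro iffI ballI allI)
  fix z j assume "holomorphic_vec f S" "z \<in> S"
  then obtain A where "(f has_derivative (\<lambda>v. A *v v)) (at z)"
    unfolding holomorphic_vec_def by blast
  then have "((\<lambda>w. f w $ j) has_derivative (\<lambda>v. (A *v v) $ j)) (at z)"
    using has_derivative_vec_iff by blast
  then show "cdiff_at (\<lambda>w. f w $ j) z"
    by (rule cdiff_atI) (simp add: matrix_vector_mult_def sum_distrib_left mult_ac)
next
  assume *: "\<forall>z\<in>S. \<forall>j. cdiff_at (\<lambda>w. f w $ j) z"
  show "holomorphic_vec f S"
    unfolding holomorphic_vec_def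
  proof
    fix z assume "z \<in> S"
    then have "\<forall>j. \<exists>D. ((\<lambda>w. f w $ j) has_derivative D) (at z) \<and> (\<forall>c h. D (c *s h) = c * D h)"
      using * unfolding cdiff_at_def by simp
    from choice[OF this] obtain D where "\<forall>j. ((\<lambda>w. f w $ j) has_derivative D j) (at z) \<and>
      (\<forall>c h. D j (c *s h) = c * D j h)" ..
    then have D: "\<And>j. ((\<lambda>w. f w $ j) has_derivative D j) (at z)"
      "\<And>j c h. D j (c *s h) = c * D j h" by auto
    have eq: "((\<chi> j k. D j (axis k 1)) *v h) $ j = D j h" for j h
      by (subst complex_linear_expand[OF has_derivative_linear[OF D(1)] D(2)])
        (simp add: matrix_vector_mult_def)
    then have "(f has_derivative (\<lambda>h. (\<chi> j k. D j (axis k 1)) *v h)) (at z)"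
      unfolding has_derivative_vec_iff using D(1) by (simp only: eq simp_thms all_simps)
    then show "\<exists>A. (f has_derivative (*v) A) (at z)" by blast
  qed
qed

lemma cdiff_at_compose:
  assumes "cdiff_at g (f z)" "\<And>j. cdiff_at (\<lambda>w. f w $ j) z"
  shows "cdiff_at (\<lambda>w. g (f w)) z"
proof -
  obtain E where E: "(g has_derivative E) (at (f z))" "\<forall>c h. E (c *s h) = c * E h"
    using assms unfolding cdiff_at_def by blast
  have "holomorphic_vec f {z}" using assms(2) by (simp add: holomorphic_vec_iff)
  then obtain A where A: "(f has_derivative (\<lambda>v. A *v v)) (at z)"
    unfolding holomorphic_vec_def by blast
  show ?thesis
    using has_derivative_compose[OF A E(1)]
    by (rule cdiff_atI) (simp add: E(2) vector_scalar_commute)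
qed

lemma norm_vector_scalar_mult: "norm (c *s h) = norm c * norm h" for h :: "complex ^ 'm"
  by (simp add: norm_vec_def norm_mult L2_set_right_distrib)

lemma has_field_derivative_along_line:
  fixes f :: "complex ^ 'm \<Rightarrow> complex"
  assumes "(f has_derivative D) (at (z + u *s h))" "\<And>c h. D (c *s h) = c * D h"
  shows "((\<lambda>u. f (z + u *s h)) has_field_derivative D h) (at u)"
proof -
  have "((\<lambda>u. z + u *s h) has_derivative (\<lambda>v. v *s h)) (at u)"
    unfolding has_derivative_vec_iff vector_add_component vector_smult_component
    by (auto intro!: derivative_eq_intros)
  from has_derivative_compose[OF this assms(1)]
  show ?thesis unfolding has_field_derivative_def
    by (rule has_derivative_eq_rhs) (auto simp: assms(2))
qed

text \<open>
  Cauchy's formula on a complex line writes a directional derivative as an integral of the function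
  itself. It is the source of all continuity statements about derivatives.
\<close>

lemma directional_derivative_Cauchy:
  assumes D: "(f has_derivative D) (at z)" "\<And>c h. D (c *s h) = c * D h"
    and e: "e > 0" "\<And>u. norm u \<le> e \<Longrightarrow> cdiff_at f (z + u *s h)"
  shows "D h = 1 / (2 * of_real pi * \<i>) *
    integral {0..1} (\<lambda>t. f (z + circlepath 0 e t *s h) / (circlepath 0 e t)\<^sup>2 *
                        (2 * of_real pi * \<i> * of_real e * exp (2 * of_real pi * \<i> * of_real t)))"
proof -
  define g where "g = (\<lambda>u. f (z + u *s h))"
  have fd: "g field_differentiable at u" if u: "norm u \<le> e" for u
  proof -
    obtain E where E: "(f has_derivative E) (at (z + u *s h))" "\<forall>c h. E (c *s h) = c * E h"
      using e(2)[OF u] unfolding cdiff_at_def by auto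
    have "(g has_field_derivative E h) (at u)"
      unfolding g_def by (rule has_field_derivative_along_line[OF E(1)]) (use E(2) in auto)
    then show ?thesis unfolding field_differentiable_def ..
  qed
  have hol: "g holomorphic_on cball 0 e"
    by (auto simp: holomorphic_on_def intro!: field_differentiable_at_within fd)
  have 1: "(g has_field_derivative (1 / (2 * of_real pi * \<i>) *
      contour_integral (circlepath 0 e) (\<lambda>u. g u / (u - 0)^2))) (at 0)"
    by (rule Cauchy_derivative_integral_circlepath(2))
       (use e(1) hol in \<open>auto intro: holomorphic_on_subset holomorphic_on_imp_continuous_on\<close>)
  have 2: "(g has_field_derivative D h) (at 0)"
    using has_field_derivative_along_line[of f D z 0 h] D unfolding g_def by simp
  have "D h = 1 / (2 * of_real pi * \<i>) * contour_integral (circlepath 0 e) (\<lambda>u. g u / (u - 0)^2)"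
    using DERIV_unique[OF 2 1] .
  also have "contour_integral (circlepath 0 e) (\<lambda>u. g u / (u - 0)^2) = integral {0..1} 
     (\<lambda>t. f (z + circlepath 0 e t *s h) / (circlepath 0 e t)\<^sup>2 *
                        (2 * of_real pi * \<i> * of_real e * exp (2 * of_real pi * \<i> * of_real t)))"
    unfolding contour_integral_integral g_def
    by (rule integral_cong) (simp add: vector_derivative_circlepath)
  finally show ?thesis .
qed

text \<open>
  Differentiation under the integral sign. The Leibniz rule asks for a derivative that is continuous
  in the point and the parameter together; by Cauchy's formula this is a consequence of the
  continuity of the integrand.
\<close>

lemma cdiff_at_integral:
  fixes \<Phi> :: "complex ^ 'm \<Rightarrow> real \<Rightarrow> complex"
  assumes U: "open U" "z0 \<in> U"
    and diff: "\<And>z t. z \<in> U \<Longrightarrow> t \<in> {0..1} \<Longrightarrow> cdiff_at (\<lambda>z. \<Phi> z t) z"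
    and cont: "continuous_on (U \<times> {0..1}) (\<lambda>(z, t). \<Phi> z t)"
  shows "cdiff_at (\<lambda>z. integral {0..1} (\<Phi> z)) z0"
proof -
  obtain \<delta>' where \<delta>': "\<delta>' > 0" "cball z0 \<delta>' \<subseteq> U"
    using U open_contains_cball by blast
  define \<delta> where "\<delta> = \<delta>' / 2"
  have \<delta>: "\<delta> > 0" using \<delta>' by (simp add: \<delta>_def)
  define V where "V = ball z0 \<delta>"
  have VU: "z + v \<in> U" if "z \<in> V" "norm v \<le> \<delta>" for z v
  proof -
    have "dist z0 (z + v) \<le> dist z0 z + norm v"
      by (metis dist_norm dist_triangle add_diff_cancel_left' norm_minus_commute)
    then have "z + v \<in> cball z0 \<delta>'" using that by (auto simp: V_def \<delta>_def)
    then show ?thesis using \<delta>' by blast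
  qed
  have VU0: "V \<subseteq> U" using VU[where v = 0] \<delta> by auto
  define D where "D z t = (SOME D. ((\<lambda>z. \<Phi> z t) has_derivative D) (at z) \<and> (\<forall>c h. D (c *s h) = c * D h))"
    for z t
  have D: "((\<lambda>z. \<Phi> z t) has_derivative D z t) (at z)" "D z t (c *s h) = c * D z t h"
    if "z \<in> U" "t \<in> {0..1}" for z t c h
  proof -
    have "((\<lambda>z. \<Phi> z t) has_derivative D z t) (at z) \<and> (\<forall>c h. D z t (c *s h) = c * D z t h)"
      unfolding D_def by (rule someI_ex[OF diff[OF that, unfolded cdiff_at_def]])
    then show "((\<lambda>z. \<Phi> z t) has_derivative D z t) (at z)" "D z t (c *s h) = c * D z t h" by auto
  qed
  have Dcont: "continuous_on (V \<times> {0..1}) (\<lambda>(z, t). D z t h)" for h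
  proof -
    \<comment> \<open>the circle of radius \<open>e\<close> in the direction \<open>h\<close> has to stay within distance \<open>\<delta>\<close>\<close>
    define e where "e = \<delta> / (norm h + 1)"
    have "norm h + 1 > 0" by (smt (verit) norm_ge_zero)
    then have e: "e > 0" "e * norm h \<le> \<delta>"
      using \<delta> by (auto simp: e_def field_simps)
    have inU: "z + u *s h \<in> U" if "z \<in> V" "norm u \<le> e" for z u
    proof -
      have "norm (u *s h) \<le> e * norm h"
        using that by (simp add: norm_vector_scalar_mult mult_right_mono)
      then show ?thesis using VU[OF that(1)] e by auto
    qed
    have eq: "D z t h = 1 / (2 * of_real pi * \<i>) *
      integral (cbox 0 1) (\<lambda>s. \<Phi> (z + circlepath 0 e s *s h) t / (circlepath 0 e s)\<^sup>2 *
              (2 * of_real pi * \<i> * of_real e * exp (2 * of_real pi * \<i> * of_real s)))"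
      if "z \<in> V" "t \<in> {0..1}" for z t
      unfolding cbox_interval
    proof (rule directional_derivative_Cauchy[of "\<lambda>z. \<Phi> z t", OF _ _ e(1)])
      have zU: "z \<in> U" using that VU0 by blast
      show "((\<lambda>z. \<Phi> z t) has_derivative D z t) (at z)" by (rule D(1)[OF zU that(2)])
      show "D z t (c *s h) = c * D z t h" for c h by (rule D(2)[OF zU that(2)])
      show "cdiff_at (\<lambda>z. \<Phi> z t) (z + u *s h)" if "norm u \<le> e" for u
        by (rule diff[OF inU[OF \<open>z \<in> V\<close> that] \<open>t \<in> {0..1}\<close>])
    qed
    have ncirc: "norm (circlepath 0 e s) = e" for s
      using e(1) by (simp add: circlepath norm_mult)
    have circ0: "circlepath 0 e s \<noteq> 0" for s
      using ncirc[of s] e(1) by (metis norm_zero less_irrefl)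
    have cs: "continuous_on UNIV (circlepath 0 e)"
      unfolding circlepath by (intro continuous_intros)
    have "continuous_on ((V \<times> {0..1}) \<times> cbox 0 1) (\<lambda>x. case x of ((z, t), s) \<Rightarrow> \<Phi> (z + circlepath 0 e s *s h) t)"
    proof -
      have "continuous_on ((V \<times> {0..1}) \<times> cbox (0::real) 1)
        (\<lambda>x. (\<lambda>(z, t). \<Phi> z t) (fst (fst x) + circlepath 0 e (snd x) *s h, snd (fst x)))"
      proof (rule continuous_on_compose2[OF cont])
        show "continuous_on ((V \<times> {0..1}) \<times> cbox (0::real) 1)
            (\<lambda>x. (fst (fst x) + circlepath 0 e (snd x) *s h, snd (fst x)))"
          unfolding vector_scalar_mult_def circlepath by (intro continuous_intros)
        show "(\<lambda>x. (fst (fst x) + circlepath 0 e (snd x) *s h, snd (fst x))) `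
            ((V \<times> {0..1}) \<times> cbox 0 1) \<subseteq> U \<times> {0..1}"
          using inU ncirc by auto
      qed
      then show ?thesis by (simp add: case_prod_beta')
    qed
    then have c1: "continuous_on ((V \<times> {0..1}) \<times> cbox 0 1)
      (\<lambda>x. case x of (zt, s) \<Rightarrow> \<Phi> (fst zt + circlepath 0 e s *s h) (snd zt) / (circlepath 0 e s)\<^sup>2 *
              (2 * of_real pi * \<i> * of_real e * exp (2 * of_real pi * \<i> * of_real s)))"
      unfolding case_prod_beta'
      by (intro continuous_intros continuous_on_compose2[OF cs continuous_on_snd] ballI)
         (use e(1) in \<open>auto simp: circ0\<close>)
    have "continuous_on (V \<times> {0..1}) (\<lambda>zt. 1 / (2 * of_real pi * \<i>) *
       integral (cbox 0 1) (\<lambda>s. \<Phi> (fst zt + circlepath 0 e s *s h) (snd zt) / (circlepath 0 e s)\<^sup>2 *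
              (2 * of_real pi * \<i> * of_real e * exp (2 * of_real pi * \<i> * of_real s))))"
      by (rule continuous_on_mult[OF continuous_on_const integral_continuous_on_param[OF c1]])
    then show ?thesis
      by (rule continuous_on_eq) (auto simp: eq)
  qed
  define fx where "fx z t = Blinfun (D z t)" for z t
  have fx: "blinfun_apply (fx z t) = D z t" if "z \<in> V" "t \<in> {0..1}" for z t
    unfolding fx_def using D(1)[of z t] that VU0
    by (intro bounded_linear_Blinfun_apply has_derivative_bounded_linear) auto
  have fxc: "continuous_on (V \<times> cbox 0 1) (\<lambda>(z, t). fx z t)"
  proof (rule continuous_on_blinfun_componentwise)
    fix h :: "complex ^ 'm"
    show "continuous_on (V \<times> cbox 0 1) (\<lambda>x. blinfun_apply (case x of (z, t) \<Rightarrow> fx z t) h)"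
      unfolding cbox_interval by (rule continuous_on_eq[OF Dcont[of h]]) (auto simp: fx)
  qed
  have z0: "z0 \<in> V" using \<delta> by (simp add: V_def)
  have "((\<lambda>z. integral (cbox 0 1) (\<Phi> z)) has_derivative integral (cbox 0 1) (fx z0)) (at z0 within V)"
  proof (rule leibniz_rule[OF _ _ fxc z0])
    show "convex V" by (simp add: V_def)
    fix z assume z: "z \<in> V"
    have "continuous_on {0..1} (\<lambda>t. (\<lambda>(z, t). \<Phi> z t) (z, t))"
      by (rule continuous_on_compose2[OF cont]) (use z VU0 in \<open>auto intro!: continuous_intros\<close>)
    then show "\<Phi> z integrable_on cbox 0 1"
      by (auto intro: integrable_continuous_interval)
    fix t :: real assume "t \<in> cbox 0 1"
    then show "((\<lambda>x. \<Phi> x t) has_derivative blinfun_apply (fx z t)) (at z within V)"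
      using fx[OF z] D(1)[of z t] z VU0 by (auto intro: has_derivative_at_withinI)
  qed
  then have deriv: "((\<lambda>z. integral {0..1} (\<Phi> z)) has_derivative integral {0..1} (fx z0)) (at z0)"
    using z0 by (simp add: V_def at_within_open[OF _ open_ball])
  have "fx z0 integrable_on {0..1}"
  proof -
    have "continuous_on {0..1} (\<lambda>t. (\<lambda>(z, t). fx z t) (z0, t))"
      by (rule continuous_on_compose2[OF fxc]) (use z0 in \<open>auto intro!: continuous_intros\<close>)
    then show ?thesis by (auto intro: integrable_continuous_interval)
  qed
  then have ap: "blinfun_apply (integral {0..1} (fx z0)) h = integral {0..1} (\<lambda>t. D z0 t h)" for h
    using blinfun_apply_integral[of "fx z0" "{0..1}" h] integral_cong[of "{0..1}"
        "\<lambda>t. blinfun_apply (fx z0 t) h" "\<lambda>t. D z0 t h"] fx[OF z0]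
    by simp
  show ?thesis
  proof (rule cdiff_atI[OF deriv])
    fix c h
    have "integral {0..1} (\<lambda>t. D z0 t (c *s h)) = integral {0..1} (\<lambda>t. c * D z0 t h)"
      by (rule integral_cong) (rule D(2)[OF U(2)])
    also have "\<dots> = c * integral {0..1} (\<lambda>t. D z0 t h)"
      by (rule integral_mult_right)
    finally show "blinfun_apply (integral {0..1} (fx z0)) (c *s h) = c * blinfun_apply (integral {0..1} (fx z0)) h"
      unfolding ap .
  qed
qed

section \<open>Hadamard's lemma\<close>

definition polydisc :: "real \<Rightarrow> (complex ^ 'm) set" where
  "polydisc r = {z. \<forall>j. norm (z $ j) < r}"

definition replace_coord :: "complex ^ 'm \<Rightarrow> 'm \<Rightarrow> complex \<Rightarrow> complex ^ 'm" where
  "replace_coord z i w = (\<chi> j. if j = i then w else z $ j)"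

definition zero_coords :: "'m set \<Rightarrow> complex ^ 'm \<Rightarrow> complex ^ 'm" where
  "zero_coords S z = (\<chi> j. if j \<in> S then 0 else z $ j)"

lemma open_polydisc: "open (polydisc r :: (complex ^ 'm) set)"
proof -
  have "polydisc r = (\<Inter>j. {z :: complex ^ 'm. norm (z $ j) < r})"
    by (auto simp: polydisc_def)
  moreover have "open {z :: complex ^ 'm. norm (z $ j) < r}" for j
    by (intro open_Collect_less continuous_intros)
  ultimately show ?thesis by auto
qed

lemma polydisc_mono: "r \<le> r' \<Longrightarrow> polydisc r \<subseteq> polydisc r'"
  unfolding polydisc_def using less_le_trans by blast

lemma ex_polydisc_subset:
  fixes D :: "(complex ^ 'm) set"
  assumes "open D" "0 \<in> D" obtains r where "r > 0" "polydisc r \<subseteq> D"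
proof -
  obtain e where e: "e > 0" "ball 0 e \<subseteq> D" using assms open_contains_ball by blast
  define r where "r = e / real CARD('m)"
  have c: "real CARD('m) > 0" by simp
  have "r > 0" using e c by (simp add: r_def)
  moreover have "polydisc r \<subseteq> D"
  proof
    fix z :: "complex ^ 'm" assume z: "z \<in> polydisc r"
    have "norm z \<le> (\<Sum>j\<in>UNIV. norm (z $ j))" unfolding norm_vec_def by (rule L2_set_le_sum) simp
    also have "\<dots> < (\<Sum>j\<in>(UNIV :: 'm set). r)"
      by (rule sum_strict_mono) (use z in \<open>auto simp: polydisc_def\<close>)
    also have "\<dots> = e" using c by (simp add: r_def)
    finally show "z \<in> D" using e by auto
  qed
  ultimately show ?thesis using that by blast
qed

lemma cdiff_at_replace_coord_component:
  "cdiff_at (\<lambda>z. replace_coord z i w $ j) z"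
  by (cases "j = i") (auto simp: replace_coord_def)

text \<open>
  The quotient \<open>(f z - f (z with z\<^sub>i = 0)) / z\<^sub>i\<close> is, up to the factor \<open>2 \<pi> \<i>\<close>, the integral of
  \<open>f (z with z\<^sub>i = \<zeta>) / (\<zeta> (\<zeta> - z\<^sub>i))\<close> over a circle in the variable \<open>\<zeta>\<close>. The integral is holomorphic in
  all variables, also where \<open>z\<^sub>i = 0\<close>.
\<close>

lemma divide_by_coordinate:
  fixes f :: "complex ^ 'm \<Rightarrow> complex"
  assumes f: "\<And>z. z \<in> polydisc r \<Longrightarrow> cdiff_at f z" and r: "0 < r'" "r' < r"
  shows "\<exists>g. (\<forall>z\<in>polydisc r'. cdiff_at g z \<and> f z = f (replace_coord z i 0) + z $ i * g z)"
proof -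
  define R where "R = (r + r') / 2"
  have R: "R > 0" "r' < R" "R < r" using r by (auto simp: R_def)
  define c where "c = circlepath 0 R"
  have nc: "norm (c t) = R" for t using R by (simp add: c_def circlepath norm_mult)
  define \<Phi> where "\<Phi> z t = f (replace_coord z i (c t)) / (c t * (c t - z $ i)) *
    (2 * of_real pi * \<i> * of_real R * exp (2 * of_real pi * \<i> * of_real t))" for z t
  define g where "g z = 1 / (2 * of_real pi * \<i>) * integral {0..1} (\<Phi> z)" for z
  have c0: "c t \<noteq> 0" for t using nc[of t] R by auto
  have cz: "c t - z $ i \<noteq> 0" if "z \<in> polydisc r'" for t and z :: "complex ^ 'm"
  proof
    assume "c t - z $ i = 0"
    then have "norm (z $ i) = R" using nc[of t] by simp
    moreover have "norm (z $ i) < r'" using that by (simp add: polydisc_def)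
    ultimately show False using R by simp
  qed
  have rep: "replace_coord z i u \<in> polydisc r" if "z \<in> polydisc r'" "norm u \<le> R" for u and z :: "complex ^ 'm"
  proof -
    have "norm (z $ j) < r" for j using that R by (auto simp: polydisc_def intro: less_trans)
    then show ?thesis using that R by (auto simp: polydisc_def replace_coord_def)
  qed
  have fcont: "continuous_on (polydisc r) f"
    using f by (rule cdiff_at_imp_continuous_on)
  have "cdiff_at g z" if z: "z \<in> polydisc r'" for z :: "complex ^ 'm"
    unfolding g_def
  proof (intro cdiff_at_mult cdiff_at_const cdiff_at_integral[OF open_polydisc z])
    fix t and z :: "complex ^ 'm" assume z: "z \<in> polydisc r'" and t: "t \<in> {0..1::real}"
    show "cdiff_at (\<lambda>z. \<Phi> z t) z"
      unfolding \<Phi>_def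
      by (intro cdiff_at_mult cdiff_at_divide cdiff_at_diff cdiff_at_const cdiff_at_coord
            cdiff_at_compose[where g = f, OF f] rep cdiff_at_replace_coord_component)
         (use z nc c0 cz in auto)
  next
    have cs: "continuous_on UNIV c"
      unfolding c_def circlepath by (intro continuous_intros)
    have 1: "continuous_on (polydisc r' \<times> {0..1}) (\<lambda>x. f (replace_coord (fst x) i (c (snd x))))"
    proof (rule continuous_on_compose2[OF fcont])
      show "continuous_on (polydisc r' \<times> {0..1}) (\<lambda>x. replace_coord (fst x) i (c (snd x)))"
      proof (unfold continuous_on_vec_lambda replace_coord_def, intro continuous_on_vec_lambda)
        fix j show "continuous_on (polydisc r' \<times> {0..1})
            (\<lambda>x. if j = i then c (snd x) else fst x $ j)"
          by (cases "j = i")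
             (auto intro!: continuous_intros continuous_on_compose2[OF cs continuous_on_snd])
      qed
    qed (use rep nc in auto)
    have 2: "continuous_on (polydisc r' \<times> {0..1}) (\<lambda>x. c (snd x))"
      by (rule continuous_on_compose2[OF cs]) (auto intro!: continuous_intros)
    show "continuous_on (polydisc r' \<times> {0..1}) (\<lambda>(z, t). \<Phi> z t)"
      unfolding \<Phi>_def case_prod_beta'
      by (intro continuous_on_mult continuous_on_divide 1 2 continuous_on_diff continuous_intros)
         (use c0 cz in auto)
  qed
  moreover have "f z = f (replace_coord z i 0) + z $ i * g z" if z: "z \<in> polydisc r'" for z :: "complex ^ 'm"
  proof -
    define \<phi> where "\<phi> u = f (replace_coord z i u)" for u
    have line: "replace_coord z i u = replace_coord z i 0 + u *s axis i 1" for u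
      by (auto simp: replace_coord_def axis_def cart_eq_iff)
    have \<phi>_line: "\<phi> = (\<lambda>u. f (replace_coord z i 0 + u *s axis i 1))"
      unfolding \<phi>_def by (intro ext arg_cong[where f = f] line)
    have fd: "\<phi> field_differentiable at u" if u: "norm u \<le> R" for u
    proof -
      obtain E where E: "(f has_derivative E) (at (replace_coord z i u))" "\<forall>c h. E (c *s h) = c * E h"
        using f[OF rep[OF z u]] unfolding cdiff_at_def by auto
      have "(\<phi> has_field_derivative E (axis i 1)) (at u)"
        unfolding \<phi>_line using E(2)
        by (intro has_field_derivative_along_line[OF E(1)[unfolded line[of u]]]) auto
      then show ?thesis unfolding field_differentiable_def ..
    qed
    have hol: "\<phi> holomorphic_on cball 0 R"
      by (auto simp: holomorphic_on_def intro!: field_differentiable_at_within fd)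
    have zi: "norm (z $ i - 0) < R" using z R by (auto simp: polydisc_def intro: less_trans)
    have 1: "((\<lambda>u. \<phi> u / (u - z $ i)) has_contour_integral 2 * of_real pi * \<i> * \<phi> (z $ i)) c"
      unfolding c_def by (rule Cauchy_integral_circlepath_simple[OF hol zi])
    have 2: "((\<lambda>u. \<phi> u / (u - 0)) has_contour_integral 2 * of_real pi * \<i> * \<phi> 0) c"
      unfolding c_def by (rule Cauchy_integral_circlepath_simple[OF hol]) (use R in auto)
    have 3: "((\<lambda>u. \<phi> u / (u - z $ i) - \<phi> u / (u - 0)) has_contour_integral
        2 * of_real pi * \<i> * \<phi> (z $ i) - 2 * of_real pi * \<i> * \<phi> 0) c"
      by (rule has_contour_integral_diff[OF 1 2])
    have "2 * of_real pi * \<i> * \<phi> (z $ i) - 2 * of_real pi * \<i> * \<phi> 0 =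
        contour_integral c (\<lambda>u. \<phi> u / (u - z $ i) - \<phi> u / (u - 0))"
      using contour_integral_unique[OF 3] by simp
    also have "\<dots> = integral {0..1} (\<lambda>t. (\<phi> (c t) / (c t - z $ i) - \<phi> (c t) / (c t - 0)) *
       vector_derivative c (at t))"
      unfolding contour_integral_integral ..
    also have "\<dots> = integral {0..1} (\<lambda>t. z $ i * \<Phi> z t)"
    proof (rule integral_cong)
      fix t :: real
      have "\<phi> (c t) / (c t - z $ i) - \<phi> (c t) / (c t - 0) = z $ i * (\<phi> (c t) / (c t * (c t - z $ i)))"
        using c0[of t] cz[OF z, of t] by (simp add: field_simps)
      then show "(\<phi> (c t) / (c t - z $ i) - \<phi> (c t) / (c t - 0)) * vector_derivative c (at t) = z $ i * \<Phi> z t"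
        by (simp add: \<Phi>_def \<phi>_def c_def vector_derivative_circlepath)
    qed
    also have "\<dots> = z $ i * integral {0..1} (\<Phi> z)"
      by (rule integral_mult_right)
    finally have "\<phi> (z $ i) - \<phi> 0 = z $ i * g z"
      unfolding g_def by (simp add: field_simps)
    moreover have "replace_coord z i (z $ i) = z"
      by (auto simp: replace_coord_def cart_eq_iff)
    ultimately show ?thesis by (simp add: \<phi>_def algebra_simps)
  qed
  ultimately show ?thesis by blast
qed

text \<open>
  Hadamard's lemma, one coordinate at a time: after the coordinates in \<open>S\<close> have been set to zero, the
  next one is split off from the remaining function.
\<close>

lemma expand_in_coordinates:
  fixes f :: "complex ^ 'm \<Rightarrow> complex" and S :: "'m set"
  assumes f: "\<And>z. z \<in> polydisc r \<Longrightarrow> cdiff_at f z" and r: "0 < r'" "r' < r"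
  shows "\<exists>g. (\<forall>i. \<forall>z\<in>polydisc r'. cdiff_at (g i) z) \<and>
    (\<forall>z\<in>polydisc r'. f z = f (zero_coords S z) + (\<Sum>i\<in>S. z $ i * g i z))"
proof -
  have "finite S" by simp
  then show ?thesis
  proof (induction S rule: finite_induct)
    case empty
    show ?case by (rule exI[of _ "\<lambda>_ _. 0"]) (simp add: zero_coords_def)
  next
    case (insert i S)
    then obtain g where g: "\<forall>i. \<forall>z\<in>polydisc r'. cdiff_at (g i) z"
      "\<forall>z\<in>polydisc r'. f z = f (zero_coords S z) + (\<Sum>i\<in>S. z $ i * g i z)" by blast
    obtain h where h: "\<forall>z\<in>polydisc r'. cdiff_at h z \<and> f z = f (replace_coord z i 0) + z $ i * h z"
      using divide_by_coordinate[OF f r, of i] by blast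
    have zS: "zero_coords S z \<in> polydisc r'" if "z \<in> polydisc r'" for z
      using that r by (auto simp: polydisc_def zero_coords_def)
    have zc: "cdiff_at (\<lambda>z. zero_coords S z $ j) z" for z j
      by (cases "j \<in> S") (auto simp: zero_coords_def)
    define g' where "g' k z = (if k = i then h (zero_coords S z) else g k z)" for k z
    show ?case
    proof (intro exI[of _ g'] conjI allI ballI)
      fix k and z :: "complex ^ 'm" assume z: "z \<in> polydisc r'"
      have "cdiff_at (\<lambda>z. h (zero_coords S z)) z"
        by (rule cdiff_at_compose) (use h zS[OF z] zc in auto)
      then show "cdiff_at (g' k) z"
        using g(1) z by (cases "k = i") (simp_all add: g'_def[abs_def])
    next
      fix z :: "complex ^ 'm" assume z: "z \<in> polydisc r'"
      have rz: "replace_coord (zero_coords S z) i 0 = zero_coords (insert i S) z"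
        by (auto simp: replace_coord_def zero_coords_def cart_eq_iff)
      have "f (zero_coords S z) = f (zero_coords (insert i S) z) + zero_coords S z $ i * h (zero_coords S z)"
        using h zS[OF z] rz by metis
      also have "zero_coords S z $ i = z $ i"
        using insert.hyps by (simp add: zero_coords_def)
      finally have 1: "f (zero_coords S z) = f (zero_coords (insert i S) z) + z $ i * g' i z"
        by (simp add: g'_def)
      have 2: "(\<Sum>k\<in>S. z $ k * g' k z) = (\<Sum>k\<in>S. z $ k * g k z)"
        using insert.hyps by (intro sum.cong) (auto simp: g'_def)
      show "f z = f (zero_coords (insert i S) z) + (\<Sum>k\<in>insert i S. z $ k * g' k z)"
        using g(2) z insert.hyps by (simp add: 1 2)
    qed
  qed
qed

lemma hadamard_first_order:
  fixes f :: "complex ^ 'm \<Rightarrow> complex"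
  assumes f: "\<And>z. z \<in> polydisc r \<Longrightarrow> cdiff_at f z" and r: "0 < r'" "r' < r"
  shows "\<exists>g. (\<forall>i. \<forall>z\<in>polydisc r'. cdiff_at (g i) z) \<and>
    (\<forall>z\<in>polydisc r'. f z = f 0 + (\<Sum>i\<in>UNIV. z $ i * g i z))"
proof -
  have "zero_coords UNIV z = 0" for z :: "complex ^ 'm"
    by (simp add: zero_coords_def cart_eq_iff)
  then show ?thesis using expand_in_coordinates[OF f r, of UNIV] by simp
qed

text \<open>
  Applying the first order expansion twice shows that the nonlinear part of \<open>f\<close> lies in the square of
  the maximal ideal, with holomorphic coefficients. Everything after this lemma is algebra with the
  coefficients \<open>q\<close>.
\<close>

lemma hadamard_second_order:
  fixes f :: "complex ^ 'm \<Rightarrow> complex"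
  assumes "open D" "0 \<in> D" and f: "\<And>z. z \<in> D \<Longrightarrow> cdiff_at f z" and f0: "f 0 = 0"
    and df: "(f has_derivative (\<lambda>h. \<Sum>k\<in>UNIV. a k * h $ k)) (at 0)"
  shows "\<exists>r q. r > 0 \<and> (\<forall>i k. \<forall>z\<in>polydisc r. cdiff_at (q i k) z) \<and>
    (\<forall>z\<in>polydisc r. f z = (\<Sum>k\<in>UNIV. a k * z $ k) + (\<Sum>k\<in>UNIV. \<Sum>i\<in>UNIV. z $ k * z $ i * q k i z))"
proof -
  obtain r where r: "r > 0" "polydisc r \<subseteq> D" using ex_polydisc_subset assms(1,2) by blast
  obtain g where g: "\<forall>i. \<forall>z\<in>polydisc (r / 2). cdiff_at (g i) z"
    "\<forall>z\<in>polydisc (r / 2). f z = (\<Sum>i\<in>UNIV. z $ i * g i z)"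
    using hadamard_first_order[of r f "r / 2"] f r f0 by auto
  have p0: "0 \<in> polydisc (r / 2)" using r by (auto simp: polydisc_def)
  have g0: "g k 0 = a k" for k
  proof -
    have "\<forall>i. \<exists>E. (g i has_derivative E) (at 0)"
      using g(1) p0 unfolding cdiff_at_def by blast
    then obtain E where E: "\<And>i. (g i has_derivative E i) (at 0)" by metis
    have "((\<lambda>z. \<Sum>i\<in>UNIV. z $ i * g i z) has_derivative
       (\<lambda>h. \<Sum>i\<in>UNIV. (0::complex ^ 'm) $ i * E i h + h $ i * g i 0)) (at 0)"
      by (intro has_derivative_sum has_derivative_mult bounded_linear_imp_has_derivative
          bounded_linear_vec_nth E)
    then have "(f has_derivative (\<lambda>h. \<Sum>i\<in>UNIV. h $ i * g i 0)) (at 0)"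
      using has_derivative_transform_within_open[OF _ open_polydisc p0, of _ _ UNIV f] g(2) by simp
    then have "(\<lambda>h. \<Sum>i\<in>UNIV. h $ i * g i 0) = (\<lambda>h. \<Sum>k\<in>UNIV. a k * h $ k)"
      using df has_derivative_unique by blast
    from fun_cong[OF this, of "axis k 1"] show ?thesis
      by (simp add: axis_def if_distrib[of "\<lambda>x. x * _"] if_distrib[of "\<lambda>x. _ * x"] cong: if_cong)
  qed
  have "\<forall>k. \<exists>q. (\<forall>i. \<forall>z\<in>polydisc (r / 4). cdiff_at (q i) z) \<and>
    (\<forall>z\<in>polydisc (r / 4). g k z = g k 0 + (\<Sum>i\<in>UNIV. z $ i * q i z))"
    using g(1) r by (intro allI hadamard_first_order[of "r / 2"]) auto
  from choice[OF this] obtain q where q: "\<forall>k. (\<forall>i. \<forall>z\<in>polydisc (r / 4). cdiff_at (q k i) z) \<and>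
    (\<forall>z\<in>polydisc (r / 4). g k z = g k 0 + (\<Sum>i\<in>UNIV. z $ i * q k i z))" ..
  show ?thesis
  proof (intro exI[of _ "r / 4"] exI[of _ q] conjI allI ballI)
    show "r / 4 > 0" using r by simp
    show "cdiff_at (q i k) z" if "z \<in> polydisc (r / 4)" for i k z using q that by blast
    fix z :: "complex ^ 'm" assume z: "z \<in> polydisc (r / 4)"
    then have "z \<in> polydisc (r / 2)" using polydisc_mono[of "r / 4" "r / 2"] r by auto
    then have "f z = (\<Sum>k\<in>UNIV. z $ k * g k z)" using g(2) by blast
    also have "\<dots> = (\<Sum>k\<in>UNIV. z $ k * (a k + (\<Sum>i\<in>UNIV. z $ i * q k i z)))"
      using q z g0 by simp
    also have "\<dots> = (\<Sum>k\<in>UNIV. a k * z $ k) + (\<Sum>k\<in>UNIV. \<Sum>i\<in>UNIV. z $ k * z $ i * q k i z)"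
      by (simp add: distrib_left sum.distrib sum_distrib_left mult_ac)
    finally show "f z = \<dots>" .
  qed
qed

lemma cdiff_at_imp_continuous_on_vec:
  assumes "\<And>z k. z \<in> S \<Longrightarrow> cdiff_at (\<lambda>z. f z $ k) z" shows "continuous_on S f"
proof -
  have "continuous_on S (\<lambda>z. \<chi> k. f z $ k)"
    by (intro continuous_on_vec_lambda cdiff_at_imp_continuous_on assms)
  then show ?thesis by simp
qed

section \<open>Complex manifolds as quotients of open sets\<close>

text \<open>
  An atlas on a quotient of an open subset of \<open>\<complex>\<^sup>m\<close>. Points are values of the class map \<open>r\<close>. The
  chart \<open>i\<close> lives on the classes of points of the open set \<open>\<Omega> i\<close>; its inverse is represented by a
  holomorphic slice \<open>\<iota> i\<close>, and \<open>\<tau> i\<close> moves a point along its class into that slice. Consequently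
  every map that is induced by a holomorphic map \<open>\<Phi>\<close> of \<open>\<complex>\<^sup>m\<close> has the chart expression
  \<open>\<tau> j \<circ> \<Phi> \<circ> \<iota> i\<close>, and no pair of charts has to be compared explicitly. Two points of a common chart are
  separated by it, so \<open>separated\<close> only speaks about the others.
\<close>

locale quotient_atlas =
  fixes r :: "complex ^ 'm \<Rightarrow> 'p"
    and I :: "'i set"
    and \<Omega> :: "'i \<Rightarrow> (complex ^ 'm) set"
    and \<tau> :: "'i \<Rightarrow> complex ^ 'm \<Rightarrow> complex ^ ('n :: finite)"
    and \<iota> :: "'i \<Rightarrow> complex ^ 'n \<Rightarrow> complex ^ 'm"
  assumes countable_charts: "countable I"
    and open_domain: "i \<in> I \<Longrightarrow> open (\<Omega> i)"
    and saturated: "i \<in> I \<Longrightarrow> h \<in> \<Omega> i \<Longrightarrow> r h' = r h \<Longrightarrow> h' \<in> \<Omega> i"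
    and invariant: "i \<in> I \<Longrightarrow> h \<in> \<Omega> i \<Longrightarrow> r h' = r h \<Longrightarrow> \<tau> i h' = \<tau> i h"
    and hol_\<tau>: "i \<in> I \<Longrightarrow> h \<in> \<Omega> i \<Longrightarrow> cdiff_at (\<lambda>h. \<tau> i h $ l) h"
    and hol_\<iota>: "i \<in> I \<Longrightarrow> cdiff_at (\<lambda>u. \<iota> i u $ k) u"
    and slice: "i \<in> I \<Longrightarrow> h \<in> \<Omega> i \<Longrightarrow> r (\<iota> i (\<tau> i h)) = r h"
    and coordinate: "i \<in> I \<Longrightarrow> \<iota> i u \<in> \<Omega> i \<Longrightarrow> \<tau> i (\<iota> i u) = u"
    and connected_domain: "i \<in> I \<Longrightarrow> connected {u. \<iota> i u \<in> \<Omega> i}"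
    and common_point: "\<exists>h. \<forall>i\<in>I. h \<in> \<Omega> i"
    and open_saturation: "open S \<Longrightarrow> open {h. \<exists>\<eta>\<in>S. r \<eta> = r h}"
    and separated: "i \<in> I \<Longrightarrow> j \<in> I \<Longrightarrow> h \<in> \<Omega> i \<Longrightarrow> h' \<in> \<Omega> j \<Longrightarrow> r h \<noteq> r h' \<Longrightarrow>
      (\<exists>i\<in>I. h \<in> \<Omega> i \<and> h' \<in> \<Omega> i) \<or>
      (\<exists>S S'. open S \<and> open S' \<and> h \<in> S \<and> h' \<in> S' \<and>
        (\<forall>\<eta>\<in>S \<inter> (\<Union>i\<in>I. \<Omega> i). \<forall>\<eta>'\<in>S' \<inter> (\<Union>i\<in>I. \<Omega> i). r \<eta> \<noteq> r \<eta>'))"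
begin

definition Tot :: "(complex ^ 'm) set" where "Tot = (\<Union>i\<in>I. \<Omega> i)"

definition dom :: "'i \<Rightarrow> 'p set" where "dom i = r ` \<Omega> i"

text \<open>
  The representative is arbitrary, since \<open>\<tau> i\<close> is constant on classes.
\<close>

definition chart :: "'i \<Rightarrow> 'p \<Rightarrow> complex ^ 'n" where
  "chart i p = \<tau> i (SOME h. h \<in> \<Omega> i \<and> r h = p)"

definition quotient_topology :: "'p topology" where
  "quotient_topology = topology (\<lambda>V. V \<subseteq> r ` Tot \<and> open {h \<in> Tot. r h \<in> V})"

definition quotient_space :: "('p, 'n) charted_space" where
  "quotient_space = \<lparr>mtop = quotient_topology, atlas = (\<lambda>i. (dom i, chart i)) ` I\<rparr>"

lemma open_Tot: "open Tot"
  unfolding Tot_def using open_domain by blast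

lemma domain_subset_Tot: "i \<in> I \<Longrightarrow> \<Omega> i \<subseteq> Tot"
  unfolding Tot_def by blast

lemma openin_quotient: "openin quotient_topology V \<longleftrightarrow> V \<subseteq> r ` Tot \<and> open {h \<in> Tot. r h \<in> V}"
proof -
  have "istopology (\<lambda>V. V \<subseteq> r ` Tot \<and> open {h \<in> Tot. r h \<in> V})"
    unfolding istopology_def
  proof (intro conjI allI impI)
    fix S S' assume "S \<subseteq> r ` Tot \<and> open {h \<in> Tot. r h \<in> S}" "S' \<subseteq> r ` Tot \<and> open {h \<in> Tot. r h \<in> S'}"
    moreover have "{h \<in> Tot. r h \<in> S \<inter> S'} = {h \<in> Tot. r h \<in> S} \<inter> {h \<in> Tot. r h \<in> S'}" by auto
    ultimately show "S \<inter> S' \<subseteq> r ` Tot" "open {h \<in> Tot. r h \<in> S \<inter> S'}" by auto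
  next
    fix K assume K: "\<forall>V\<in>K. V \<subseteq> r ` Tot \<and> open {h \<in> Tot. r h \<in> V}"
    have "{h \<in> Tot. r h \<in> \<Union> K} = (\<Union>V\<in>K. {h \<in> Tot. r h \<in> V})" by auto
    then show "open {h \<in> Tot. r h \<in> \<Union> K}" using K by auto
    show "\<Union> K \<subseteq> r ` Tot" using K by auto
  qed
  then show ?thesis unfolding quotient_topology_def by (simp add: topology_inverse')
qed

lemma topspace_quotient [simp]: "topspace quotient_topology = r ` Tot"
proof -
  have "{h \<in> Tot. r h \<in> r ` Tot} = Tot" by auto
  then have "openin quotient_topology (r ` Tot)" using open_Tot by (simp add: openin_quotient)
  then have "r ` Tot \<subseteq> topspace quotient_topology" by (rule openin_subset)
  moreover have "topspace quotient_topology \<subseteq> r ` Tot"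
    using openin_topspace[of quotient_topology] unfolding openin_quotient by blast
  ultimately show ?thesis by blast
qed

lemma preimage_of_image:
  assumes "W \<subseteq> Tot" "\<And>h h'. h \<in> W \<Longrightarrow> r h' = r h \<Longrightarrow> h' \<in> W"
  shows "{h \<in> Tot. r h \<in> r ` W} = W"
  using assms by (auto simp: image_iff)

lemma openin_image:
  assumes "open W" "W \<subseteq> Tot" "\<And>h h'. h \<in> W \<Longrightarrow> r h' = r h \<Longrightarrow> h' \<in> W"
  shows "openin quotient_topology (r ` W)"
  using preimage_of_image[OF assms(2,3)] assms(1,2) by (auto simp: openin_quotient)

lemma openin_dom: "i \<in> I \<Longrightarrow> openin quotient_topology (dom i)"
  unfolding dom_def by (rule openin_image) (auto intro: open_domain saturated simp: Tot_def)

lemma chart_class: "i \<in> I \<Longrightarrow> h \<in> \<Omega> i \<Longrightarrow> chart i (r h) = \<tau> i h"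
  unfolding chart_def by (rule someI2[of _ h]) (auto intro: invariant)

lemma \<iota>_\<tau>_in: "i \<in> I \<Longrightarrow> h \<in> \<Omega> i \<Longrightarrow> \<iota> i (\<tau> i h) \<in> \<Omega> i"
  using saturated slice by blast

lemma chart_image: "i \<in> I \<Longrightarrow> chart i ` dom i = {u. \<iota> i u \<in> \<Omega> i}"
proof -
  assume i: "i \<in> I"
  have "chart i ` dom i = \<tau> i ` \<Omega> i"
    unfolding dom_def image_image using chart_class[OF i] by auto
  also have "\<dots> = {u. \<iota> i u \<in> \<Omega> i}"
    using coordinate[OF i] \<iota>_\<tau>_in[OF i] by (force simp: image_iff)
  finally show ?thesis .
qed

lemma chart_inj: "i \<in> I \<Longrightarrow> inj_on (chart i) (dom i)"
  unfolding dom_def inj_on_def using chart_class slice by (metis (no_types, lifting) imageE)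

lemma chart_\<iota>: "i \<in> I \<Longrightarrow> \<iota> i u \<in> \<Omega> i \<Longrightarrow> chart i (r (\<iota> i u)) = u"
  by (simp add: chart_class coordinate)

lemma inv_chart: "i \<in> I \<Longrightarrow> \<iota> i u \<in> \<Omega> i \<Longrightarrow> inv_into (dom i) (chart i) u = r (\<iota> i u)"
  by (rule inv_into_f_eq[OF chart_inj]) (auto simp: dom_def chart_\<iota>)

lemma continuous_\<iota>: "i \<in> I \<Longrightarrow> continuous_on S (\<iota> i)"
  by (rule cdiff_at_imp_continuous_on_vec) (rule hol_\<iota>)

lemma continuous_\<tau>: "i \<in> I \<Longrightarrow> continuous_on (\<Omega> i) (\<tau> i)"
  by (rule cdiff_at_imp_continuous_on_vec) (rule hol_\<tau>)

lemma open_chart_image: "i \<in> I \<Longrightarrow> open {u. \<iota> i u \<in> \<Omega> i}"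
  using open_vimage[OF open_domain continuous_\<iota>] by (simp add: vimage_def)

lemma continuous_map_from_quotient:
  assumes W: "open W" "W \<subseteq> Tot" "\<And>h h'. h \<in> W \<Longrightarrow> r h' = r h \<Longrightarrow> h' \<in> W"
    and f: "continuous_map (top_of_set W) Y (f \<circ> r)"
  shows "continuous_map (subtopology quotient_topology (r ` W)) Y f"
  unfolding continuous_map_alt
proof (intro conjI allI impI)
  have rW: "openin quotient_topology (r ` W)" by (rule openin_image[OF W])
  fix V assume "openin Y V"
  then have "openin (top_of_set W) ((f \<circ> r) -` V \<inter> W)"
    using f unfolding continuous_map_alt by auto
  then have 1: "open ((f \<circ> r) -` V \<inter> W)" using W(1) by (simp add: openin_open_eq)
  have 2: "f -` V \<inter> r ` W = r ` ((f \<circ> r) -` V \<inter> W)" by auto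
  have "openin quotient_topology (f -` V \<inter> r ` W)"
    unfolding 2 by (rule openin_image[OF 1]) (use W in auto)
  then show "openin (subtopology quotient_topology (r ` W))
     (f -` V \<inter> topspace (subtopology quotient_topology (r ` W)))"
    using openin_subset[OF rW] by (auto simp: openin_open_subtopology[OF rW] Int_absorb1 inf.absorb2)
next
  show "f \<in> topspace (subtopology quotient_topology (r ` W)) \<rightarrow> topspace Y"
    using f W(2) unfolding continuous_map_alt by auto
qed

lemma continuous_map_class: "continuous_map (top_of_set Tot) quotient_topology r"
  unfolding continuous_map_alt
proof (intro conjI allI impI)
  fix V assume "openin quotient_topology V"
  then have "open {h \<in> Tot. r h \<in> V}" by (simp add: openin_quotient)
  moreover have "r -` V \<inter> topspace (top_of_set Tot) = {h \<in> Tot. r h \<in> V}" by auto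
  ultimately show "openin (top_of_set Tot) (r -` V \<inter> topspace (top_of_set Tot))"
    by (metis (no_types, lifting) open_openin_trans open_Tot mem_Collect_eq subsetI)
qed auto

lemma continuous_map_class_compose:
  assumes "open S" "\<And>z. z \<in> S \<Longrightarrow> \<kappa> z \<in> Tot" "continuous_on S \<kappa>"
  shows "continuous_map (top_of_set S) quotient_topology (\<lambda>z. r (\<kappa> z))"
proof -
  have "continuous_map (top_of_set S) (top_of_set Tot) \<kappa>"
    using assms by auto
  from continuous_map_compose[OF this continuous_map_class] show ?thesis by (simp add: o_def)
qed

lemma homeomorphic_chart:
  assumes i: "i \<in> I"
  shows "homeomorphic_map (subtopology quotient_topology (dom i)) (top_of_set {u. \<iota> i u \<in> \<Omega> i}) (chart i)"
proof (rule homeomorphic_maps_imp_map)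
  show "homeomorphic_maps (subtopology quotient_topology (dom i)) (top_of_set {u. \<iota> i u \<in> \<Omega> i})
      (chart i) (\<lambda>u. r (\<iota> i u))"
    unfolding homeomorphic_maps_def
  proof (intro conjI ballI)
    have "continuous_on (\<Omega> i) (chart i \<circ> r)"
      using continuous_on_eq[OF continuous_\<tau>[OF i]] chart_class[OF i] by (metis comp_apply)
    then have "continuous_map (top_of_set (\<Omega> i)) (top_of_set {u. \<iota> i u \<in> \<Omega> i}) (chart i \<circ> r)"
      using chart_class[OF i] \<iota>_\<tau>_in[OF i] by auto
    then show "continuous_map (subtopology quotient_topology (dom i)) (top_of_set {u. \<iota> i u \<in> \<Omega> i}) (chart i)"
      unfolding dom_def
      by (intro continuous_map_from_quotient open_domain[OF i] domain_subset_Tot[OF i])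
         (auto intro: saturated[OF i])
    have "continuous_map (top_of_set {u. \<iota> i u \<in> \<Omega> i}) quotient_topology (\<lambda>u. r (\<iota> i u))"
      by (intro continuous_map_class_compose open_chart_image[OF i] continuous_\<iota>[OF i])
         (use domain_subset_Tot[OF i] in auto)
    then show "continuous_map (top_of_set {u. \<iota> i u \<in> \<Omega> i}) (subtopology quotient_topology (dom i))
        (\<lambda>u. r (\<iota> i u))"
      by (auto simp: continuous_map_in_subtopology dom_def)
  next
    fix p assume "p \<in> topspace (subtopology quotient_topology (dom i))"
    then show "r (\<iota> i (chart i p)) = p"
      using slice[OF i] chart_class[OF i] by (auto simp: dom_def)
  next
    fix u assume "u \<in> topspace (top_of_set {u. \<iota> i u \<in> \<Omega> i})"
    then show "chart i (r (\<iota> i u)) = u" using chart_\<iota>[OF i] by auto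
  qed
qed

lemma is_chart: "i \<in> I \<Longrightarrow> is_chart quotient_topology (dom i) (chart i)"
  unfolding is_chart_def chart_image
  using openin_dom open_chart_image homeomorphic_chart by (simp add: chart_image)

text \<open>
  The chart expression of an induced map coincides near \<open>u\<close> with \<open>\<tau> j \<circ> \<Phi> \<circ> \<iota> i\<close>.
\<close>

lemma cdiff_at_in_charts:
  assumes ij: "i \<in> I" "j \<in> I" and W: "open W"
    and \<Phi>: "\<And>h k. h \<in> W \<Longrightarrow> cdiff_at (\<lambda>h. \<Phi> h $ k) h"
    and f: "\<And>h. h \<in> W \<Longrightarrow> h \<in> \<Omega> i \<Longrightarrow> f (r h) = r (\<Phi> h)"
    and u: "\<iota> i u \<in> \<Omega> i" "\<iota> i u \<in> W" "\<Phi> (\<iota> i u) \<in> \<Omega> j"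
  shows "cdiff_at (\<lambda>u. (chart j \<circ> f \<circ> inv_into (dom i) (chart i)) u $ l) u"
proof -
  define S where "S = {u. \<iota> i u \<in> {h \<in> \<Omega> i \<inter> W. \<Phi> h \<in> \<Omega> j}}"
  have c\<Phi>: "continuous_on (\<Omega> i \<inter> W) \<Phi>"
    by (rule cdiff_at_imp_continuous_on_vec) (rule \<Phi>, auto)
  have "open {h \<in> \<Omega> i \<inter> W. \<Phi> h \<in> \<Omega> j}"
  proof -
    have "{h \<in> \<Omega> i \<inter> W. \<Phi> h \<in> \<Omega> j} = (\<Omega> i \<inter> W) \<inter> \<Phi> -` \<Omega> j" by auto
    then show ?thesis
      using continuous_open_preimage[OF c\<Phi> _ open_domain[OF ij(2)]] W open_domain[OF ij(1)]
      by (simp add: open_Int)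
  qed
  then have oS: "open S"
    using open_vimage[OF _ continuous_\<iota>[OF ij(1), of UNIV]] unfolding S_def vimage_def by blast
  have uS: "u \<in> S" using u by (auto simp: S_def)
  show ?thesis
  proof (rule cdiff_at_cong[OF _ oS uS])
    show "cdiff_at (\<lambda>u. \<tau> j (\<Phi> (\<iota> i u)) $ l) u"
      by (rule cdiff_at_compose[of _ "\<lambda>u. \<Phi> (\<iota> i u)"], rule hol_\<tau>[OF ij(2) u(3)])
         (rule cdiff_at_compose[of _ "\<iota> i"], rule \<Phi>[OF u(2)], rule hol_\<iota>[OF ij(1)])
    fix w assume "w \<in> S"
    then have w: "\<iota> i w \<in> \<Omega> i" "\<iota> i w \<in> W" "\<Phi> (\<iota> i w) \<in> \<Omega> j" by (auto simp: S_def)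
    show "\<tau> j (\<Phi> (\<iota> i w)) $ l = (chart j \<circ> f \<circ> inv_into (dom i) (chart i)) w $ l"
      using w by (simp add: inv_chart[OF ij(1)] f chart_class[OF ij(2)])
  qed
qed

lemma Hausdorff_quotient: "Hausdorff_space quotient_topology"
  unfolding Hausdorff_space_def
proof (intro allI impI)
  fix p p' assume "p \<in> topspace quotient_topology \<and> p' \<in> topspace quotient_topology \<and> p \<noteq> p'"
  then obtain h h' i j where w: "i \<in> I" "j \<in> I" "h \<in> \<Omega> i" "h' \<in> \<Omega> j" "p = r h" "p' = r h'" "r h \<noteq> r h'"
    by (auto simp: Tot_def)
  from separated[OF w(1-4,7)] consider
    (chart) k where "k \<in> I" "h \<in> \<Omega> k" "h' \<in> \<Omega> k" |
    (sep) S S' where "open S" "open S'" "h \<in> S" "h' \<in> S'" "\<forall>\<eta>\<in>S \<inter> Tot. \<forall>\<eta>'\<in>S' \<inter> Tot. r \<eta> \<noteq> r \<eta>'"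
    unfolding Tot_def by auto
  then show "\<exists>U V. openin quotient_topology U \<and> openin quotient_topology V \<and> p \<in> U \<and> p' \<in> V \<and> disjnt U V"
  proof cases
    case chart
    have "\<tau> k h \<noteq> \<tau> k h'"
      using slice[OF chart(1)] chart(2,3) w(7) by metis
    then obtain B B' where B: "open B" "open B'" "\<tau> k h \<in> B" "\<tau> k h' \<in> B'" "B \<inter> B' = {}"
      by (meson hausdorff)
    have op: "openin quotient_topology (r ` {h \<in> \<Omega> k. \<tau> k h \<in> B})" if "open B" for B
    proof (rule openin_image)
      show "open {h \<in> \<Omega> k. \<tau> k h \<in> B}"
        using continuous_open_preimage[OF continuous_\<tau>[OF chart(1)] open_domain[OF chart(1)] that]
        by (simp add: Int_def vimage_def)
      show "{h \<in> \<Omega> k. \<tau> k h \<in> B} \<subseteq> Tot" using chart(1) by (auto simp: Tot_def)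
      fix \<eta> \<eta>' assume "\<eta> \<in> {h \<in> \<Omega> k. \<tau> k h \<in> B}" "r \<eta>' = r \<eta>"
      then show "\<eta>' \<in> {h \<in> \<Omega> k. \<tau> k h \<in> B}"
        using saturated[OF chart(1), of \<eta> \<eta>'] invariant[OF chart(1), of \<eta> \<eta>'] by simp
    qed
    show ?thesis
    proof (intro exI conjI)
      show "openin quotient_topology (r ` {h \<in> \<Omega> k. \<tau> k h \<in> B})" by (rule op[OF B(1)])
      show "openin quotient_topology (r ` {h \<in> \<Omega> k. \<tau> k h \<in> B'})" by (rule op[OF B(2)])
      show "disjnt (r ` {h \<in> \<Omega> k. \<tau> k h \<in> B}) (r ` {h \<in> \<Omega> k. \<tau> k h \<in> B'})"
        unfolding disjnt_iff
      proof (intro allI notI, elim conjE imageE CollectE)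
        fix q \<eta> \<eta>' assume "\<eta> \<in> \<Omega> k" "\<tau> k \<eta> \<in> B" "\<eta>' \<in> \<Omega> k" "\<tau> k \<eta>' \<in> B'" "q = r \<eta>" "q = r \<eta>'"
        then show False using invariant[OF chart(1), of \<eta> \<eta>'] B(5) by auto
      qed
    qed (use chart w B in auto)
  next
    case sep
    have op: "openin quotient_topology (r ` (S \<inter> Tot))" if "open S" for S
    proof -
      have "{h \<in> Tot. r h \<in> r ` (S \<inter> Tot)} = Tot \<inter> {h. \<exists>\<eta>\<in>S \<inter> Tot. r \<eta> = r h}"
      proof -
        have "r h \<in> r ` A \<longleftrightarrow> (\<exists>\<eta>\<in>A. r \<eta> = r h)" for A h
          unfolding image_iff by (simp only: eq_commute[of "r h"])
        note * = this
        show ?thesis unfolding * by blast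
      qed
      then have "open {h \<in> Tot. r h \<in> r ` (S \<inter> Tot)}"
        using open_saturation[of "S \<inter> Tot"] that open_Tot by auto
      then show ?thesis by (auto simp: openin_quotient)
    qed
    show ?thesis
    proof (intro exI conjI)
      show "openin quotient_topology (r ` (S \<inter> Tot))" by (rule op[OF sep(1)])
      show "openin quotient_topology (r ` (S' \<inter> Tot))" by (rule op[OF sep(2)])
      show "disjnt (r ` (S \<inter> Tot)) (r ` (S' \<inter> Tot))"
        using sep(5) by (auto simp: disjnt_iff)
    qed (use sep(3,4) w in \<open>auto simp: Tot_def\<close>)
  qed
qed

text \<open>
  The class map is open, so it carries a countable basis to a countable basis.
\<close>

lemma second_countable_quotient:
  "\<exists>\<B>. countable \<B> \<and> (\<forall>B\<in>\<B>. openin quotient_topology B) \<and>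
     (\<forall>U x. openin quotient_topology U \<and> x \<in> U \<longrightarrow> (\<exists>B\<in>\<B>. x \<in> B \<and> B \<subseteq> U))"
proof -
  obtain B :: "(complex ^ 'm) set set" where B: "countable B" "topological_basis B"
    using ex_countable_basis by blast
  define \<B> where "\<B> = (\<lambda>S. r ` (Tot \<inter> {h. \<exists>\<eta>\<in>S \<inter> Tot. r \<eta> = r h})) ` B"
  show ?thesis
  proof (intro exI[of _ \<B>] conjI ballI allI impI)
    show "countable \<B>" using B(1) by (simp add: \<B>_def)
    fix V assume "V \<in> \<B>"
    then obtain S where S: "S \<in> B" "V = r ` (Tot \<inter> {h. \<exists>\<eta>\<in>S \<inter> Tot. r \<eta> = r h})" by (auto simp: \<B>_def)
    have "open (Tot \<inter> {h. \<exists>\<eta>\<in>S \<inter> Tot. r \<eta> = r h})"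
      by (intro open_Int open_saturation open_Tot topological_basis_open[OF B(2) S(1)])
    then show "openin quotient_topology V"
      unfolding S(2) by (rule openin_image) (auto simp: Tot_def intro: saturated)
  next
    fix U x assume U: "openin quotient_topology U \<and> x \<in> U"
    then obtain h where w: "h \<in> Tot" "x = r h" by (auto simp: openin_quotient)
    have "open {h \<in> Tot. r h \<in> U}" using U by (simp add: openin_quotient)
    then obtain S where S: "S \<in> B" "h \<in> S" "S \<subseteq> {h \<in> Tot. r h \<in> U}"
      using topological_basisE[OF B(2), of "{h \<in> Tot. r h \<in> U}" h] w U by auto
    show "\<exists>V\<in>\<B>. x \<in> V \<and> V \<subseteq> U"
    proof (rule bexI[of _ "r ` (Tot \<inter> {h. \<exists>\<eta>\<in>S \<inter> Tot. r \<eta> = r h})"])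
      show "x \<in> r ` (Tot \<inter> {h. \<exists>\<eta>\<in>S \<inter> Tot. r \<eta> = r h}) \<and>
          r ` (Tot \<inter> {h. \<exists>\<eta>\<in>S \<inter> Tot. r \<eta> = r h}) \<subseteq> U"
      proof
        show "x \<in> r ` (Tot \<inter> {h. \<exists>\<eta>\<in>S \<inter> Tot. r \<eta> = r h})" using w S(2) by blast
        show "r ` (Tot \<inter> {h. \<exists>\<eta>\<in>S \<inter> Tot. r \<eta> = r h}) \<subseteq> U"
        proof
          fix y assume "y \<in> r ` (Tot \<inter> {h. \<exists>\<eta>\<in>S \<inter> Tot. r \<eta> = r h})"
          then obtain \<eta> where "\<eta> \<in> S" "y = r \<eta>" by auto
          then show "y \<in> U" using S(3) by blast
        qed
      qed
    qed (use S(1) in \<open>auto simp: \<B>_def\<close>)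
  qed
qed

text \<open>
  All charts contain one common point and have connected images.
\<close>

lemma connected_quotient: "connected_space quotient_topology"
proof -
  obtain h0 where w0: "\<And>i. i \<in> I \<Longrightarrow> h0 \<in> \<Omega> i" using common_point by blast
  have con: "connectedin quotient_topology (dom i)" if i: "i \<in> I" for i
  proof -
    have "connectedin quotient_topology ((\<lambda>u. r (\<iota> i u)) ` {u. \<iota> i u \<in> \<Omega> i})"
    proof (rule connectedin_continuous_map_image)
      show "continuous_map (top_of_set {u. \<iota> i u \<in> \<Omega> i}) quotient_topology (\<lambda>u. r (\<iota> i u))"
        by (intro continuous_map_class_compose open_chart_image[OF i] continuous_\<iota>[OF i])
           (use domain_subset_Tot[OF i] in auto)
      show "connectedin (top_of_set {u. \<iota> i u \<in> \<Omega> i}) {u. \<iota> i u \<in> \<Omega> i}"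
        using connected_domain[OF i] by (simp add: connectedin_subtopology)
    qed
    moreover have "(\<lambda>u. r (\<iota> i u)) ` {u. \<iota> i u \<in> \<Omega> i} = dom i"
      using slice[OF i] \<iota>_\<tau>_in[OF i] by (force simp: dom_def image_iff)
    ultimately show ?thesis by simp
  qed
  have "connectedin quotient_topology (\<Union> (dom ` I))"
  proof (rule connectedin_Union)
    show "\<And>S. S \<in> dom ` I \<Longrightarrow> connectedin quotient_topology S" using con by auto
    have "r h0 \<in> \<Inter> (dom ` I)" using w0 by (auto simp: dom_def)
    then show "\<Inter> (dom ` I) \<noteq> {}" by blast
  qed
  moreover have "\<Union> (dom ` I) = topspace quotient_topology"
    by (auto simp: dom_def Tot_def)
  ultimately have "connectedin quotient_topology (topspace quotient_topology)" by (simp only:)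
  then show ?thesis by (simp only: connectedin_topspace)
qed

theorem complex_manifold_quotient: "complex_manifold quotient_space"
  unfolding complex_manifold_def
proof (intro conjI)
  show "Hausdorff_space (mtop quotient_space)" "connected_space (mtop quotient_space)"
    using Hausdorff_quotient connected_quotient by (simp_all add: quotient_space_def)
  show "\<exists>\<B>. countable \<B> \<and> (\<forall>B\<in>\<B>. openin (mtop quotient_space) B) \<and>
     (\<forall>U x. openin (mtop quotient_space) U \<and> x \<in> U \<longrightarrow> (\<exists>B\<in>\<B>. x \<in> B \<and> B \<subseteq> U))"
    using second_countable_quotient by (simp add: quotient_space_def)
  show "\<forall>(U, \<phi>)\<in>atlas quotient_space. is_chart (mtop quotient_space) U \<phi>"
    using is_chart by (auto simp: quotient_space_def)
  show "\<Union> (fst ` atlas quotient_space) = topspace (mtop quotient_space)"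
    by (auto simp: quotient_space_def dom_def Tot_def)
  have "holomorphic_vec (chart j \<circ> inv_into (dom i) (chart i)) (chart i ` (dom i \<inter> dom j))"
    if ij: "i \<in> I" "j \<in> I" for i j
    unfolding holomorphic_vec_iff
  proof (intro ballI allI)
    fix u l assume "u \<in> chart i ` (dom i \<inter> dom j)"
    then obtain p where p: "p \<in> dom i" "p \<in> dom j" "u = chart i p" by auto
    then have iu: "\<iota> i u \<in> \<Omega> i" using chart_image[OF ij(1)] by blast
    have "p = r (\<iota> i u)"
      using p inv_chart[OF ij(1) iu] chart_inj[OF ij(1)] by simp
    then have "\<iota> i u \<in> \<Omega> j" using p(2) saturated[OF ij(2)] by (auto simp: dom_def)
    then show "cdiff_at (\<lambda>w. (chart j \<circ> inv_into (dom i) (chart i)) w $ l) u"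
      using cdiff_at_in_charts[OF ij open_UNIV, of "\<lambda>h. h" "\<lambda>p. p" u l] iu by (simp add: o_def)
  qed
  then show "\<forall>(U, \<phi>)\<in>atlas quotient_space. \<forall>(V, \<psi>)\<in>atlas quotient_space.
        holomorphic_vec (\<psi> \<circ> inv_into U \<phi>) (\<phi> ` (U \<inter> V))"
    by (auto simp: quotient_space_def)
qed

lemma holomorphic_map_from_quotient:
  assumes W: "open W" "W \<subseteq> Tot" "\<And>h h'. h \<in> W \<Longrightarrow> r h' = r h \<Longrightarrow> h' \<in> W"
    and P: "\<And>h l. h \<in> W \<Longrightarrow> cdiff_at (\<lambda>h. P h $ l) h"
    and f: "\<And>h. h \<in> W \<Longrightarrow> f (r h) = P h"
  shows "holomorphic_map quotient_space (r ` W) complex_space f"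
  unfolding holomorphic_map_def
proof (intro conjI)
  have "continuous_on W P"
    by (rule cdiff_at_imp_continuous_on_vec) (rule P, auto)
  then have "continuous_on W (f \<circ> r)" by (rule continuous_on_eq) (simp add: f)
  then show "continuous_map (subtopology (mtop quotient_space) (r ` W)) (mtop complex_space) f"
    unfolding quotient_space_def complex_space_def using continuous_map_from_quotient[OF W, where Y = euclidean and f = f] by simp
  show "openin (mtop quotient_space) (r ` W)" using openin_image[OF W] by (simp add: quotient_space_def)
  have "holomorphic_vec (f \<circ> inv_into (dom i) (chart i)) (chart i ` {x \<in> dom i \<inter> r ` W. f x \<in> UNIV})"
    if i: "i \<in> I" for i
    unfolding holomorphic_vec_iff
  proof (intro ballI allI)
    fix u l assume "u \<in> chart i ` {x \<in> dom i \<inter> r ` W. f x \<in> UNIV}"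
    then obtain p where p: "p \<in> dom i" "p \<in> r ` W" "u = chart i p" by auto
    then have iu: "\<iota> i u \<in> \<Omega> i" using chart_image[OF i] by blast
    have "p = r (\<iota> i u)"
      using p inv_chart[OF i iu] chart_inj[OF i] by simp
    then have iW: "\<iota> i u \<in> W" using p(2) W(3) by auto
    define S where "S = \<iota> i -` (\<Omega> i \<inter> W)"
    have oS: "open S" unfolding S_def
      by (rule open_vimage[OF _ continuous_\<iota>[OF i]]) (use open_domain[OF i] W in auto)
    have "u \<in> S" using iu iW by (simp add: S_def)
    show "cdiff_at (\<lambda>w. (f \<circ> inv_into (dom i) (chart i)) w $ l) u"
    proof (rule cdiff_at_cong[OF _ oS \<open>u \<in> S\<close>])
      show "cdiff_at (\<lambda>u. P (\<iota> i u) $ l) u"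
        by (rule cdiff_at_compose[of _ "\<iota> i"], rule P[OF iW], rule hol_\<iota>[OF i])
      fix w assume "w \<in> S"
      then show "P (\<iota> i w) $ l = (f \<circ> inv_into (dom i) (chart i)) w $ l"
        by (simp add: S_def inv_chart[OF i] f)
    qed
  qed
  then show "\<forall>(U, \<phi>)\<in>atlas quotient_space. \<forall>(V, \<psi>)\<in>atlas complex_space.
        holomorphic_vec (\<psi> \<circ> f \<circ> inv_into U \<phi>) (\<phi> ` {x \<in> U \<inter> r ` W. f x \<in> V})"
    by (auto simp: quotient_space_def complex_space_def)
qed

lemma holomorphic_map_into_quotient:
  fixes \<kappa> :: "complex ^ 'k \<Rightarrow> complex ^ 'm"
  assumes S: "open S" "\<And>z. z \<in> S \<Longrightarrow> \<kappa> z \<in> Tot"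
    and \<kappa>: "\<And>z l. z \<in> S \<Longrightarrow> cdiff_at (\<lambda>z. \<kappa> z $ l) z"
    and f: "\<And>z. z \<in> S \<Longrightarrow> f z = r (\<kappa> z)"
  shows "holomorphic_map complex_space S quotient_space f"
  unfolding holomorphic_map_def
proof (intro conjI)
  have c: "continuous_on S \<kappa>"
    by (rule cdiff_at_imp_continuous_on_vec) (rule \<kappa>, auto)
  have "continuous_map (top_of_set S) quotient_topology f"
    using continuous_map_eq[OF continuous_map_class_compose[OF S c], of f] f by simp
  then show "continuous_map (subtopology (mtop complex_space) S) (mtop quotient_space) f"
    by (simp add: quotient_space_def complex_space_def)
  show "openin (mtop complex_space) S" using S by (simp add: complex_space_def)
  have "holomorphic_vec (chart j \<circ> f \<circ> inv_into UNIV id) (id ` {x \<in> UNIV \<inter> S. f x \<in> dom j})"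
    if j: "j \<in> I" for j
    unfolding holomorphic_vec_iff
  proof (intro ballI allI)
    fix z l assume "z \<in> id ` {x \<in> UNIV \<inter> S. f x \<in> dom j}"
    then have z: "z \<in> S" "f z \<in> dom j" by auto
    then have zj: "\<kappa> z \<in> \<Omega> j" using f saturated[OF j] by (auto simp: dom_def)
    have o: "open (S \<inter> \<kappa> -` \<Omega> j)" by (rule continuous_open_preimage[OF c S(1) open_domain[OF j]])
    show "cdiff_at (\<lambda>w. (chart j \<circ> f \<circ> inv_into UNIV id) w $ l) z"
    proof (rule cdiff_at_cong[OF _ o])
      show "cdiff_at (\<lambda>z. \<tau> j (\<kappa> z) $ l) z"
        by (rule cdiff_at_compose[of _ \<kappa>], rule hol_\<tau>[OF j zj], rule \<kappa>[OF z(1)])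
      show "z \<in> S \<inter> \<kappa> -` \<Omega> j" using z zj by simp
      fix w assume "w \<in> S \<inter> \<kappa> -` \<Omega> j"
      then have w: "w \<in> S" "\<kappa> w \<in> \<Omega> j" by auto
      have "(chart j \<circ> f \<circ> inv_into UNIV id) w = chart j (f w)" by (simp only: inv_id o_def id_apply)
      also have "\<dots> = \<tau> j (\<kappa> w)" unfolding f[OF w(1)] by (rule chart_class[OF j w(2)])
      finally show "\<tau> j (\<kappa> w) $ l = (chart j \<circ> f \<circ> inv_into UNIV id) w $ l" by simp
    qed
  qed
  then show "\<forall>(U, \<phi>)\<in>atlas complex_space. \<forall>(V, \<psi>)\<in>atlas quotient_space.
        holomorphic_vec (\<psi> \<circ> f \<circ> inv_into U \<phi>) (\<phi> ` {x \<in> U \<inter> S. f x \<in> V})"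
    by (auto simp: quotient_space_def complex_space_def)
qed

lemma holomorphic_map_between_quotients:
  assumes W: "open W" "W \<subseteq> Tot" "\<And>h h'. h \<in> W \<Longrightarrow> r h' = r h \<Longrightarrow> h' \<in> W"
    and \<Phi>: "\<And>h l. h \<in> W \<Longrightarrow> cdiff_at (\<lambda>h. \<Phi> h $ l) h" "\<And>h. h \<in> W \<Longrightarrow> \<Phi> h \<in> Tot"
    and f: "\<And>h. h \<in> W \<Longrightarrow> f (r h) = r (\<Phi> h)"
  shows "holomorphic_map quotient_space (r ` W) quotient_space f"
  unfolding holomorphic_map_def
proof (intro conjI)
  have c: "continuous_on W \<Phi>"
    by (rule cdiff_at_imp_continuous_on_vec) (rule \<Phi>(1), auto)
  have "continuous_map (top_of_set W) quotient_topology (f \<circ> r)"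
    using continuous_map_eq[OF continuous_map_class_compose[OF W(1) \<Phi>(2) c], of "f \<circ> r"] f by simp
  from continuous_map_from_quotient[OF W(1,2) _ this]
  show "continuous_map (subtopology (mtop quotient_space) (r ` W)) (mtop quotient_space) f"
    unfolding quotient_space_def charted_space.simps using W(3) .
  show "openin (mtop quotient_space) (r ` W)" using openin_image[OF W] by (simp add: quotient_space_def)
  have "holomorphic_vec (chart j \<circ> f \<circ> inv_into (dom i) (chart i)) (chart i ` {x \<in> dom i \<inter> r ` W. f x \<in> dom j})"
    if ij: "i \<in> I" "j \<in> I" for i j
    unfolding holomorphic_vec_iff
  proof (intro ballI allI)
    fix u l assume "u \<in> chart i ` {x \<in> dom i \<inter> r ` W. f x \<in> dom j}"
    then obtain p where p: "p \<in> dom i" "p \<in> r ` W" "u = chart i p" "f p \<in> dom j" by auto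
    then have iu: "\<iota> i u \<in> \<Omega> i" using chart_image[OF ij(1)] by blast
    have pu: "p = r (\<iota> i u)"
      using p inv_chart[OF ij(1) iu] chart_inj[OF ij(1)] by simp
    then have iW: "\<iota> i u \<in> W" using p(2) W(3) by auto
    have "r (\<Phi> (\<iota> i u)) \<in> dom j" using p(4) unfolding pu f[OF iW] .
    then have "\<Phi> (\<iota> i u) \<in> \<Omega> j" using saturated[OF ij(2)] unfolding dom_def by blast
    then show "cdiff_at (\<lambda>w. (chart j \<circ> f \<circ> inv_into (dom i) (chart i)) w $ l) u"
      by (intro cdiff_at_in_charts[OF ij W(1) \<Phi>(1)] f iu iW)
  qed
  then show "\<forall>(U, \<phi>)\<in>atlas quotient_space. \<forall>(V, \<psi>)\<in>atlas quotient_space.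
        holomorphic_vec (\<psi> \<circ> f \<circ> inv_into U \<phi>) (\<phi> ` {x \<in> U \<inter> r ` W. f x \<in> V})"
    by (auto simp: quotient_space_def)
qed

end

section \<open>A toric modification in homogeneous coordinates\<close>

text \<open>
  Names of the homogeneous coordinates: equations \<open>x\<close>, \<open>y\<close>, \<open>s\<close> of the three exceptional divisors, and
  one coordinate for every coordinate hyperplane of \<open>\<complex>\<^sup>n\<close>.
\<close>

datatype 'n cox = Cx | Cy | Cs | Cv 'n

lemma UNIV_cox: "(UNIV :: 'n cox set) = insert Cx (insert Cy (insert Cs (range Cv)))"
proof -
  have "k \<in> insert Cx (insert Cy (insert Cs (range Cv)))" for k :: "'n cox"
    by (cases k) simp_all
  then show ?thesis by blast
qed

instance cox :: (finite) finite
  by standard (simp add: UNIV_cox)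

text \<open>
  The charts, by the three coordinates that are normalized to \<open>1\<close>. \<open>Affine\<close> normalizes \<open>x, y, s\<close> and
  covers the complement of the exceptional divisors. \<open>Off_Hyperplane\<close> is the chart of the blown up
  origin at directions outside the hyperplane \<open>z\<^sub>b = 0\<close>. Near the direction of the \<open>i\<close>-th axis, inside
  that hyperplane, its blow-up has the charts \<open>Corner i\<close>, where both exceptional divisors meet, and
  \<open>Strict i\<close>, which misses the divisor \<open>x = 0\<close>. \<open>Last\<close> is the chart around the distinguished point.
\<close>

datatype 'n chart_index = Affine | Off_Hyperplane | Corner 'n | Strict 'n | Last

text \<open>
  The weights \<open>a\<close> and \<open>N\<close> determine the divisor \<open>s = 0\<close>. The set \<open>B\<close> is \<open>{b}\<close> if the hyperplane \<open>z\<^sub>b = 0\<close>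
  is blown up in addition to the origin. If \<open>B\<close> is empty, then \<open>x\<close> never vanishes on the open set
  considered below, the torus normalizes it to \<open>1\<close>, and \<open>y\<close> is the equation of the exceptional divisor
  of the origin. In this way both cases share one construction.
\<close>

locale cox_data =
  fixes a :: "'n :: finite \<Rightarrow> nat" and p q b :: 'n and B :: "'n set" and N :: nat
  assumes p_neq_q: "p \<noteq> q" and a_p: "a p = 0" and a_q: "a q = 1"
    and a_pos: "j \<noteq> p \<Longrightarrow> a j \<ge> 1" and a_less_N: "a j < N"
    and B_cases: "B = {} \<or> B = {b} \<and> b \<noteq> p \<and> b \<noteq> q"
begin

text \<open>
  A name for \<open>B \<noteq> {}\<close> that rewriting does not turn into an instance of the parameter \<open>B\<close>.
\<close>

definition proper :: bool where "proper \<longleftrightarrow> B \<noteq> {}"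

text \<open>
  The order of vanishing of \<open>z\<^sub>j\<close> along the divisor \<open>y = 0\<close>.
\<close>

definition \<beta> :: "'n \<Rightarrow> nat" where "\<beta> j = (if j \<in> B then 2 else 1)"

text \<open>
  The torus acts so that the monomials \<open>x y\<^bsup>\<beta> j\<^esup> s\<^bsup>N + a j\<^esup> v\<^sub>j\<close>, which are the coordinates of \<open>\<complex>\<^sup>n\<close>, are
  invariant.
\<close>

definition act :: "complex \<Rightarrow> complex \<Rightarrow> complex \<Rightarrow> complex ^ 'n cox \<Rightarrow> complex ^ 'n cox" where
  "act c d f h = (\<chi> k. case k of Cx \<Rightarrow> c * h $ Cx | Cy \<Rightarrow> d * h $ Cy | Cs \<Rightarrow> f * h $ Cs
     | Cv j \<Rightarrow> h $ Cv j / (c * d ^ \<beta> j * f ^ (N + a j)))"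

definition orbit_rel :: "complex ^ 'n cox \<Rightarrow> complex ^ 'n cox \<Rightarrow> bool" where
  "orbit_rel h h' \<longleftrightarrow> (\<exists>c d f. c \<noteq> 0 \<and> d \<noteq> 0 \<and> f \<noteq> 0 \<and> h' = act c d f h)"

text \<open>
  The points of the manifold are chosen representatives of the orbits, written as lists of vectors.
\<close>

definition encode :: "complex ^ 'n cox \<Rightarrow> 'n manifold_point" where
  "encode h = [\<chi> j. h $ Cx, \<chi> j. h $ Cy, \<chi> j. h $ Cs, \<chi> j. h $ Cv j]"

definition orbit :: "complex ^ 'n cox \<Rightarrow> 'n manifold_point" where
  "orbit h = encode (SOME h'. orbit_rel h h')"

text \<open>
  The chart \<open>i\<close> uses as its \<open>j\<close>-th coordinate the homogeneous coordinate \<open>slot i j\<close>; whenever \<open>v\<^sub>j\<close> is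
  normalized, its place is taken by one of \<open>x, y, s\<close>.
\<close>

definition slot :: "'n chart_index \<Rightarrow> 'n \<Rightarrow> 'n cox" where
  "slot i j = (case i of Affine \<Rightarrow> Cv j
    | Off_Hyperplane \<Rightarrow> if j = b then Cx else Cv j
    | Corner i \<Rightarrow> if j = i then Cx else if j = b then Cy else Cv j
    | Strict i \<Rightarrow> if j = i then Cy else Cv j
    | Last \<Rightarrow> if j = q then Cs else if j = p then (if \<not> proper then Cy else Cx)
             else if j \<in> B then Cy else Cv j)"

definition slot_of :: "'n chart_index \<Rightarrow> 'n cox \<Rightarrow> 'n" where
  "slot_of i k = (case k of Cv j \<Rightarrow> j | Cs \<Rightarrow> q | Cx \<Rightarrow>
      (case i of Corner l \<Rightarrow> l | Off_Hyperplane \<Rightarrow> b | _ \<Rightarrow> p)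
    | Cy \<Rightarrow> (case i of Strict l \<Rightarrow> l | Last \<Rightarrow> if \<not> proper then p else b | _ \<Rightarrow> b))"

definition normalized :: "'n chart_index \<Rightarrow> 'n cox set" where
  "normalized i = (case i of Affine \<Rightarrow> {Cx, Cy, Cs}
    | Off_Hyperplane \<Rightarrow> {Cy, Cs, Cv b}
    | Corner i \<Rightarrow> {Cs, Cv i, Cv b}
    | Strict i \<Rightarrow> {Cx, Cs, Cv i}
    | Last \<Rightarrow> {Cv p, Cv q, if \<not> proper then Cx else Cv b})"

text \<open>
  The torus element \<open>(scale_x, scale_y, scale_s)\<close> that moves a point to the slice of the chart: the
  solution of the three monomial equations saying that the normalized coordinates become \<open>1\<close>. The lemma
  \<open>scale_vertex\<close> below states them for coordinates of the form \<open>v\<^sub>j\<close>.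
\<close>

definition scale_s :: "'n chart_index \<Rightarrow> complex ^ 'n cox \<Rightarrow> complex" where
  "scale_s i h = (case i of Last \<Rightarrow> h $ Cv q / h $ Cv p | _ \<Rightarrow> 1 / h $ Cs)"

definition scale_y :: "'n chart_index \<Rightarrow> complex ^ 'n cox \<Rightarrow> complex" where
  "scale_y i h = (case i of Affine \<Rightarrow> 1 / h $ Cy | Off_Hyperplane \<Rightarrow> 1 / h $ Cy
    | Corner j \<Rightarrow> h $ Cv b * h $ Cs ^ (N + a b) / (h $ Cv j * h $ Cs ^ (N + a j))
    | Strict j \<Rightarrow> h $ Cv j * h $ Cs ^ (N + a j) * h $ Cx
    | Last \<Rightarrow> if \<not> proper then h $ Cv p * h $ Cx / scale_s Last h ^ N
             else h $ Cv b / (h $ Cv p * scale_s Last h ^ a b))"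

definition scale_x :: "'n chart_index \<Rightarrow> complex ^ 'n cox \<Rightarrow> complex" where
  "scale_x i h = (case i of Affine \<Rightarrow> 1 / h $ Cx
    | Off_Hyperplane \<Rightarrow> h $ Cv b * h $ Cy ^ 2 * h $ Cs ^ (N + a b)
    | Corner j \<Rightarrow> h $ Cv j * h $ Cs ^ (N + a j) / scale_y (Corner j) h
    | Strict j \<Rightarrow> 1 / h $ Cx
    | Last \<Rightarrow> if \<not> proper then 1 / h $ Cx else h $ Cv p / (scale_y Last h * scale_s Last h ^ N))"

definition indices :: "'n chart_index set" where
  "indices = {Affine, Last} \<union> Strict ` (- insert p B) \<union>
    (if \<not> proper then {} else insert Off_Hyperplane (Corner ` (- insert p B)))"

definition domain :: "'n chart_index \<Rightarrow> (complex ^ 'n cox) set" where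
  "domain i = {h. (\<forall>k\<in>normalized i. h $ k \<noteq> 0) \<and> (i = Affine \<longrightarrow> (\<exists>j. h $ Cv j \<noteq> 0))}"

definition normalize :: "'n chart_index \<Rightarrow> complex ^ 'n cox \<Rightarrow> complex ^ 'n cox" where
  "normalize i h = act (scale_x i h) (scale_y i h) (scale_s i h) h"

definition coords :: "'n chart_index \<Rightarrow> complex ^ 'n cox \<Rightarrow> complex ^ 'n" where
  "coords i h = (\<chi> j. normalize i h $ slot i j)"

definition slice_embed :: "'n chart_index \<Rightarrow> complex ^ 'n \<Rightarrow> complex ^ 'n cox" where
  "slice_embed i u = (\<chi> k. if k \<in> normalized i then 1 else u $ slot_of i k)"

lemma act_simps [simp]:
  "act c d f h $ Cx = c * h $ Cx" "act c d f h $ Cy = d * h $ Cy" "act c d f h $ Cs = f * h $ Cs"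
  "act c d f h $ Cv j = h $ Cv j / (c * d ^ \<beta> j * f ^ (N + a j))"
  by (simp_all add: act_def)

lemma cox_eqI: "h $ Cx = h' $ Cx \<Longrightarrow> h $ Cy = h' $ Cy \<Longrightarrow> h $ Cs = h' $ Cs \<Longrightarrow>
    (\<And>j. h $ Cv j = h' $ Cv j) \<Longrightarrow> h = h'"
  unfolding cart_eq_iff
proof
  fix k assume "h $ Cx = h' $ Cx" "h $ Cy = h' $ Cy" "h $ Cs = h' $ Cs"
    "\<And>j. h $ Cv j = h' $ Cv j"
  then show "h $ k = h' $ k" by (cases k) simp_all
qed

lemma act_1 [simp]: "act 1 1 1 h = h"
  by (rule cox_eqI) auto

lemma act_act: "act c d f (act c' d' f' h) = act (c * c') (d * d') (f * f') h"
  by (rule cox_eqI) (simp_all add: power_mult_distrib mult_ac)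

lemma orbit_rel_refl: "orbit_rel h h"
  unfolding orbit_rel_def by (intro exI[of _ 1]) simp

lemma orbit_rel_sym: "orbit_rel h h' \<Longrightarrow> orbit_rel h' h"
  unfolding orbit_rel_def
proof (elim exE conjE)
  fix c d f :: complex assume "c \<noteq> 0" "d \<noteq> 0" "f \<noteq> 0" "h' = act c d f h"
  then show "\<exists>c d f. c \<noteq> 0 \<and> d \<noteq> 0 \<and> f \<noteq> 0 \<and> h = act c d f h'"
    by (intro exI[of _ "1 / c"] exI[of _ "1 / d"] exI[of _ "1 / f"]) (simp add: act_act)
qed

lemma orbit_rel_trans: "orbit_rel h h' \<Longrightarrow> orbit_rel h' h'' \<Longrightarrow> orbit_rel h h''"
  unfolding orbit_rel_def by (metis act_act mult_eq_0_iff)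

lemma encode_inject: "encode h = encode h' \<Longrightarrow> h = h'"
  unfolding encode_def by (intro cox_eqI) (auto simp: cart_eq_iff)

lemma orbit_eq_iff: "orbit h = orbit h' \<longleftrightarrow> orbit_rel h h'"
proof
  assume "orbit_rel h h'"
  then have "orbit_rel h = orbit_rel h'"
    using orbit_rel_sym orbit_rel_trans by blast
  then show "orbit h = orbit h'" by (simp add: orbit_def)
next
  assume "orbit h = orbit h'"
  then have eq: "(SOME \<eta>. orbit_rel h \<eta>) = (SOME \<eta>. orbit_rel h' \<eta>)"
    unfolding orbit_def by (rule encode_inject)
  have "orbit_rel h (SOME \<eta>. orbit_rel h \<eta>)" "orbit_rel h' (SOME \<eta>. orbit_rel h' \<eta>)"
    by (rule someI[of _ h], rule orbit_rel_refl, rule someI[of _ h'], rule orbit_rel_refl)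
  then show "orbit_rel h h'" unfolding eq using orbit_rel_sym orbit_rel_trans by blast
qed

lemma orbit_eqE:
  assumes "orbit h = orbit h'"
  obtains c d f where "c \<noteq> 0" "d \<noteq> 0" "f \<noteq> 0" "h' = act c d f h"
  using assms unfolding orbit_eq_iff orbit_rel_def by (elim exE conjE) (rule that)

lemma orbit_act:
  assumes "c \<noteq> 0" "d \<noteq> 0" "f \<noteq> 0" shows "orbit (act c d f h) = orbit h"
proof -
  have "orbit_rel h (act c d f h)"
    unfolding orbit_rel_def using assms by (intro exI conjI) (assumption+, rule refl)
  from orbit_rel_sym[OF this] show ?thesis unfolding orbit_eq_iff .
qed

lemma b_in: "proper \<Longrightarrow> b \<in> B" and in_B: "j \<in> B \<Longrightarrow> j = b \<and> proper"
  and p_notin [simp]: "p \<notin> B" and q_notin [simp]: "q \<notin> B"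
  using B_cases by (auto simp: proper_def)

lemma \<beta>_simps [simp]: "\<beta> p = 1" "\<beta> q = 1" "proper \<Longrightarrow> \<beta> b = 2" "j \<notin> B \<Longrightarrow> \<beta> j = 1"
  by (auto simp: \<beta>_def b_in)

lemma corner_index: "Corner l \<in> indices \<Longrightarrow> proper \<and> l \<notin> B \<and> l \<noteq> b \<and> l \<noteq> p"
  and off_index: "Off_Hyperplane \<in> indices \<Longrightarrow> proper"
  and strict_index: "Strict l \<in> indices \<Longrightarrow> l \<notin> B \<and> l \<noteq> p"
  using b_in by (auto simp: indices_def split: if_splits)

lemma b_neq: "proper \<Longrightarrow> b \<noteq> p \<and> b \<noteq> q"
  using b_in p_notin q_notin by metis

lemma in_B_iff: "proper \<Longrightarrow> j \<in> B \<longleftrightarrow> j = b" and not_proper: "\<not> proper \<Longrightarrow> j \<notin> B"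
  using b_in in_B by blast+

lemma slot_of_slot: "i \<in> indices \<Longrightarrow> slot_of i (slot i j) = j"
proof (cases i)
  case (Corner l)
  assume "i \<in> indices"
  then have "l \<noteq> b" using corner_index Corner by auto
  then show ?thesis using Corner by (simp add: slot_def slot_of_def)
next
  case Last
  then show ?thesis
    using in_B_iff not_proper p_neq_q by (cases proper) (simp_all add: slot_def slot_of_def)
qed (simp_all add: slot_def slot_of_def)

lemma slot_notin_normalized: "i \<in> indices \<Longrightarrow> slot i j \<notin> normalized i"
proof (cases i)
  case Last
  then show ?thesis
    using in_B_iff not_proper p_neq_q by (cases proper) (simp_all add: slot_def normalized_def)
qed (simp_all add: slot_def normalized_def)

lemma slot_slot_of:
  assumes i: "i \<in> indices" and k: "k \<notin> normalized i" shows "slot i (slot_of i k) = k"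
proof (cases i)
  case Affine
  then show ?thesis using k by (cases k) (simp_all add: slot_def slot_of_def normalized_def)
next
  case Off_Hyperplane
  then show ?thesis using k by (cases k) (simp_all add: slot_def slot_of_def normalized_def)
next
  case (Corner l)
  then have "l \<noteq> b" using corner_index i by auto
  then show ?thesis using k Corner by (cases k) (simp_all add: slot_def slot_of_def normalized_def)
next
  case (Strict l)
  then show ?thesis using k by (cases k) (simp_all add: slot_def slot_of_def normalized_def)
next
  case Last
  show ?thesis
  proof (cases proper)
    case True
    then show ?thesis using k Last b_neq p_neq_q b_in 
      by (cases k) (simp_all add: slot_def slot_of_def normalized_def in_B_iff)
  next
    case False
    then show ?thesis using k Last p_neq_q not_proper
      by (cases k) (simp_all add: slot_def slot_of_def normalized_def)
  qed
qed

lemma domain_act: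
  "c \<noteq> 0 \<Longrightarrow> d \<noteq> 0 \<Longrightarrow> f \<noteq> 0 \<Longrightarrow> h \<in> domain i \<Longrightarrow> act c d f h \<in> domain i"
proof -
  assume nz: "c \<noteq> 0" "d \<noteq> 0" "f \<noteq> 0" and w: "h \<in> domain i"
  have "act c d f h $ k \<noteq> 0" if "h $ k \<noteq> 0" for k
    using nz that by (cases k) simp_all
  then show ?thesis using w unfolding domain_def by blast
qed

lemma scale_nonzero:
  assumes "i \<in> indices" "h \<in> domain i"
  shows "scale_s i h \<noteq> 0" "scale_y i h \<noteq> 0" "scale_x i h \<noteq> 0"
proof -
  show 1: "scale_s i h \<noteq> 0"
    using assms by (auto simp: domain_def normalized_def scale_s_def split: chart_index.splits)
  show 2: "scale_y i h \<noteq> 0"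
    using assms 1 by (auto simp: domain_def normalized_def scale_y_def split: chart_index.splits if_splits)
  show "scale_x i h \<noteq> 0"
    using assms 1 2 by (auto simp: domain_def normalized_def scale_x_def split: chart_index.splits if_splits)
qed

lemma scale_vertex:
  assumes i: "i \<in> indices" "h \<in> domain i" and j: "Cv j \<in> normalized i"
  shows "scale_x i h * scale_y i h ^ \<beta> j * scale_s i h ^ (N + a j) = h $ Cv j"
proof -
  note nz = scale_nonzero[OF i]
  have w: "h $ k \<noteq> 0" if "k \<in> normalized i" for k using i(2) that by (simp add: domain_def)
  show ?thesis
  proof (cases i)
    case Affine
    then show ?thesis using j by (simp add: normalized_def)
  next
    case Off_Hyperplane
    then have B: proper using i off_index by simp
    have "j = b" using j Off_Hyperplane by (simp add: normalized_def)
    have "h $ Cs \<noteq> 0" "h $ Cy \<noteq> 0" using w[of Cs] w[of Cy] Off_Hyperplane by (simp_all add: normalized_def)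
    then show ?thesis
      unfolding Off_Hyperplane \<open>j = b\<close> by (simp add: scale_x_def scale_y_def scale_s_def B power_divide)
  next
    case (Corner l)
    then have B: proper "l \<notin> B" using i corner_index by auto
    have S: "h $ Cs \<noteq> 0" "h $ Cv l \<noteq> 0" using w[of Cs] w[of "Cv l"] Corner by (simp_all add: normalized_def)
    have xy: "scale_x i h * scale_y i h = h $ Cv l * h $ Cs ^ (N + a l)"
      using nz(2) unfolding Corner by (simp add: scale_x_def)
    have y: "h $ Cv l * h $ Cs ^ (N + a l) * scale_y i h = h $ Cv b * h $ Cs ^ (N + a b)"
      using S unfolding Corner by (simp add: scale_y_def)
    have s: "scale_s i h = 1 / h $ Cs" unfolding Corner by (simp add: scale_s_def)
    have "j = l \<or> j = b" using j Corner by (simp add: normalized_def)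
    then show ?thesis
    proof
      assume "j = l"
      then show ?thesis using xy B S unfolding s by (simp add: power_divide)
    next
      assume "j = b"
      then have "scale_x i h * scale_y i h ^ \<beta> j = h $ Cv b * h $ Cs ^ (N + a b)"
        using xy y B by (simp add: power2_eq_square flip: mult.assoc)
      then show ?thesis using \<open>j = b\<close> S unfolding s by (simp add: power_divide)
    qed
  next
    case (Strict l)
    then have l: "l \<notin> B" using i strict_index by simp
    have "j = l" using j Strict by (simp add: normalized_def)
    have "h $ Cs \<noteq> 0" "h $ Cx \<noteq> 0" using w[of Cs] w[of Cx] Strict by (simp_all add: normalized_def)
    then show ?thesis
      unfolding Strict \<open>j = l\<close> using l by (simp add: scale_x_def scale_y_def scale_s_def power_divide)
  next
    case Last
    have V: "h $ Cv p \<noteq> 0" "h $ Cv q \<noteq> 0"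
      using w[of "Cv p"] w[of "Cv q"] Last by (simp_all add: normalized_def)
    define s where "s = scale_s i h"
    have Vq: "h $ Cv p * s = h $ Cv q" using V unfolding s_def Last by (simp add: scale_s_def)
    have s0: "s \<noteq> 0" using nz(1) by (simp add: s_def)
    show ?thesis
    proof (cases proper)
      case False
      have "h $ Cx \<noteq> 0" using w[of Cx] Last False by (simp add: normalized_def)
      then have p: "scale_x i h * scale_y i h * s ^ N = h $ Cv p"
        using False s0 unfolding Last s_def by (simp add: scale_x_def scale_y_def)
      have "j = p \<or> j = q" using j Last False by (simp add: normalized_def)
      then show ?thesis
      proof
        assume "j = p" then show ?thesis using p by (simp add: a_p s_def)
      next
        assume "j = q"
        have "scale_x i h * scale_y i h * s ^ (N + 1) = (scale_x i h * scale_y i h * s ^ N) * s" by simp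
        also have "\<dots> = h $ Cv q" unfolding p by (rule Vq)
        finally show ?thesis unfolding s_def \<open>j = q\<close> by (simp only: \<beta>_simps a_q power_one_right)
      qed
    next
      case  True
      define y where "y = scale_y i h"
      have y0: "y \<noteq> 0" using nz by (simp add: y_def)
      have p: "scale_x i h * y * s ^ N = h $ Cv p"
        using True s0 y0 unfolding Last s_def y_def by (simp add: scale_x_def)
      have yb: "h $ Cv p * y * s ^ a b = h $ Cv b"
        using True s0 V unfolding Last s_def y_def by (simp add: scale_y_def)
      have "j = p \<or> j = q \<or> j = b" using j Last True by (simp add: normalized_def)
      then show ?thesis
      proof (elim disjE)
        assume "j = p" then show ?thesis using p by (simp add: a_p s_def y_def)
      next
        assume "j = q"
        have "scale_x i h * y * s ^ (N + 1) = (scale_x i h * y * s ^ N) * s" by simp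
        also have "\<dots> = h $ Cv q" unfolding p by (rule Vq)
        finally show ?thesis unfolding s_def y_def \<open>j = q\<close> by (simp only: \<beta>_simps a_q power_one_right)
      next
        assume "j = b"
        have "scale_x i h * y ^ 2 * s ^ (N + a b) = (scale_x i h * y * s ^ N) * y * s ^ a b"
          by (simp add: power2_eq_square power_add)
        also have "\<dots> = h $ Cv b" unfolding p by (rule yb)
        finally show ?thesis unfolding s_def y_def \<open>j = b\<close> by (simp only: \<beta>_simps True)
      qed
    qed
  qed
qed

lemma normalize_eq_1:
  assumes i: "i \<in> indices" "h \<in> domain i" and k: "k \<in> normalized i"
  shows "normalize i h $ k = 1"
proof -
  have w: "h $ k \<noteq> 0" using i(2) k by (simp add: domain_def)
  show ?thesis
  proof (cases k)
    case (Cv j)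
    then show ?thesis using scale_vertex[OF i, of j] k w by (simp add: normalize_def)
  qed (use k w in \<open>cases i; auto simp: normalized_def normalize_def scale_x_def scale_y_def scale_s_def split: if_splits\<close>)+
qed

text \<open>
  The exponents of the three normalized coordinates form a unimodular matrix, so the torus acts
  simply transitively on them. Hence normalization does not depend on the representative.
\<close>

lemma stabilizer_of_slice:
  assumes i: "i \<in> indices" and nz: "c \<noteq> 0" "d \<noteq> 0" "f \<noteq> 0"
    and 1: "\<And>k. k \<in> normalized i \<Longrightarrow> h $ k = 1" "\<And>k. k \<in> normalized i \<Longrightarrow> act c d f h $ k = 1"
  shows "c = 1 \<and> d = 1 \<and> f = 1"
proof -
  have v: "c * d ^ \<beta> j * f ^ (N + a j) = 1" if "Cv j \<in> normalized i" for j
    using 1[OF that] by simp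
  have x: "c = 1" if "Cx \<in> normalized i" using 1[OF that] by simp
  have y: "d = 1" if "Cy \<in> normalized i" using 1[OF that] by simp
  have s: "f = 1" if "Cs \<in> normalized i" using 1[OF that] by simp
  have cd: "d = 1" if "c * d = 1" "c * d ^ 2 = 1"
    using that by (metis mult.assoc mult_1 power2_eq_square)
  show ?thesis
  proof (cases i)
    case Affine
    then show ?thesis using x y s by (simp add: normalized_def)
  next
    case Off_Hyperplane
    then have "f = 1" "d = 1" "c * d ^ \<beta> b * f ^ (N + a b) = 1"
      using y s v[of b] by (simp_all add: normalized_def)
    then show ?thesis by simp
  next
    case (Corner l)
    then have B: proper "l \<notin> B" using i corner_index by auto
    have f: "f = 1" using s Corner by (simp add: normalized_def)
    have "c * d = 1" "c * d ^ 2 = 1"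
      using v[of l] v[of b] Corner B f by (simp_all add: normalized_def)
    then show ?thesis using cd f by auto
  next
    case (Strict l)
    then have l: "l \<notin> B" using i strict_index by simp
    have "f = 1" "c = 1" using s x Strict by (simp_all add: normalized_def)
    then show ?thesis using v[of l] Strict l by (simp add: normalized_def)
  next
    case Last
    have *: "c * d * f ^ N = 1" "c * d * f ^ N * f = 1"
      using v[of p] v[of q] Last by (simp_all add: normalized_def a_p a_q mult_ac)
    then have f: "f = 1" by simp
    show ?thesis
    proof (cases proper)
      case False
      then show ?thesis using * f x Last by (simp add: normalized_def)
    next
      case True
      then have "c * d ^ 2 = 1" using v[of b] Last f by (simp add: normalized_def)
      moreover have "c * d = 1" using * f by simp
      ultimately show ?thesis using f cd by auto
    qed
  qed
qed

lemma slice_embed_slot: "i \<in> indices \<Longrightarrow> slice_embed i u $ slot i j = u $ j"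
  by (simp add: slice_embed_def slot_notin_normalized slot_of_slot)

lemma slice_embed_normalized: "k \<in> normalized i \<Longrightarrow> slice_embed i u $ k = 1"
  by (simp add: slice_embed_def)

lemma orbit_normalize: "i \<in> indices \<Longrightarrow> h \<in> domain i \<Longrightarrow> orbit (normalize i h) = orbit h"
  unfolding normalize_def by (intro orbit_act scale_nonzero)

lemma slice_embed_coords:
  assumes "i \<in> indices" "h \<in> domain i"
  shows "slice_embed i (coords i h) = normalize i h"
  unfolding cart_eq_iff
proof
  fix k show "slice_embed i (coords i h) $ k = normalize i h $ k"
  proof (cases "k \<in> normalized i")
    case True
    then show ?thesis by (simp add: slice_embed_normalized normalize_eq_1 assms)
  next
    case False
    then obtain j where "k = slot i j" using slot_slot_of[OF assms(1)] by metis
    then show ?thesis by (simp add: slice_embed_slot assms coords_def)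
  qed
qed

lemma normalize_unique:
  assumes i: "i \<in> indices" and w: "h \<in> domain i" "h' \<in> domain i" and o: "orbit h = orbit h'"
  shows "normalize i h = normalize i h'"
proof -
  have "orbit (normalize i h) = orbit (normalize i h')"
    by (rule trans[OF orbit_normalize[OF i w(1)] trans[OF o sym[OF orbit_normalize[OF i w(2)]]]])
  then obtain c d f where nz: "c \<noteq> 0" "d \<noteq> 0" "f \<noteq> 0" and eq: "normalize i h' = act c d f (normalize i h)"
    by (rule orbit_eqE)
  have 1: "normalize i h $ k = 1" if "k \<in> normalized i" for k
    by (rule normalize_eq_1[OF i w(1) that])
  have 2: "act c d f (normalize i h) $ k = 1" if "k \<in> normalized i" for k
    by (rule subst[OF eq, of "\<lambda>x. x $ k = 1"]) (rule normalize_eq_1[OF i w(2) that])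
  have "c = 1 \<and> d = 1 \<and> f = 1"
    by (rule stabilizer_of_slice[OF i nz, of "normalize i h"]) (rule 1, assumption, rule 2, assumption)
  then have "c = 1" "d = 1" "f = 1" by auto
  with eq show ?thesis by (simp only: act_1)
qed

lemma normalize_slice:
  assumes i: "i \<in> indices" and u: "slice_embed i u \<in> domain i"
  shows "normalize i (slice_embed i u) = slice_embed i u"
proof -
  have "scale_x i (slice_embed i u) = 1 \<and> scale_y i (slice_embed i u) = 1 \<and> scale_s i (slice_embed i u) = 1"
  proof (rule stabilizer_of_slice[OF i scale_nonzero(3,2,1)[OF i u]])
    show "slice_embed i u $ k = 1" if "k \<in> normalized i" for k
      by (rule slice_embed_normalized[OF that])
    show "act (scale_x i (slice_embed i u)) (scale_y i (slice_embed i u)) (scale_s i (slice_embed i u))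
        (slice_embed i u) $ k = 1" if "k \<in> normalized i" for k
      using normalize_eq_1[OF i u that] unfolding normalize_def .
  qed
  then show ?thesis by (simp add: normalize_def)
qed

lemma coords_slice:
  "i \<in> indices \<Longrightarrow> slice_embed i u \<in> domain i \<Longrightarrow> coords i (slice_embed i u) = u"
  by (simp add: coords_def normalize_slice slice_embed_slot cart_eq_iff)

lemma domain_saturated: "h \<in> domain i \<Longrightarrow> orbit h' = orbit h \<Longrightarrow> h' \<in> domain i"
proof -
  assume w: "h \<in> domain i" and "orbit h' = orbit h"
  then have "orbit_rel h h'" using orbit_eq_iff by metis
  then show "h' \<in> domain i" unfolding orbit_rel_def using domain_act[OF _ _ _ w] by blast
qed

lemma open_domain: "open (domain i)"
proof -
  have eq: "domain i = (\<Inter>k\<in>normalized i. {h. h $ k \<noteq> 0}) \<inter>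
     (if i = Affine then \<Union>j. {h. h $ Cv j \<noteq> 0} else UNIV)"
    by (auto simp: domain_def)
  have "open {h :: complex ^ 'n cox. h $ k \<noteq> 0}" for k
    by (intro open_Collect_neq continuous_intros)
  note o = this
  have "open (\<Inter>k\<in>normalized i. {h :: complex ^ 'n cox. h $ k \<noteq> 0})"
    by (rule open_INT) (auto intro: o)
  moreover have "open (\<Union>j. {h :: complex ^ 'n cox. h $ Cv j \<noteq> 0})"
    by (rule open_UN) (auto intro: o)
  ultimately show ?thesis unfolding eq by (cases "i = Affine") (simp_all add: open_Int)
qed

lemma cdiff_at_scale:
  assumes i: "i \<in> indices" "h \<in> domain i"
  shows "cdiff_at (\<lambda>h. scale_s i h) h" "cdiff_at (\<lambda>h. scale_y i h) h" "cdiff_at (\<lambda>h. scale_x i h) h"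
proof -
  have nz: "h $ k \<noteq> 0" if "k \<in> normalized i" for k using i that by (simp add: domain_def)
  note nz' = scale_nonzero[OF i]
  note rules = cdiff_at_divide cdiff_at_mult cdiff_at_power cdiff_at_coord cdiff_at_const
  show s: "cdiff_at (\<lambda>h. scale_s i h) h"
    unfolding scale_s_def
    by (cases i; simp only: chart_index.case; intro rules; rule nz; simp add: normalized_def)
  show y: "cdiff_at (\<lambda>h. scale_y i h) h"
  proof (cases i)
    case Last
    show ?thesis
    proof (cases proper)
      case True
      then show ?thesis using nz[of "Cv p"] nz'(1) s unfolding Last
        by (simp add: scale_y_def normalized_def) (intro rules, auto)
    next
      case False
      then show ?thesis using nz'(1) s unfolding Last
        by (simp add: scale_y_def) (intro rules, auto)
    qed
  next
    case (Corner l)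
    have "h $ Cv l * h $ Cs ^ (N + a l) \<noteq> 0"
      using nz[of "Cv l"] nz[of Cs] by (simp add: Corner normalized_def)
    then show ?thesis unfolding Corner scale_y_def chart_index.case
      by (intro rules)
  qed (simp only: scale_y_def chart_index.case, intro rules, (rule nz, simp add: normalized_def)?)+
  show "cdiff_at (\<lambda>h. scale_x i h) h"
  proof (cases i)
    case Last
    show ?thesis
    proof (cases proper)
      case True
      then show ?thesis using nz'(1,2) s y unfolding Last
        by (simp add: scale_x_def) (intro rules, auto)
    next
      case False
      then show ?thesis using nz[of Cx] unfolding Last
        by (simp add: scale_x_def normalized_def) (intro rules, auto)
    qed
  next
    case (Corner l)
    then show ?thesis using nz'(2) y unfolding Corner scale_x_def chart_index.case
      by (intro rules)
  qed (simp only: scale_x_def chart_index.case, intro rules, (rule nz, simp add: normalized_def)?)+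
qed

lemma cdiff_at_normalize:
  assumes i: "i \<in> indices" "h \<in> domain i"
  shows "cdiff_at (\<lambda>h. normalize i h $ k) h"
proof -
  note rules = cdiff_at_divide cdiff_at_mult cdiff_at_power cdiff_at_coord cdiff_at_scale[OF i]
  show ?thesis
  proof (cases k)
    case (Cv j)
    have "scale_x i h * scale_y i h ^ \<beta> j * scale_s i h ^ (N + a j) \<noteq> 0"
      using scale_nonzero[OF i] by simp
    then show ?thesis unfolding Cv normalize_def act_simps by (intro rules)
  qed (simp only: normalize_def act_simps, intro rules)+
qed

lemma cdiff_at_slice_embed: "cdiff_at (\<lambda>u. slice_embed i u $ k) u"
  by (cases "k \<in> normalized i") (simp_all add: slice_embed_def)

end

section \<open>Smoothness and separation of the modification\<close>

context cox_data
begin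

text \<open>
  The coordinates of a point divided by the common factor \<open>x y s\<^sup>N\<close>. They are homogeneous coordinates of
  its image in the blow-up of the origin, and along the exceptional set they retain the direction.
\<close>

definition proj_coord :: "complex ^ 'n cox \<Rightarrow> 'n \<Rightarrow> complex" where
  "proj_coord h j = h $ Cy ^ (\<beta> j - 1) * h $ Cs ^ a j * h $ Cv j"

definition blow_down :: "complex ^ 'n cox \<Rightarrow> complex ^ 'n" where
  "blow_down h = (\<chi> j. h $ Cx * h $ Cy ^ \<beta> j * h $ Cs ^ (N + a j) * h $ Cv j)"

text \<open>
  The open set whose quotient is the manifold. The second alternative is the chart \<open>Last\<close>. In the first
  one, \<open>(x, v\<^sub>b) \<noteq> (0, 0)\<close> expresses the blow-up of the hyperplane, and the last conjunct removes the
  direction of the \<open>p\<close>-th axis from the exceptional set, where \<open>x y = 0\<close>: its place is taken by the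
  divisor \<open>s = 0\<close>, and keeping it would destroy separation.
\<close>

definition regular :: "complex ^ 'n cox \<Rightarrow> bool" where
  "regular h \<longleftrightarrow>
    h $ Cs \<noteq> 0 \<and> (h $ Cx \<noteq> 0 \<or> proper \<and> h $ Cv b \<noteq> 0) \<and>
      (h $ Cx \<noteq> 0 \<and> h $ Cy \<noteq> 0 \<and> h $ Cv p \<noteq> 0 \<or> (\<exists>j. j \<noteq> p \<and> proj_coord h j \<noteq> 0)) \<or>
    h $ Cv p \<noteq> 0 \<and> h $ Cv q \<noteq> 0 \<and> h $ (if proper then Cv b else Cx) \<noteq> 0"

lemma \<beta>_pos: "\<beta> j = Suc (\<beta> j - 1)"
  by (simp add: \<beta>_def)

lemma blow_down_proj_coord: "blow_down h $ j = h $ Cx * h $ Cy * h $ Cs ^ N * proj_coord h j"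
  unfolding blow_down_def proj_coord_def by (subst \<beta>_pos) (simp add: power_add)

lemma proj_coord_p: "proj_coord h p = h $ Cv p"
  by (simp add: proj_coord_def a_p)

lemma proj_coord_q: "proj_coord h q = h $ Cs * h $ Cv q"
  by (simp add: proj_coord_def a_q)

lemma proj_coord_notin: "j \<notin> B \<Longrightarrow> proj_coord h j = h $ Cs ^ a j * h $ Cv j"
  by (simp add: proj_coord_def)

lemma proj_coord_b: "proper \<Longrightarrow> proj_coord h b = h $ Cy * (h $ Cs ^ a b * h $ Cv b)"
  by (simp add: proj_coord_def)

lemma proj_coord_act:
  assumes "c \<noteq> 0" "d \<noteq> 0" "f \<noteq> 0"
  shows "proj_coord (act c d f h) j = proj_coord h j / (c * d * f ^ N)"
  unfolding proj_coord_def act_simps using assms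
  by (subst (2) \<beta>_pos) (simp add: power_mult_distrib power_add divide_simps mult_ac)

lemma blow_down_act:
  assumes "c \<noteq> 0" "d \<noteq> 0" "f \<noteq> 0"
  shows "blow_down (act c d f h) = blow_down h"
  using assms by (simp add: blow_down_def power_mult_distrib mult_ac)

lemma blow_down_orbit: "orbit h = orbit h' \<Longrightarrow> blow_down h = blow_down h'"
  by (elim orbit_eqE) (metis blow_down_act)

lemma domain_iffs:
  "h \<in> domain Affine \<longleftrightarrow> h $ Cx \<noteq> 0 \<and> h $ Cy \<noteq> 0 \<and> h $ Cs \<noteq> 0 \<and> (\<exists>j. h $ Cv j \<noteq> 0)"
  "h \<in> domain Off_Hyperplane \<longleftrightarrow> h $ Cy \<noteq> 0 \<and> h $ Cs \<noteq> 0 \<and> h $ Cv b \<noteq> 0"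
  "h \<in> domain (Corner l) \<longleftrightarrow> h $ Cs \<noteq> 0 \<and> h $ Cv l \<noteq> 0 \<and> h $ Cv b \<noteq> 0"
  "h \<in> domain (Strict l) \<longleftrightarrow> h $ Cx \<noteq> 0 \<and> h $ Cs \<noteq> 0 \<and> h $ Cv l \<noteq> 0"
  "h \<in> domain Last \<longleftrightarrow> h $ Cv p \<noteq> 0 \<and> h $ Cv q \<noteq> 0 \<and> h $ (if proper then Cv b else Cx) \<noteq> 0"
  by (simp_all add: domain_def normalized_def)

lemma regularI: "i \<in> indices \<Longrightarrow> h \<in> domain i \<Longrightarrow> regular h"
proof (cases i)
  case Affine
  assume "h \<in> domain i"
  then have w: "h $ Cx \<noteq> 0" "h $ Cy \<noteq> 0" "h $ Cs \<noteq> 0" and "\<exists>j. h $ Cv j \<noteq> 0"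
    by (simp_all add: Affine domain_iffs)
  then obtain j where j: "h $ Cv j \<noteq> 0" by blast
  then have "proj_coord h j \<noteq> 0" using w by (simp add: proj_coord_def)
  then show ?thesis using w j unfolding regular_def by (cases "j = p") auto
next
  case Off_Hyperplane
  assume "i \<in> indices" "h \<in> domain i"
  then have P: proper and w: "h $ Cy \<noteq> 0" "h $ Cs \<noteq> 0" "h $ Cv b \<noteq> 0"
    using off_index by (simp_all add: Off_Hyperplane domain_iffs)
  then have "proj_coord h b \<noteq> 0" by (simp add: proj_coord_b)
  then show ?thesis using w P b_neq unfolding regular_def by blast
next
  case (Corner l)
  assume "i \<in> indices" "h \<in> domain i"
  then have P: proper "l \<notin> B" "l \<noteq> p" and w: "h $ Cv l \<noteq> 0" "h $ Cs \<noteq> 0" "h $ Cv b \<noteq> 0"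
    using corner_index by (auto simp: Corner domain_iffs)
  then have "proj_coord h l \<noteq> 0" by (simp add: proj_coord_notin)
  then show ?thesis using w P unfolding regular_def by blast
next
  case (Strict l)
  assume "i \<in> indices" "h \<in> domain i"
  then have P: "l \<notin> B" "l \<noteq> p" and w: "h $ Cv l \<noteq> 0" "h $ Cs \<noteq> 0" "h $ Cx \<noteq> 0"
    using strict_index by (auto simp: Strict domain_iffs)
  then have "proj_coord h l \<noteq> 0" by (simp add: proj_coord_notin)
  then show ?thesis using w P unfolding regular_def by blast
next
  case Last
  assume "h \<in> domain i"
  then show ?thesis unfolding Last domain_iffs regular_def by blast
qed

lemma index_simps:
  "Affine \<in> indices" "Last \<in> indices" "proper \<Longrightarrow> Off_Hyperplane \<in> indices"
  "l \<notin> B \<Longrightarrow> l \<noteq> p \<Longrightarrow> Strict l \<in> indices" "proper \<Longrightarrow> l \<notin> B \<Longrightarrow> l \<noteq> p \<Longrightarrow> Corner l \<in> indices"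
  by (auto simp: indices_def)

lemma regularE: "regular h \<Longrightarrow> \<exists>i\<in>indices. h \<in> domain i"
proof -
  assume r: "regular h"
  show ?thesis
  proof (cases "h $ Cv p \<noteq> 0 \<and> h $ Cv q \<noteq> 0 \<and> h $ (if proper then Cv b else Cx) \<noteq> 0")
    case True
    then have "h \<in> domain Last" unfolding domain_iffs .
    then show ?thesis using index_simps(2) by blast
  next
    case False
    then have s: "h $ Cs \<noteq> 0" and xb: "h $ Cx \<noteq> 0 \<or> proper \<and> h $ Cv b \<noteq> 0"
      and c: "h $ Cx \<noteq> 0 \<and> h $ Cy \<noteq> 0 \<and> h $ Cv p \<noteq> 0 \<or> (\<exists>j. j \<noteq> p \<and> proj_coord h j \<noteq> 0)"
      using r unfolding regular_def by blast+
    from c show ?thesis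
    proof
      assume "h $ Cx \<noteq> 0 \<and> h $ Cy \<noteq> 0 \<and> h $ Cv p \<noteq> 0"
      then have "h \<in> domain Affine" using s unfolding domain_iffs by blast
      then show ?thesis using index_simps(1) by blast
    next
      assume "\<exists>j. j \<noteq> p \<and> proj_coord h j \<noteq> 0"
      then obtain j where j: "j \<noteq> p" "proj_coord h j \<noteq> 0" by blast
      then have vj: "h $ Cv j \<noteq> 0" by (simp add: proj_coord_def)
      show ?thesis
      proof (cases "j \<in> B")
        case True
        then have jb: "j = b" "proper" using in_B by auto
        then have "h $ Cy \<noteq> 0" using j(2) by (simp add: proj_coord_b)
        then have "h \<in> domain Off_Hyperplane" using s vj jb unfolding domain_iffs by blast
        then show ?thesis using index_simps(3) jb by blast
      next
        case False
        from xb show ?thesis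
        proof
          assume "h $ Cx \<noteq> 0"
          then have "h \<in> domain (Strict j)" using s vj unfolding domain_iffs by blast
          then show ?thesis using index_simps(4)[OF False j(1)] by blast
        next
          assume P: "proper \<and> h $ Cv b \<noteq> 0"
          then have "h \<in> domain (Corner j)" using s vj unfolding domain_iffs by blast
          then show ?thesis using index_simps(5)[OF _ False j(1)] P by blast
        qed
      qed
    qed
  qed
qed

lemma Union_domain: "(\<Union>i\<in>indices. domain i) = {h. regular h}"
  using regularI regularE by blast

lemma proj_coord_nonzero:
  assumes "regular h" obtains j where "proj_coord h j \<noteq> 0"
proof -
  have "proj_coord h p \<noteq> 0 \<or> (\<exists>j. proj_coord h j \<noteq> 0)"
    using assms unfolding regular_def proj_coord_p by blast
  then show ?thesis using that by blast
qed

lemma regular_s0: "regular h \<Longrightarrow> h $ Cs = 0 \<Longrightarrow> h \<in> domain Last"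
  unfolding domain_iffs regular_def by blast

text \<open>
  Where \<open>s \<noteq> 0\<close>, an orbit is determined by its image in \<open>\<complex>\<^sup>n\<close>, its direction, and the ratio
  \<open>x s\<^sup>N w\<^sub>i\<^sup>2 : s\<^bsup>a b\<^esup> v\<^sub>b\<close>, which is a coordinate on the fibres of the blow-up of the hyperplane (\<open>w\<close> stands
  for \<open>proj_coord\<close>). All three conditions are closed, which is what the Hausdorff property needs.
\<close>

lemma same_orbit_s_nonzero:
  assumes reg: "regular h" "regular h'" and s: "h $ Cs \<noteq> 0" "h' $ Cs \<noteq> 0"
    and E1: "blow_down h = blow_down h'"
    and E2: "\<And>i j. proj_coord h i * proj_coord h' j = proj_coord h j * proj_coord h' i"
    and E3: "\<And>i. proper \<Longrightarrow>
      h $ Cx * h $ Cs ^ N * proj_coord h i ^ 2 * (h' $ Cs ^ a b * h' $ Cv b) =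
      h' $ Cx * h' $ Cs ^ N * proj_coord h' i ^ 2 * (h $ Cs ^ a b * h $ Cv b)"
  shows "orbit h = orbit h'"
proof -
  define X Y S V where "X = h $ Cx" "Y = h $ Cy" "S = h $ Cs" "V = (\<lambda>j. h $ Cv j)"
  define X' Y' S' V' where "X' = h' $ Cx" "Y' = h' $ Cy" "S' = h' $ Cs" "V' = (\<lambda>j. h' $ Cv j)"
  define w w' where "w = proj_coord h" "w' = proj_coord h'"
  note defs = X_Y_S_V_def X'_Y'_S'_V'_def w_w'_def
  define f where "f = S' / S"
  have S0: "S \<noteq> 0" "S' \<noteq> 0" using s by (simp_all add: defs)
  have f0: "f \<noteq> 0" and Sf: "S' = f * S" using S0 by (simp_all add: f_def)
  obtain i where i: "w i \<noteq> 0" using proj_coord_nonzero[OF reg(1)] unfolding defs by blast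
  obtain k where k: "w' k \<noteq> 0" using proj_coord_nonzero[OF reg(2)] unfolding defs by blast
  have E2': "w i * w' j = w j * w' i" for i j using E2 unfolding defs .
  have i': "w' i \<noteq> 0" using E2'[of i k] i k by auto
  define \<kappa> where "\<kappa> = w' i / w i"
  have \<kappa>0: "\<kappa> \<noteq> 0" using i i' by (simp add: \<kappa>_def)
  have w': "w' j = \<kappa> * w j" for j
    using E2'[of i j] i by (simp add: \<kappa>_def field_simps)
  have "X * Y * S ^ N * w i = X' * Y' * S' ^ N * w' i"
    using arg_cong[OF E1, of "\<lambda>z. z $ i"] unfolding blow_down_proj_coord defs .
  then have e1: "X * Y * S ^ N = X' * Y' * S' ^ N * \<kappa>" using i by (simp add: w' mult.assoc)
  define K K' where "K = S ^ a b * V b" "K' = S' ^ a b * V' b"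
  have e3: "X * S ^ N * K' = X' * S' ^ N * \<kappa> ^ 2 * K" if proper
  proof -
    have "X * S ^ N * w i ^ 2 * K' = X' * S' ^ N * w' i ^ 2 * K"
      using E3[OF that] unfolding defs K_K'_def .
    then show ?thesis using i by (simp add: w' power_mult_distrib mult.assoc)
  qed
  have xb: "X \<noteq> 0 \<or> proper \<and> V b \<noteq> 0" "X' \<noteq> 0 \<or> proper \<and> V' b \<noteq> 0"
    using reg s unfolding regular_def defs by (auto split: if_splits)
  \<comment> \<open>The torus element \<open>(c, d, f)\<close> is found in the order \<open>f\<close>, \<open>c\<close>, \<open>d\<close>. If \<open>X = 0\<close>, then \<open>c\<close> cannot be
    read off from \<open>X\<close>, and the coordinate \<open>V b\<close> determines it.\<close>
  have X0: "X = 0 \<longleftrightarrow> X' = 0"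
  proof (cases proper)
    case True
    then show ?thesis using e3[OF True] xb S0 \<kappa>0 unfolding K_K'_def by auto
  next
    case False
    then show ?thesis using xb by blast
  qed
  have "\<exists>c. c \<noteq> 0 \<and> X' = c * X \<and> (proper \<longrightarrow> K' = c * f ^ N * \<kappa> ^ 2 * K)"
  proof (cases "X = 0")
    case True
    then have "X' = 0" "proper" "V b \<noteq> 0" "V' b \<noteq> 0" using X0 xb by auto
    then have "K \<noteq> 0" "K' \<noteq> 0" using S0 by (simp_all add: K_K'_def)
    then show ?thesis using True \<open>X' = 0\<close> f0 \<kappa>0
      by (intro exI[of _ "K' / (K * \<kappa> ^ 2 * f ^ N)"]) (simp add: field_simps)
  next
    case False
    have "K' = X' / X * f ^ N * \<kappa> ^ 2 * K" if proper
      using e3[OF that] False S0 by (simp add: Sf power_mult_distrib field_simps)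
    then show ?thesis using False X0 by (intro exI[of _ "X' / X"]) simp
  qed
  then obtain c where c0: "c \<noteq> 0" and cX: "X' = c * X" and cK: "proper \<Longrightarrow> K' = c * f ^ N * \<kappa> ^ 2 * K"
    by blast
  define d where "d = 1 / (\<kappa> * c * f ^ N)"
  have d0: "d \<noteq> 0" using c0 f0 \<kappa>0 by (simp add: d_def)
  have cdf: "c * d * f ^ N = 1 / \<kappa>" using c0 f0 \<kappa>0 by (simp add: d_def)
  have Y': "Y' = d * Y"
  proof (cases "X = 0")
    case False
    then have "Y = c * f ^ N * \<kappa> * Y'" using e1 S0 by (simp add: cX Sf power_mult_distrib)
    then show ?thesis using c0 f0 \<kappa>0 by (simp add: d_def)
  next
    case True
    then have P: "proper" "V b \<noteq> 0" using xb by auto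
    then have "K \<noteq> 0" using S0 by (simp add: K_K'_def)
    have "Y' * K' = \<kappa> * (Y * K)"
      using w'[of b] unfolding defs K_K'_def by (simp add: proj_coord_b[OF P(1)])
    then have "Y' * (c * f ^ N * \<kappa>) = Y" using \<open>K \<noteq> 0\<close> \<kappa>0 unfolding cK[OF P(1)]
      by (simp add: power2_eq_square mult.assoc)
    then show ?thesis using c0 f0 \<kappa>0 by (simp add: d_def field_simps)
  qed
  have V': "V' j = V j / (c * d ^ \<beta> j * f ^ (N + a j))" for j
  proof (cases "j \<in> B")
    case False
    have "S' ^ a j * V' j = \<kappa> * (S ^ a j * V j)"
      using w'[of j] unfolding defs by (simp add: proj_coord_notin[OF False])
    then have "f ^ a j * V' j = \<kappa> * V j" using S0 by (simp add: Sf power_mult_distrib)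
    then have "V' j = \<kappa> * V j / f ^ a j" using f0 by (simp add: field_simps)
    also have "\<dots> = V j / ((c * d * f ^ N) * f ^ a j)" unfolding cdf using \<kappa>0 by simp
    finally show ?thesis using False by (simp add: power_add mult.assoc)
  next
    case True
    then have jb: "j = b" and P: proper using in_B by auto
    have "f ^ a b * V' b = c * f ^ N * \<kappa> ^ 2 * V b"
      using cK[OF P] S0 unfolding K_K'_def by (simp add: Sf power_mult_distrib)
    then have "V' b = c * f ^ N * \<kappa> ^ 2 * V b / f ^ a b" using f0 by (simp add: field_simps)
    also have "c * f ^ N * \<kappa> ^ 2 = 1 / (c * d ^ 2 * f ^ N)"
      using c0 f0 \<kappa>0 by (simp add: d_def power2_eq_square)
    finally show ?thesis using P by (simp add: jb power_add mult.assoc)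
  qed
  have "h' = act c d f h"
    using cX Y' Sf V' unfolding defs by (intro cox_eqI) simp_all
  then show ?thesis using orbit_act[OF c0 d0 f0, of h] by simp
qed

text \<open>
  On the divisor \<open>s = 0\<close> the direction is that of the \<open>p\<close>-th axis and the image in \<open>\<complex>\<^sup>n\<close> is the origin;
  points with \<open>s \<noteq> 0\<close> and these two properties are not regular.
\<close>

lemma not_both_strata:
  assumes reg: "regular h" "regular h'" and s: "h $ Cs = 0" "h' $ Cs \<noteq> 0"
    and E1: "blow_down h = blow_down h'"
    and E2: "\<And>i j. proj_coord h i * proj_coord h' j = proj_coord h j * proj_coord h' i"
  shows False
proof -
  have vp: "h $ Cv p \<noteq> 0" using regular_s0[OF reg(1) s(1)] unfolding domain_iffs by blast
  have N: "N \<noteq> 0" using a_less_N[of p] by simp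
  have z: "proj_coord h' j = 0" if "j \<noteq> p" for j
  proof -
    have "proj_coord h j = 0" using a_pos[OF that] s(1) by (simp add: proj_coord_def)
    then show ?thesis using E2[of p j] vp by (simp add: proj_coord_p)
  qed
  have "h' $ Cv q = 0" using z[of q] p_neq_q s(2) by (simp add: proj_coord_q)
  then have "h' $ Cx \<noteq> 0" "h' $ Cy \<noteq> 0" "h' $ Cv p \<noteq> 0"
    using reg(2) z unfolding regular_def by blast+
  then have "blow_down h' $ p \<noteq> 0" using s(2) by (simp add: blow_down_def)
  moreover have "blow_down h $ p = 0" using s(1) N by (simp add: blow_down_def)
  ultimately show False using E1 by simp
qed

text \<open>
  A continuous function of two points that vanishes on pairs from one orbit separates the orbits of any
  pair on which it does not vanish.
\<close>

lemma separate_orbits: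
  fixes g :: "complex ^ 'n cox \<Rightarrow> complex ^ 'n cox \<Rightarrow> complex"
  assumes c: "continuous_on UNIV (\<lambda>x. g (fst x) (snd x))" and ne: "g h h' \<noteq> 0"
    and eq: "\<And>\<eta> c d f. c \<noteq> 0 \<Longrightarrow> d \<noteq> 0 \<Longrightarrow> f \<noteq> 0 \<Longrightarrow> g \<eta> (act c d f \<eta>) = 0"
  shows "\<exists>S S'. open S \<and> open S' \<and> h \<in> S \<and> h' \<in> S' \<and> (\<forall>\<eta>\<in>S \<inter> T. \<forall>\<eta>'\<in>S' \<inter> T. orbit \<eta> \<noteq> orbit \<eta>')"
proof -
  have "open {x. g (fst x) (snd x) \<noteq> 0}"
    by (intro open_Collect_neq c continuous_on_const)
  moreover have "(h, h') \<in> {x. g (fst x) (snd x) \<noteq> 0}" using ne by simp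
  ultimately obtain S S' where S: "open S" "open S'" "(h, h') \<in> S \<times> S'"
    "S \<times> S' \<subseteq> {x. g (fst x) (snd x) \<noteq> 0}"
    by (rule open_prod_elim)
  have "orbit \<eta> \<noteq> orbit \<eta>'" if "\<eta> \<in> S" "\<eta>' \<in> S'" for \<eta> \<eta>'
  proof
    assume "orbit \<eta> = orbit \<eta>'"
    then obtain c d f where "c \<noteq> 0" "d \<noteq> 0" "f \<noteq> 0" "\<eta>' = act c d f \<eta>" by (rule orbit_eqE)
    then have "g \<eta> \<eta>' = 0" using eq by blast
    then show False using S(4) that by auto
  qed
  then show ?thesis using S(1-3) by (intro exI[of _ S] exI[of _ S']) auto
qed

lemma continuous_on_proj_coord: "continuous_on S g \<Longrightarrow> continuous_on S (\<lambda>x. proj_coord (g x) j)"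
  unfolding proj_coord_def by (intro continuous_intros)

lemma hausdorff_orbits:
  assumes reg: "regular h" "regular h'" and ne: "orbit h \<noteq> orbit h'"
  shows "(\<exists>i\<in>indices. h \<in> domain i \<and> h' \<in> domain i) \<or>
    (\<exists>S S'. open S \<and> open S' \<and> h \<in> S \<and> h' \<in> S' \<and> (\<forall>\<eta>\<in>S \<inter> T. \<forall>\<eta>'\<in>S' \<inter> T. orbit \<eta> \<noteq> orbit \<eta>'))"
proof (cases "h $ Cs = 0 \<and> h' $ Cs = 0")
  case True
  then show ?thesis using regular_s0 reg index_simps(2) by blast
next
  case False
  define K where "K \<eta> = \<eta> $ Cs ^ a b * \<eta> $ Cv b" for \<eta> :: "complex ^ 'n cox"
  define H where "H \<eta> i = \<eta> $ Cx * \<eta> $ Cs ^ N * proj_coord \<eta> i ^ 2" for \<eta> i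
  have c1: "continuous_on UNIV (\<lambda>x. blow_down (fst x) $ j - blow_down (snd x) $ j)" for j
    unfolding blow_down_proj_coord by (intro continuous_intros continuous_on_proj_coord)
  have c2: "continuous_on UNIV (\<lambda>x. proj_coord (fst x) i * proj_coord (snd x) j -
      proj_coord (fst x) j * proj_coord (snd x) i)" for i j
    by (intro continuous_intros continuous_on_proj_coord)
  have c3: "continuous_on UNIV (\<lambda>x. H (fst x) i * K (snd x) - H (snd x) i * K (fst x))" for i
    unfolding H_def K_def by (intro continuous_intros continuous_on_proj_coord)
  have i1: "blow_down \<eta> $ j - blow_down (act c d f \<eta>) $ j = 0" if "c \<noteq> 0" "d \<noteq> 0" "f \<noteq> 0" for \<eta> c d f j
    by (simp add: blow_down_act[OF that])
  have i2: "proj_coord \<eta> i * proj_coord (act c d f \<eta>) j - proj_coord \<eta> j * proj_coord (act c d f \<eta>) i = 0"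
    if "c \<noteq> 0" "d \<noteq> 0" "f \<noteq> 0" for \<eta> c d f i j
    by (simp add: proj_coord_act[OF that])
  have i3: "H \<eta> i * K (act c d f \<eta>) - H (act c d f \<eta>) i * K \<eta> = 0"
    if P: proper and nz: "c \<noteq> 0" "d \<noteq> 0" "f \<noteq> 0" for \<eta> c d f i
  proof -
    have "K (act c d f \<eta>) = K \<eta> / (c * d ^ 2 * f ^ N)"
      using nz P unfolding K_def by (simp add: power_mult_distrib power_add)
    moreover have "H (act c d f \<eta>) i = H \<eta> i / (c * d ^ 2 * f ^ N)"
      using nz unfolding H_def by (simp add: proj_coord_act[OF nz] power_mult_distrib power_divide power2_eq_square mult_ac)
    ultimately show ?thesis by simp
  qed
  consider (1) j where "blow_down h $ j - blow_down h' $ j \<noteq> 0" |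
    (2) i j where "proj_coord h i * proj_coord h' j - proj_coord h j * proj_coord h' i \<noteq> 0" |
    (3) i where proper "H h i * K h' - H h' i * K h \<noteq> 0" |
    (4) "\<forall>j. blow_down h $ j = blow_down h' $ j"
        "\<forall>i j. proj_coord h i * proj_coord h' j = proj_coord h j * proj_coord h' i"
        "\<forall>i. proper \<longrightarrow> H h i * K h' = H h' i * K h"
    by fastforce
  then show ?thesis
  proof cases
    case 1
    show ?thesis by (rule disjI2, rule separate_orbits[OF c1[of j] 1 i1])
  next
    case 2
    show ?thesis by (rule disjI2, rule separate_orbits[OF c2[of i j] 2 i2])
  next
    case 3
    show ?thesis by (rule disjI2, rule separate_orbits[OF c3[of i] 3(2) i3[OF 3(1)]])
  next
    case 4
    have E1: "blow_down h = blow_down h'" using 4(1) by (simp add: cart_eq_iff)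
    have E2: "proj_coord h i * proj_coord h' j = proj_coord h j * proj_coord h' i" for i j
      using 4(2) by blast
    have "orbit h = orbit h'"
    proof (cases "h $ Cs = 0 \<or> h' $ Cs = 0")
      case True
      then consider "h $ Cs = 0" "h' $ Cs \<noteq> 0" | "h $ Cs \<noteq> 0" "h' $ Cs = 0" using False by blast
      then show ?thesis
      proof cases
        case 1
        then show ?thesis using not_both_strata[OF reg 1 E1 E2] by blast
      next
        case 2
        have "proj_coord h' i * proj_coord h j = proj_coord h' j * proj_coord h i" for i j
          using E2[of j i] by (simp add: mult.commute)
        from not_both_strata[OF reg(2,1) 2(2,1) E1[symmetric] this] show ?thesis ..
      qed
    next
      case False
      then have s: "h $ Cs \<noteq> 0" "h' $ Cs \<noteq> 0" by auto
      show ?thesis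
        by (rule same_orbit_s_nonzero[OF reg s E1 E2]) (use 4(3) in \<open>simp add: H_def K_def\<close>)
    qed
    then show ?thesis using ne by blast
  qed
qed

lemma slice_embed_in_domain:
  "i \<noteq> Affine \<Longrightarrow> slice_embed i u \<in> domain i"
  "slice_embed Affine u \<in> domain Affine \<longleftrightarrow> u \<noteq> 0"
  by (simp_all add: domain_def slice_embed_def normalized_def slot_of_def cart_eq_iff)

lemma connected_slice_domain: "connected {u. slice_embed i u \<in> domain i}"
proof (cases "i = Affine")
  case True
  have "2 \<le> DIM(complex ^ 'n)" by (simp add: DIM_cart)
  then have "connected (- {0 :: complex ^ 'n})" by (rule connected_punctured_universe)
  moreover have "{u. slice_embed i u \<in> domain i} = - {0}"
    using slice_embed_in_domain(2) True by auto
  ultimately show ?thesis by simp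
next
  case False
  then have "{u. slice_embed i u \<in> domain i} = UNIV" using slice_embed_in_domain(1) by blast
  then show ?thesis by (simp only: convex_connected[OF convex_UNIV])
qed

text \<open>
  The saturation of an open set is a union of its translates under the group.
\<close>

lemma open_saturation_orbit:
  assumes "open S" shows "open {h. \<exists>\<eta>\<in>S. orbit \<eta> = orbit h}"
proof -
  define T where "T = {t :: complex \<times> complex \<times> complex. fst t \<noteq> 0 \<and> fst (snd t) \<noteq> 0 \<and> snd (snd t) \<noteq> 0}"
  have "{h. \<exists>\<eta>\<in>S. orbit \<eta> = orbit h} = (\<Union>t\<in>T. act (fst t) (fst (snd t)) (snd (snd t)) -` S)"
  proof (intro equalityI subsetI)
    fix h assume "h \<in> {h. \<exists>\<eta>\<in>S. orbit \<eta> = orbit h}"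
    then obtain \<eta> where \<eta>: "\<eta> \<in> S" "orbit h = orbit \<eta>" by auto
    from \<eta>(2) obtain c d f where cdf: "c \<noteq> 0" "d \<noteq> 0" "f \<noteq> 0" "\<eta> = act c d f h" by (rule orbit_eqE)
    then have "(c, d, f) \<in> T" by (simp add: T_def)
    then show "h \<in> (\<Union>t\<in>T. act (fst t) (fst (snd t)) (snd (snd t)) -` S)"
      using \<eta>(1) cdf(4) by (intro UN_I[of "(c, d, f)"]) auto
  next
    fix h assume "h \<in> (\<Union>t\<in>T. act (fst t) (fst (snd t)) (snd (snd t)) -` S)"
    then obtain c d f where "c \<noteq> 0" "d \<noteq> 0" "f \<noteq> 0" "act c d f h \<in> S" by (auto simp: T_def)
    then show "h \<in> {h. \<exists>\<eta>\<in>S. orbit \<eta> = orbit h}" using orbit_act by blast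
  qed
  moreover have "open (act c d f -` S)" for c d f
  proof (rule open_vimage[OF assms])
    show "continuous_on UNIV (act c d f)"
    proof (rule cdiff_at_imp_continuous_on_vec)
      fix h k
      show "cdiff_at (\<lambda>h. act c d f h $ k) h"
      proof (cases k)
        case (Cv j)
        have "cdiff_at (\<lambda>h. inverse (c * d ^ \<beta> j * f ^ (N + a j)) * h $ Cv j) h"
          by (intro cdiff_at_mult cdiff_at_const cdiff_at_coord)
        then show ?thesis unfolding Cv act_simps by (simp add: field_simps)
      qed (simp only: act_simps, intro cdiff_at_mult cdiff_at_const cdiff_at_coord)+
    qed
  qed
  ultimately show ?thesis by auto
qed

lemma finite_indices: "finite indices"
  by (simp add: indices_def)

sublocale quotient_atlas orbit indices domain coords slice_embed
proof
  show "countable indices" using finite_indices by (rule countable_finite)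
  show "open (domain i)" for i by (rule open_domain)
  show "h' \<in> domain i" if "h \<in> domain i" "orbit h' = orbit h" for i h h'
    by (rule domain_saturated[OF that])
  show "coords i h' = coords i h" if "i \<in> indices" "h \<in> domain i" "orbit h' = orbit h" for i h h'
    unfolding coords_def
    by (simp only: normalize_unique[OF that(1) domain_saturated[OF that(2,3)] that(2,3)])
  show "cdiff_at (\<lambda>h. coords i h $ l) h" if "i \<in> indices" "h \<in> domain i" for i h l
    unfolding coords_def vec_lambda_beta by (rule cdiff_at_normalize[OF that])
  show "cdiff_at (\<lambda>u. slice_embed i u $ k) u" for i k u by (rule cdiff_at_slice_embed)
  show "orbit (slice_embed i (coords i h)) = orbit h" if "i \<in> indices" "h \<in> domain i" for i h
    by (simp only: slice_embed_coords[OF that] orbit_normalize[OF that])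
  show "coords i (slice_embed i u) = u" if "i \<in> indices" "slice_embed i u \<in> domain i" for i u
    by (rule coords_slice[OF that])
  show "connected {u. slice_embed i u \<in> domain i}" for i by (rule connected_slice_domain)
  show "\<exists>h. \<forall>i\<in>indices. h \<in> domain i"
    by (rule exI[of _ "\<chi> k. 1"]) (simp add: domain_def)
  show "open {h. \<exists>\<eta>\<in>S. orbit \<eta> = orbit h}" if "open S" for S by (rule open_saturation_orbit[OF that])
  show "(\<exists>i\<in>indices. h \<in> domain i \<and> h' \<in> domain i) \<or>
      (\<exists>S S'. open S \<and> open S' \<and> h \<in> S \<and> h' \<in> S' \<and>
        (\<forall>\<eta>\<in>S \<inter> (\<Union>i\<in>indices. domain i). \<forall>\<eta>'\<in>S' \<inter> (\<Union>i\<in>indices. domain i). orbit \<eta> \<noteq> orbit \<eta>'))"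
    if "i \<in> indices" "j \<in> indices" "h \<in> domain i" "h' \<in> domain j" "orbit h \<noteq> orbit h'" for i j h h'
    by (rule hausdorff_orbits[OF regularI[OF that(1,3)] regularI[OF that(2,4)] that(5)])
qed

end

section \<open>The projection and the lift of the germ\<close>

lemma cdiff_at_matrix_vector_mult:
  "(\<And>k. cdiff_at (\<lambda>z. f z $ k) z) \<Longrightarrow> cdiff_at (\<lambda>z. (M *v f z) $ j) z"
  unfolding matrix_vector_mult_def vec_lambda_beta
  by (intro cdiff_at_sum cdiff_at_mult cdiff_at_const)

text \<open>
  The columns of \<open>L\<close> are the adapted basis; \<open>L\<close> translates adapted coordinates into the given ones.
\<close>

locale cox_frame = cox_data a p q b B N
  for a :: "'n :: finite \<Rightarrow> nat" and p q b :: 'n and B :: "'n set" and N :: nat +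
  fixes L L' :: "complex ^ 'n ^ 'n"
  assumes L_L': "L ** L' = identity_matrix" and L'_L: "L' ** L = identity_matrix"
begin

lemma L_inverse [simp]: "L *v (L' *v z) = z" "L' *v (L *v z) = z"
  by (simp_all add: matrix_vector_mul_assoc L_L' L'_L)

lemma L_eq_0_iff [simp]: "L *v z = 0 \<longleftrightarrow> z = 0" "L' *v z = 0 \<longleftrightarrow> z = 0"
  by (metis L_inverse matrix_vector_mult_0_right)+

definition projection :: "'n manifold_point \<Rightarrow> complex ^ 'n" where
  "projection x = L *v blow_down (SOME h. orbit h = x)"

lemma projection_orbit: "projection (orbit h) = L *v blow_down h"
proof -
  have "blow_down (SOME h'. orbit h' = orbit h) = blow_down h"
    by (rule someI2[of _ h]) (rule refl, rule blow_down_orbit)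
  then show ?thesis by (simp add: projection_def)
qed

lemma Tot_iff: "h \<in> Tot \<longleftrightarrow> regular h"
  using Union_domain unfolding Tot_def by blast

lemma topspace_quotient_space: "topspace (mtop quotient_space) = orbit ` Tot"
  by (simp add: quotient_space_def)

lemma regular_saturated: "regular h \<Longrightarrow> orbit h' = orbit h \<Longrightarrow> regular h'"
  using regularE regularI domain_saturated by blast

lemma cdiff_at_blow_down: "cdiff_at (\<lambda>h. blow_down h $ j) h"
  unfolding blow_down_def vec_lambda_beta
  by (intro cdiff_at_mult cdiff_at_power cdiff_at_coord)

lemma cdiff_at_proj_coord: "cdiff_at (\<lambda>h. proj_coord h j) h"
  unfolding proj_coord_def by (intro cdiff_at_mult cdiff_at_power cdiff_at_coord)

lemma continuous_blow_down: "continuous_on S blow_down"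
  by (rule cdiff_at_imp_continuous_on_vec) (rule cdiff_at_blow_down)

lemma coords_Affine:
  assumes "h $ Cx \<noteq> 0" "h $ Cy \<noteq> 0" "h $ Cs \<noteq> 0"
  shows "coords Affine h = blow_down h"
  using assms unfolding cart_eq_iff
  by (simp add: coords_def normalize_def slot_def blow_down_def scale_x_def scale_y_def scale_s_def
      power_divide divide_simps)

text \<open>
  Off the fibre, none of \<open>x, y, s\<close> vanishes, so every orbit has a unique representative with
  \<open>x = y = s = 1\<close>, and then \<open>v\<close> is the image point.
\<close>

lemma orbit_eq_affine:
  assumes "regular h" "blow_down h \<noteq> 0"
  shows "slice_embed Affine (blow_down h) \<in> domain Affine" "orbit (slice_embed Affine (blow_down h)) = orbit h"
proof -
  obtain j where "blow_down h $ j \<noteq> 0" using assms(2) by (auto simp: cart_eq_iff)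
  then have nz: "h $ Cx \<noteq> 0" "h $ Cy \<noteq> 0" "h $ Cs \<noteq> 0" "h $ Cv j \<noteq> 0"
    using \<beta>_pos[of j] a_less_N[of j] by (auto simp: blow_down_def power_0_left split: if_splits)
  then have dA: "h \<in> domain Affine" unfolding domain_iffs by blast
  show "slice_embed Affine (blow_down h) \<in> domain Affine" using assms(2) slice_embed_in_domain(2) by blast
  show "orbit (slice_embed Affine (blow_down h)) = orbit h"
    using slice_embed_coords[OF index_simps(1) dA] orbit_normalize[OF index_simps(1) dA]
    unfolding coords_Affine[OF nz(1-3)] by simp
qed

lemma blow_down_affine: "blow_down (slice_embed Affine z) = z"
  by (simp add: blow_down_def slice_embed_def normalized_def slot_of_def cart_eq_iff)

lemma regular_affine: "z \<noteq> 0 \<Longrightarrow> regular (slice_embed Affine z)"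
  using slice_embed_in_domain(2) regularI index_simps(1) by blast

definition base_point :: "complex ^ 'n cox" where "base_point = slice_embed Last 0"

lemma base_point_domain: "base_point \<in> domain Last"
  unfolding base_point_def by (rule slice_embed_in_domain) simp

lemma slice_Last_simps:
  "slice_embed Last u $ Cv p = 1" "slice_embed Last u $ Cv q = 1" "slice_embed Last u $ Cs = u $ q"
  "proper \<Longrightarrow> slice_embed Last u $ Cv b = 1" "proper \<Longrightarrow> slice_embed Last u $ Cx = u $ p"
  "proper \<Longrightarrow> slice_embed Last u $ Cy = u $ b"
  "\<not> proper \<Longrightarrow> slice_embed Last u $ Cx = 1" "\<not> proper \<Longrightarrow> slice_embed Last u $ Cy = u $ p"
  "j \<noteq> p \<Longrightarrow> j \<noteq> q \<Longrightarrow> j \<notin> B \<Longrightarrow> slice_embed Last u $ Cv j = u $ j"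
  using b_in by (auto simp: slice_embed_def normalized_def slot_of_def)

lemma blow_down_base_point: "blow_down base_point = 0"
proof -
  have "N \<noteq> 0" using a_less_N[of p] by simp
  then show ?thesis
    by (simp add: base_point_def blow_down_def slice_Last_simps cart_eq_iff)
qed

lemma fibre_eq: "fibre_over_0 quotient_space projection = orbit ` {h \<in> Tot. blow_down h = 0}"
  unfolding fibre_over_0_def topspace_quotient_space by (auto simp: projection_orbit)

lemma complement_of_fibre:
  "topspace (mtop quotient_space) - fibre_over_0 quotient_space projection = orbit ` {h \<in> Tot. blow_down h \<noteq> 0}"
  unfolding fibre_over_0_def topspace_quotient_space
  by (auto simp: projection_orbit dest: blow_down_orbit)

lemma open_off_fibre: "open {h \<in> Tot. blow_down h \<noteq> 0}"
proof -
  have "open (Tot \<inter> blow_down -` (- {0}))"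
    by (rule continuous_open_preimage[OF continuous_blow_down open_Tot]) auto
  moreover have "Tot \<inter> blow_down -` (- {0}) = {h \<in> Tot. blow_down h \<noteq> 0}" by auto
  ultimately show ?thesis by simp
qed

lemma projection_over_0_quotient: "projection_over_0 quotient_space projection"
  unfolding projection_over_0_def
proof (intro conjI)
  have sat: "h' \<in> Tot" if "h \<in> Tot" "orbit h' = orbit h" for h h'
    using that regular_saturated unfolding Tot_iff by blast
  show "holomorphic_map quotient_space (topspace (mtop quotient_space)) complex_space projection"
    unfolding topspace_quotient_space
    by (rule holomorphic_map_from_quotient[where P = "\<lambda>h. L *v blow_down h"])
       (rule open_Tot, rule subset_refl, rule sat, assumption+, rule cdiff_at_matrix_vector_mult, rule cdiff_at_blow_down,
        rule projection_orbit)
  have "z \<in> projection ` topspace (mtop quotient_space)" for z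
  proof (cases "z = 0")
    case True
    have "regular base_point" using regularI[OF index_simps(2) base_point_domain] .
    then have "projection (orbit base_point) \<in> projection ` topspace (mtop quotient_space)"
      unfolding topspace_quotient_space Tot_iff[symmetric] by blast
    then show ?thesis by (simp add: projection_orbit blow_down_base_point True)
  next
    case False
    then have "projection (orbit (slice_embed Affine (L' *v z))) \<in> projection ` topspace (mtop quotient_space)"
      using regular_affine[of "L' *v z"] L_eq_0_iff unfolding topspace_quotient_space Tot_iff[symmetric] by blast
    then show ?thesis by (simp add: projection_orbit blow_down_affine)
  qed
  then show "projection ` topspace (mtop quotient_space) = UNIV" by blast
  let ?W = "{h \<in> Tot. blow_down h \<noteq> 0}"
  show "biholomorphism quotient_space (topspace (mtop quotient_space) - fibre_over_0 quotient_space projection)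
      complex_space (- {0}) projection"
    unfolding biholomorphism_def complement_of_fibre
  proof (intro conjI)
    have inj: "inj_on projection (orbit ` ?W)"
    proof (rule inj_onI)
      fix x x' assume "x \<in> orbit ` ?W" "x' \<in> orbit ` ?W" and eq: "projection x = projection x'"
      then obtain h h' where w: "regular h" "blow_down h \<noteq> 0" "x = orbit h"
        "regular h'" "blow_down h' \<noteq> 0" "x' = orbit h'" unfolding Tot_iff by blast
      have "L *v blow_down h = L *v blow_down h'" using eq w(3,6) by (simp add: projection_orbit)
      then have "blow_down h = blow_down h'" by (metis L_inverse(2))
      then show "x = x'" using orbit_eq_affine(2)[OF w(1,2)] orbit_eq_affine(2)[OF w(4,5)] w(3,6) by simp
    qed
    have img: "projection ` (orbit ` ?W) = - {0}"
    proof (intro equalityI subsetI)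
      fix z assume "z \<in> projection ` (orbit ` ?W)"
      then show "z \<in> - {0}" by (auto simp: projection_orbit)
    next
      fix z :: "complex ^ 'n" assume "z \<in> - {0}"
      then have "slice_embed Affine (L' *v z) \<in> ?W" using regular_affine by (simp add: Tot_iff blow_down_affine)
      then have "projection (orbit (slice_embed Affine (L' *v z))) \<in> projection ` (orbit ` ?W)" by blast
      then show "z \<in> projection ` (orbit ` ?W)" by (simp only: projection_orbit blow_down_affine L_inverse)
    qed
    show "bij_betw projection (orbit ` ?W) (- {0})" using inj img by (simp add: bij_betw_def)
    show "holomorphic_map quotient_space (orbit ` ?W) complex_space projection"
    proof (rule holomorphic_map_from_quotient[where P = "\<lambda>h. L *v blow_down h"])
      show "open ?W" by (rule open_off_fibre)
      show "h' \<in> ?W" if "h \<in> ?W" "orbit h' = orbit h" for h h'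
        using that sat blow_down_orbit[OF that(2)] by auto
      show "cdiff_at (\<lambda>h. (L *v blow_down h) $ l) h" for h l
        by (rule cdiff_at_matrix_vector_mult) (rule cdiff_at_blow_down)
      show "projection (orbit h) = L *v blow_down h" for h by (rule projection_orbit)
    qed auto
    show "holomorphic_map complex_space (- {0}) quotient_space (inv_into (orbit ` ?W) projection)"
    proof (rule holomorphic_map_into_quotient[where \<kappa> = "\<lambda>z. slice_embed Affine (L' *v z)"])
      fix z :: "complex ^ 'n" assume z: "z \<in> - {0}"
      then show "slice_embed Affine (L' *v z) \<in> Tot" using regular_affine by (simp add: Tot_iff)
      then have W: "slice_embed Affine (L' *v z) \<in> ?W" using z by (simp add: blow_down_affine)
      have "projection (orbit (slice_embed Affine (L' *v z))) = z"
        by (simp only: projection_orbit blow_down_affine L_inverse)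
      then show "inv_into (orbit ` ?W) projection z = orbit (slice_embed Affine (L' *v z))"
        using W by (intro inv_into_f_eq[OF inj] imageI)
      show "cdiff_at (\<lambda>z. slice_embed Affine (L' *v z) $ l) z" for l
        by (rule cdiff_at_compose[where f = "\<lambda>z. L' *v z", OF cdiff_at_slice_embed])
           (rule cdiff_at_matrix_vector_mult, rule cdiff_at_coord)
    qed auto
  qed
qed

end

text \<open>
  The germ \<open>F\<close>, expanded in adapted coordinates by Hadamard's lemma. The matrix \<open>A\<close> is triangular with
  respect to the weights, and the hyperplane that is blown up is invariant under \<open>A\<close>.
\<close>

locale cox_germ = cox_frame a p q b B N L L'
  for a :: "'n :: finite \<Rightarrow> nat" and p q b :: 'n and B :: "'n set" and N :: nat
    and L L' :: "complex ^ 'n ^ 'n" +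
  fixes A :: "complex ^ 'n ^ 'n" and F :: "complex ^ 'n \<Rightarrow> complex ^ 'n"
    and Q :: "'n \<Rightarrow> 'n \<Rightarrow> 'n \<Rightarrow> complex ^ 'n \<Rightarrow> complex" and \<rho> :: real
  assumes triangular: "A $ j $ k \<noteq> 0 \<Longrightarrow> j \<noteq> k \<Longrightarrow> a j < a k"
    and diag_nonzero: "A $ j $ j \<noteq> 0"
    and diag_p_q: "A $ q $ q = A $ p $ p"
    and invariant_hyperplane: "j \<in> B \<Longrightarrow> k \<noteq> j \<Longrightarrow> A $ j $ k = 0"
    and \<rho>_pos: "\<rho> > 0"
    and cdiff_Q: "z \<in> polydisc \<rho> \<Longrightarrow> cdiff_at (Q j k i) z"
    and F_expansion: "z \<in> polydisc \<rho> \<Longrightarrow> (L' *v F (L *v z)) $ j =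
      (\<Sum>k\<in>UNIV. A $ j $ k * z $ k) + (\<Sum>k\<in>UNIV. \<Sum>i\<in>UNIV. z $ k * z $ i * Q j k i z)"
begin

definition remainder :: "complex ^ 'n cox \<Rightarrow> 'n \<Rightarrow> complex" where
  "remainder h j = (\<Sum>k\<in>UNIV. \<Sum>i\<in>UNIV. proj_coord h k * proj_coord h i * Q j k i (blow_down h))"

text \<open>
  The quotient of the \<open>j\<close>-th component of \<open>F\<close> by \<open>x y\<^bsup>\<beta> j\<^esup> s\<^bsup>N + a j\<^esup>\<close>, written without a division. The truncated
  differences in the first sum are genuine ones whenever \<open>A\<^sub>j\<^sub>k \<noteq> 0\<close> (lemma \<open>exponents_le\<close>).
\<close>

definition lift_vertex :: "complex ^ 'n cox \<Rightarrow> 'n \<Rightarrow> complex" where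
  "lift_vertex h j =
    (\<Sum>k\<in>UNIV. A $ j $ k * (h $ Cy ^ (\<beta> k - \<beta> j) * h $ Cs ^ (a k - a j) * h $ Cv k)) +
    h $ Cx * h $ Cy ^ (2 - \<beta> j) * h $ Cs ^ (N - a j) * remainder h j"

definition lift :: "complex ^ 'n cox \<Rightarrow> complex ^ 'n cox" where
  "lift h = (\<chi> k. case k of Cv j \<Rightarrow> lift_vertex h j | _ \<Rightarrow> h $ k)"

lemma lift_simps [simp]:
  "lift h $ Cx = h $ Cx" "lift h $ Cy = h $ Cy" "lift h $ Cs = h $ Cs" "lift h $ Cv j = lift_vertex h j"
  by (simp_all add: lift_def)

lemma \<beta>_le_2: "\<beta> j \<le> 2" by (simp add: \<beta>_def)

lemma exponents_le:
  assumes "A $ j $ k \<noteq> 0" shows "a j \<le> a k" "\<beta> j \<le> \<beta> k"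
proof -
  show "a j \<le> a k" using triangular[OF assms] by (cases "j = k") auto
  have "j \<in> B \<Longrightarrow> k \<in> B" using invariant_hyperplane[of j k] assms by (cases "k = j") auto
  then show "\<beta> j \<le> \<beta> k" by (simp add: \<beta>_def)
qed

text \<open>
  On directions the lift acts by \<open>A\<close>, up to a term that vanishes on the exceptional set.
\<close>

lemma proj_coord_lift:
  "proj_coord (lift h) j =
    (\<Sum>k\<in>UNIV. A $ j $ k * proj_coord h k) + h $ Cx * h $ Cy * h $ Cs ^ N * remainder h j"
proof -
  let ?Y = "h $ Cy" and ?S = "h $ Cs"
  have 1: "?Y ^ (\<beta> j - 1) * ?S ^ a j * (A $ j $ k * (?Y ^ (\<beta> k - \<beta> j) * ?S ^ (a k - a j) * h $ Cv k)) =
     A $ j $ k * proj_coord h k" for k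
  proof (cases "A $ j $ k = 0")
    case False
    have "?Y ^ (\<beta> j - 1) * ?Y ^ (\<beta> k - \<beta> j) = ?Y ^ (\<beta> k - 1)"
      using exponents_le(2)[OF False] \<beta>_pos[of j] by (simp flip: power_add)
    moreover have "?S ^ a j * ?S ^ (a k - a j) = ?S ^ a k"
      using exponents_le(1)[OF False] by (simp flip: power_add)
    moreover have "?Y ^ (\<beta> j - 1) * ?S ^ a j * (A $ j $ k * (?Y ^ (\<beta> k - \<beta> j) * ?S ^ (a k - a j) * h $ Cv k)) =
       A $ j $ k * ((?Y ^ (\<beta> j - 1) * ?Y ^ (\<beta> k - \<beta> j)) * (?S ^ a j * ?S ^ (a k - a j)) * h $ Cv k)"
      by (simp only: mult_ac)
    ultimately show ?thesis unfolding proj_coord_def by (simp only:)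
  qed simp
  have "?Y ^ (\<beta> j - 1) * ?Y ^ (2 - \<beta> j) = ?Y"
    using \<beta>_le_2[of j] \<beta>_pos[of j] by (cases "j \<in> B") (simp_all add: \<beta>_def)
  moreover have "?S ^ a j * ?S ^ (N - a j) = ?S ^ N"
    using a_less_N[of j] by (simp flip: power_add)
  moreover have "?Y ^ (\<beta> j - 1) * ?S ^ a j * (h $ Cx * ?Y ^ (2 - \<beta> j) * ?S ^ (N - a j) * remainder h j) =
     h $ Cx * (?Y ^ (\<beta> j - 1) * ?Y ^ (2 - \<beta> j)) * (?S ^ a j * ?S ^ (N - a j)) * remainder h j"
    by (simp only: mult_ac)
  ultimately have 2: "?Y ^ (\<beta> j - 1) * ?S ^ a j * (h $ Cx * ?Y ^ (2 - \<beta> j) * ?S ^ (N - a j) * remainder h j) =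
     h $ Cx * ?Y * ?S ^ N * remainder h j"
    by (simp only:)
  show ?thesis
    unfolding proj_coord_def[of "lift h"] lift_simps lift_vertex_def distrib_left sum_distrib_left 1 2 ..
qed

lemma blow_down_lift:
  assumes "blow_down h \<in> polydisc \<rho>" shows "blow_down (lift h) = L' *v F (L *v blow_down h)"
  unfolding cart_eq_iff
proof
  fix j
  define t where "t = h $ Cx * h $ Cy * h $ Cs ^ N"
  have z: "blow_down h $ k = t * proj_coord h k" for k by (simp add: blow_down_proj_coord t_def)
  have "blow_down (lift h) $ j = t * proj_coord (lift h) j" by (simp add: blow_down_proj_coord t_def)
  also have "\<dots> = t * (\<Sum>k\<in>UNIV. A $ j $ k * proj_coord h k) + t * (t * remainder h j)"
    unfolding proj_coord_lift t_def by (simp add: distrib_left)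
  also have "t * (\<Sum>k\<in>UNIV. A $ j $ k * proj_coord h k) = (\<Sum>k\<in>UNIV. A $ j $ k * blow_down h $ k)"
    by (simp add: z sum_distrib_left mult_ac)
  also have "t * (t * remainder h j) =
      (\<Sum>k\<in>UNIV. \<Sum>i\<in>UNIV. blow_down h $ k * blow_down h $ i * Q j k i (blow_down h))"
    by (simp add: z remainder_def sum_distrib_left mult_ac)
  finally show "blow_down (lift h) $ j = (L' *v F (L *v blow_down h)) $ j" by (simp only: F_expansion[OF assms])
qed

text \<open>
  The lift commutes with the torus, since all its terms have the same weight; hence it descends to the
  quotient.
\<close>

lemma lift_act:
  assumes nz: "c \<noteq> 0" "d \<noteq> 0" "f \<noteq> 0"
  shows "lift (act c d f h) = act c d f (lift h)"
proof (rule cox_eqI)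
  fix j
  let ?D = "c * d ^ \<beta> j * f ^ (N + a j)"
  let ?Y = "h $ Cy" and ?S = "h $ Cs"
  have D0: "?D \<noteq> 0" using nz by simp
  have 1: "A $ j $ k * ((d * ?Y) ^ (\<beta> k - \<beta> j) * (f * ?S) ^ (a k - a j) * (h $ Cv k / (c * d ^ \<beta> k * f ^ (N + a k))))
     = A $ j $ k * (?Y ^ (\<beta> k - \<beta> j) * ?S ^ (a k - a j) * h $ Cv k) / ?D" for k
  proof (cases "A $ j $ k = 0")
    case False
    have "d ^ \<beta> k = d ^ \<beta> j * d ^ (\<beta> k - \<beta> j)" "f ^ (N + a k) = f ^ (N + a j) * f ^ (a k - a j)"
      using exponents_le[OF False] by (simp_all flip: power_add)
    then show ?thesis using nz by (simp add: power_mult_distrib mult_ac)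
  qed simp
  have r: "remainder (act c d f h) j = remainder h j / (c * d * f ^ N) ^ 2"
    unfolding remainder_def blow_down_act[OF nz] proj_coord_act[OF nz]
    by (simp add: sum_divide_distrib power2_eq_square)
  have "d ^ 2 = d ^ \<beta> j * d ^ (2 - \<beta> j)" using \<beta>_le_2[of j] by (simp flip: power_add)
  moreover have "f ^ N = f ^ a j * f ^ (N - a j)" using a_less_N[of j] by (simp flip: power_add)
  ultimately have "(c * d * f ^ N) ^ 2 = ?D * (c * d ^ (2 - \<beta> j) * f ^ (N - a j))"
    by (simp add: power2_eq_square power_add mult_ac)
  then have 2: "c * h $ Cx * (d * ?Y) ^ (2 - \<beta> j) * (f * ?S) ^ (N - a j) * remainder (act c d f h) j =
      h $ Cx * ?Y ^ (2 - \<beta> j) * ?S ^ (N - a j) * remainder h j / ?D"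
    unfolding r using nz by (simp only: power_mult_distrib) (simp add: mult_ac)
  show "lift (act c d f h) $ Cv j = act c d f (lift h) $ Cv j"
    unfolding lift_simps act_simps lift_vertex_def 1 2 add_divide_distrib sum_divide_distrib ..
qed simp_all

lemma cdiff_at_lift:
  assumes "blow_down h \<in> polydisc \<rho>" shows "cdiff_at (\<lambda>h. lift h $ k) h"
proof (cases k)
  case (Cv j)
  have "cdiff_at (\<lambda>h. Q j k i (blow_down h)) h" for k i
    by (rule cdiff_at_compose[where g = "Q j k i" and f = blow_down])
      (rule cdiff_Q[OF assms], rule cdiff_at_blow_down)
  then show ?thesis
    unfolding Cv lift_simps lift_vertex_def remainder_def
    by (intro cdiff_at_add cdiff_at_sum cdiff_at_mult cdiff_at_power cdiff_at_coord cdiff_at_const cdiff_at_proj_coord)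
qed (simp_all only: lift_simps cdiff_at_coord)

lemma lift_vertex_s0:
  assumes s: "h $ Cs = 0" and d: "\<And>k. A $ j $ k \<noteq> 0 \<Longrightarrow> k \<noteq> j \<Longrightarrow> a j < a k"
  shows "lift_vertex h j = A $ j $ j * h $ Cv j"
proof -
  have "(\<Sum>k\<in>UNIV. A $ j $ k * (h $ Cy ^ (\<beta> k - \<beta> j) * h $ Cs ^ (a k - a j) * h $ Cv k)) =
      (\<Sum>k\<in>UNIV. if k = j then A $ j $ j * h $ Cv j else 0)"
  proof (rule sum.cong)
    fix k show "A $ j $ k * (h $ Cy ^ (\<beta> k - \<beta> j) * h $ Cs ^ (a k - a j) * h $ Cv k) =
        (if k = j then A $ j $ j * h $ Cv j else 0)"
      using d[of k] s by (cases "k = j"; cases "A $ j $ k = 0") (auto simp: power_0_left)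
  qed simp
  moreover have "h $ Cs ^ (N - a j) = 0" using s a_less_N[of j] by (simp add: power_0_left)
  ultimately show ?thesis unfolding lift_vertex_def by simp
qed

text \<open>
  The lift is defined along the whole fibre. On \<open>s = 0\<close> it is the diagonal linear map with the diagonal
  entries of \<open>A\<close>. Elsewhere the direction changes by \<open>A\<close>, and a direction other than that of the \<open>p\<close>-th
  axis is not mapped to the latter: among the nonzero coordinates \<open>j \<noteq> p\<close> of a vector, one of maximal
  weight is multiplied by \<open>A\<^sub>j\<^sub>j\<close>.
\<close>

lemma regular_lift:
  assumes reg: "regular h" and z: "blow_down h = 0"
  shows "regular (lift h)"
proof (cases "h $ Cs = 0")
  case True
  have L: "lift_vertex h j = A $ j $ j * h $ Cv j" for j
  proof (rule lift_vertex_s0[OF True])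
    show "a j < a k" if "A $ j $ k \<noteq> 0" "k \<noteq> j" for k using triangular[OF that(1)] that(2) by simp
  qed
  have "h \<in> domain Last" by (rule regular_s0[OF reg True])
  then have "lift h \<in> domain Last" unfolding domain_iffs by (cases proper) (simp_all add: L diag_nonzero)
  then show ?thesis using regularI index_simps(2) by blast
next
  case False
  obtain j0 where "proj_coord h j0 \<noteq> 0" using proj_coord_nonzero[OF reg] .
  then have xy: "h $ Cx * h $ Cy = 0"
    using arg_cong[OF z, of "\<lambda>z. z $ j0"] False unfolding blow_down_proj_coord by simp
  define J where "J = {j. j \<noteq> p \<and> proj_coord h j \<noteq> 0}"
  have "J \<noteq> {}"
  proof -
    have "proj_coord h q \<noteq> 0" if "h $ Cv q \<noteq> 0" using that False by (simp add: proj_coord_q)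
    then have "q \<in> J" if "h $ Cv q \<noteq> 0" using that p_neq_q by (simp add: J_def)
    moreover have "\<not> (h $ Cx \<noteq> 0 \<and> h $ Cy \<noteq> 0 \<and> h $ Cv p \<noteq> 0)" using xy by auto
    ultimately show ?thesis using reg unfolding regular_def J_def by blast
  qed
  have fin: "finite (a ` J)" by simp
  have "Max (a ` J) \<in> a ` J" by (rule Max_in[OF fin]) (simp add: \<open>J \<noteq> {}\<close>)
  then obtain j where j: "Max (a ` J) = a j" "j \<in> J" by (rule imageE)
  have max: "a k \<le> a j" if "k \<in> J" for k
    using Max_ge[OF fin imageI[OF that]] unfolding j(1) .
  have "A $ j $ k * proj_coord h k = (if k = j then A $ j $ j * proj_coord h j else 0)" for k
  proof (cases "k = j \<or> A $ j $ k = 0")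
    case False
    then have "a j < a k" using triangular[of j k] by auto
    then have "k \<noteq> p" "k \<notin> J" using max[of k] a_p by auto
    then show ?thesis using False by (simp add: J_def)
  qed auto
  then have "(\<Sum>k\<in>UNIV. A $ j $ k * proj_coord h k) =
      (\<Sum>k\<in>UNIV. if k = j then A $ j $ j * proj_coord h j else 0)"
    by (intro sum.cong refl)
  then have "proj_coord (lift h) j = A $ j $ j * proj_coord h j"
    unfolding proj_coord_lift xy by simp
  then have 1: "j \<noteq> p \<and> proj_coord (lift h) j \<noteq> 0" using j(2) diag_nonzero by (simp add: J_def)
  have 2: "h $ Cx \<noteq> 0 \<or> proper \<and> lift_vertex h b \<noteq> 0"
  proof (cases "h $ Cx = 0")
    case True
    then have "proper \<and> h $ Cv b \<noteq> 0" using reg unfolding regular_def by (cases proper) auto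
    then have P: proper "h $ Cv b \<noteq> 0" by blast+
    have "A $ b $ k * (h $ Cy ^ (\<beta> k - \<beta> b) * h $ Cs ^ (a k - a b) * h $ Cv k) =
        (if k = b then A $ b $ b * h $ Cv b else 0)" for k
      using invariant_hyperplane[OF b_in[OF P(1)], of k] by auto
    then have "(\<Sum>k\<in>UNIV. A $ b $ k * (h $ Cy ^ (\<beta> k - \<beta> b) * h $ Cs ^ (a k - a b) * h $ Cv k)) =
        (\<Sum>k\<in>UNIV. if k = b then A $ b $ b * h $ Cv b else 0)"
      by (intro sum.cong refl)
    then have "lift_vertex h b = A $ b $ b * h $ Cv b" unfolding lift_vertex_def using True by simp
    then show ?thesis using P diag_nonzero by simp
  qed simp
  show ?thesis using 1 2 False unfolding regular_def lift_simps by blast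
qed

definition induced :: "'n manifold_point \<Rightarrow> 'n manifold_point" where
  "induced x = orbit (lift (SOME h. orbit h = x))"

lemma induced_orbit: "induced (orbit h) = orbit (lift h)"
  unfolding induced_def
proof (rule someI2[of _ h])
  fix h' assume "orbit h' = orbit h"
  then obtain c d f where "c \<noteq> 0" "d \<noteq> 0" "f \<noteq> 0" "h = act c d f h'" by (rule orbit_eqE)
  then show "orbit (lift h') = orbit (lift h)" by (simp add: lift_act orbit_act)
qed (rule refl)

text \<open>
  An open neighbourhood of the fibre, cut out by what is needed for the lift to make sense.
\<close>

definition lift_domain :: "(complex ^ 'n cox) set" where
  "lift_domain = {h \<in> Tot. blow_down h \<in> polydisc \<rho> \<and> lift h \<in> Tot}"

lemma continuous_lift: "continuous_on {h. blow_down h \<in> polydisc \<rho>} lift"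
  by (rule cdiff_at_imp_continuous_on_vec) (rule cdiff_at_lift, simp)

lemma open_blow_down_polydisc: "open {h. blow_down h \<in> polydisc \<rho>}"
  using open_vimage[OF open_polydisc continuous_blow_down] unfolding vimage_def .

lemma open_lift_domain: "open lift_domain"
proof -
  have "open ({h. blow_down h \<in> polydisc \<rho>} \<inter> lift -` Tot)"
    by (rule continuous_open_preimage[OF continuous_lift open_blow_down_polydisc open_Tot])
  moreover have "lift_domain = Tot \<inter> ({h. blow_down h \<in> polydisc \<rho>} \<inter> lift -` Tot)"
    unfolding lift_domain_def by auto
  ultimately show ?thesis using open_Tot by (simp only: open_Int)
qed

lemma lift_domain_saturated: "h \<in> lift_domain \<Longrightarrow> orbit h' = orbit h \<Longrightarrow> h' \<in> lift_domain"
proof -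
  assume w: "h \<in> lift_domain" and o: "orbit h' = orbit h"
  have "orbit (lift h') = orbit (lift h)" using induced_orbit o by metis
  then have "regular (lift h')" "regular h'"
    using regular_saturated w o unfolding lift_domain_def Tot_iff by blast+
  then show "h' \<in> lift_domain" using w blow_down_orbit[OF o] unfolding lift_domain_def Tot_iff by simp
qed

lemma zero_in_polydisc: "0 \<in> polydisc \<rho>" using \<rho>_pos by (simp add: polydisc_def)

lemma fibre_in_lift_domain: "h \<in> Tot \<Longrightarrow> blow_down h = 0 \<Longrightarrow> h \<in> lift_domain"
  using regular_lift zero_in_polydisc unfolding lift_domain_def Tot_iff by simp

lemma germ_lift_induced: "germ_lift F quotient_space projection induced"
  unfolding germ_lift_def
proof (intro conjI exI)
  show "fibre_over_0 quotient_space projection \<subseteq> orbit ` lift_domain"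
    "fibre_over_0 quotient_space projection \<subseteq> orbit ` lift_domain"
    unfolding fibre_eq using fibre_in_lift_domain by blast+
  have sub: "lift_domain \<subseteq> Tot" unfolding lift_domain_def by blast
  show "holomorphic_map quotient_space (orbit ` lift_domain) quotient_space induced"
  proof (rule holomorphic_map_between_quotients[where \<Phi> = lift])
    show "cdiff_at (\<lambda>h. lift h $ l) h" if "h \<in> lift_domain" for h l
      using that by (intro cdiff_at_lift) (simp add: lift_domain_def)
    show "lift h \<in> Tot" if "h \<in> lift_domain" for h using that by (simp add: lift_domain_def)
    show "induced (orbit h) = orbit (lift h)" for h by (rule induced_orbit)
    show "h' \<in> lift_domain" if "h \<in> lift_domain" "orbit h' = orbit h" for h h'
      by (rule lift_domain_saturated[OF that])
  qed (rule open_lift_domain, rule sub)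
  have "openin quotient_topology (orbit ` lift_domain)"
    by (rule openin_image[OF open_lift_domain sub]) (rule lift_domain_saturated)
  then show "openin (mtop quotient_space) (orbit ` lift_domain)" by (simp add: quotient_space_def)
  show "\<forall>x\<in>orbit ` lift_domain. projection (induced x) = F (projection x)"
    by (auto simp: induced_orbit projection_orbit lift_domain_def blow_down_lift)
qed

end

section \<open>The differential at the distinguished point\<close>

text \<open>
  In a product whose first factor vanishes, only the value of the second factor matters for the
  derivative. With a vanishing value the product has derivative zero.
\<close>

lemma has_derivative_mult_vanishing:
  fixes f c :: "complex ^ 'm \<Rightarrow> complex"
  assumes f: "(f has_derivative f') (at z)" "f z = 0" and c: "cdiff_at c z"
  shows "((\<lambda>u. f u * c u) has_derivative (\<lambda>v. f' v * c z)) (at z)"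
proof -
  obtain c' where "(c has_derivative c') (at z)" using c unfolding cdiff_at_def by blast
  from has_derivative_mult[OF f(1) this] show ?thesis by (simp add: f(2))
qed

lemma has_derivative_coord: "((\<lambda>u. u $ k) has_derivative (\<lambda>v. v $ k)) (at (z :: complex ^ 'm))"
  by (intro bounded_linear_imp_has_derivative bounded_linear_vec_nth)

definition diagonal_matrix :: "('n \<Rightarrow> complex) \<Rightarrow> complex ^ 'n ^ 'n" where
  "diagonal_matrix d = (\<chi> j k. if j = k then d j else 0)"

lemma diagonal_matrix_mult: "(diagonal_matrix d *v v) $ j = d j * v $ j"
proof -
  have "(diagonal_matrix d *v v) $ j = (\<Sum>k\<in>UNIV. if k = j then d j * v $ j else 0)"
    unfolding matrix_vector_mult_def diagonal_matrix_def vec_lambda_beta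
    by (rule sum.cong) auto
  then show ?thesis by simp
qed

context cox_germ
begin

definition multiplier :: "'n \<Rightarrow> complex" where
  "multiplier j = (if j = p then if proper then (A $ p $ p)\<^sup>2 / A $ b $ b else A $ p $ p
                   else A $ j $ j / A $ p $ p)"

lemma coords_Last:
  "coords Last \<eta> $ q = \<eta> $ Cs * scale_s Last \<eta>"
  "proper \<Longrightarrow> coords Last \<eta> $ p = \<eta> $ Cx * scale_x Last \<eta>"
  "\<not> proper \<Longrightarrow> coords Last \<eta> $ p = \<eta> $ Cy * scale_y Last \<eta>"
  "proper \<Longrightarrow> coords Last \<eta> $ b = \<eta> $ Cy * scale_y Last \<eta>"
  "j \<noteq> p \<Longrightarrow> j \<noteq> q \<Longrightarrow> j \<notin> B \<Longrightarrow> coords Last \<eta> $ j =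
     \<eta> $ Cv j * (1 / (scale_x Last \<eta> * scale_y Last \<eta> * scale_s Last \<eta> ^ (N + a j)))"
  using p_neq_q b_neq b_in by (simp_all add: coords_def normalize_def slot_def)

abbreviation local_lift :: "complex ^ 'n \<Rightarrow> complex ^ 'n cox" where
  "local_lift u \<equiv> lift (slice_embed Last u)"

lemma lift_vertex_base: "lift_vertex (slice_embed Last 0) j = A $ j $ j * slice_embed Last 0 $ Cv j"
proof (rule lift_vertex_s0)
  show "slice_embed Last 0 $ Cs = 0" by (simp add: slice_Last_simps)
  show "a j < a k" if "A $ j $ k \<noteq> 0" "k \<noteq> j" for k using triangular[OF that(1)] that(2) by simp
qed

lemma lift_base_domain: "local_lift 0 \<in> domain Last"
  unfolding domain_iffs by (cases proper) (simp_all add: lift_vertex_base slice_Last_simps diag_nonzero)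

lemma scale_base:
  "scale_s Last (local_lift 0) = 1"
  "scale_y Last (local_lift 0) = (if proper then A $ b $ b / A $ p $ p else A $ p $ p)"
  "scale_x Last (local_lift 0) = (if proper then (A $ p $ p)\<^sup>2 / A $ b $ b else 1)"
proof -
  show s: "scale_s Last (local_lift 0) = 1"
    using diag_nonzero[of p] by (simp add: scale_s_def lift_vertex_base slice_Last_simps diag_p_q)
  show y: "scale_y Last (local_lift 0) = (if proper then A $ b $ b / A $ p $ p else A $ p $ p)"
    using s by (cases proper) (simp_all add: scale_y_def lift_vertex_base slice_Last_simps)
  show "scale_x Last (local_lift 0) = (if proper then (A $ p $ p)\<^sup>2 / A $ b $ b else 1)"
    using s y by (cases proper) (simp_all add: scale_x_def lift_vertex_base slice_Last_simps power2_eq_square)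
qed

lemma base_in_polydisc: "blow_down (slice_embed Last 0) \<in> polydisc \<rho>"
  using blow_down_base_point zero_in_polydisc by (simp add: base_point_def)

lemma cdiff_at_local_lift: "cdiff_at (\<lambda>u. local_lift u $ k) 0"
  by (rule cdiff_at_compose[where g = "\<lambda>h. lift h $ k" and f = "slice_embed Last"])
     (rule cdiff_at_lift[OF base_in_polydisc], rule cdiff_at_slice_embed)

lemma cdiff_at_local_scale:
  "cdiff_at (\<lambda>u. scale_s Last (local_lift u)) 0"
  "cdiff_at (\<lambda>u. scale_y Last (local_lift u)) 0"
  "cdiff_at (\<lambda>u. scale_x Last (local_lift u)) 0"
  by (rule cdiff_at_compose[where f = local_lift],
      rule cdiff_at_scale[OF index_simps(2) lift_base_domain], rule cdiff_at_local_lift)+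

lemma local_exceptional_divisor:
  assumes "j \<notin> B" shows "slice_embed Last 0 $ Cy ^ (2 - \<beta> j) = 0"
  using assms by (cases proper) (simp_all add: slice_Last_simps)

text \<open>
  Each off-diagonal term, and the nonlinear remainder, is a product of \<open>s\<close> and a function that vanishes
  at the distinguished point, so only the diagonal term contributes.
\<close>

lemma lift_vertex_derivative:
  assumes j: "j \<noteq> p" "j \<noteq> q" "j \<notin> B"
  shows "((\<lambda>u. lift_vertex (slice_embed Last u) j) has_derivative (\<lambda>v. A $ j $ j * v $ j)) (at 0)"
proof -
  let ?w = "slice_embed Last"
  note rules = cdiff_at_mult cdiff_at_power cdiff_at_const cdiff_at_slice_embed
  have s: "((\<lambda>u. ?w u $ Cs) has_derivative (\<lambda>v. v $ q)) (at 0)" "?w 0 $ Cs = 0"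
    using has_derivative_coord[of q] by (simp_all add: slice_Last_simps)
  have summand: "((\<lambda>u. A $ j $ k * (?w u $ Cy ^ (\<beta> k - \<beta> j) * ?w u $ Cs ^ (a k - a j) * ?w u $ Cv k))
      has_derivative (\<lambda>v. if k = j then A $ j $ j * v $ j else 0)) (at 0)" for k
  proof (cases "k = j")
    case True
    have "((\<lambda>u. A $ j $ j * u $ j) has_derivative (\<lambda>v. A $ j $ j * v $ j)) (at 0)"
      by (intro has_derivative_mult_right has_derivative_coord)
    then show ?thesis using True j by (simp add: slice_Last_simps)
  next
    case False
    show ?thesis
    proof (cases "A $ j $ k = 0")
      case True
      then show ?thesis using False by simp
    next
      case nz: False
      then have lt: "a j < a k" using triangular False by blast
      then have kp: "k \<noteq> p" using a_p by auto
      have kq: "k \<noteq> q" using lt a_q a_pos[OF j(1)] by auto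
      define c where "c u = A $ j $ k * (?w u $ Cy ^ (\<beta> k - \<beta> j) * ?w u $ Cs ^ (a k - a j - 1) * ?w u $ Cv k)" for u
      have "c 0 = 0"
      proof (cases "k \<in> B")
        case True
        then have "\<beta> k - \<beta> j = 1" "proper" using j(3) in_B by (auto simp: \<beta>_def)
        then show ?thesis by (simp add: c_def slice_Last_simps)
      next
        case False
        then show ?thesis using kp kq by (simp add: c_def slice_Last_simps)
      qed
      moreover have "cdiff_at c 0" unfolding c_def[abs_def] by (intro rules)
      ultimately have "((\<lambda>u. ?w u $ Cs * c u) has_derivative (\<lambda>v. 0)) (at 0)"
        using has_derivative_mult_vanishing[OF s, of c] by simp
      moreover have "?w u $ Cs * c u =
          A $ j $ k * (?w u $ Cy ^ (\<beta> k - \<beta> j) * ?w u $ Cs ^ (a k - a j) * ?w u $ Cv k)" for u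
      proof -
        have "?w u $ Cs ^ (a k - a j) = ?w u $ Cs * ?w u $ Cs ^ (a k - a j - 1)"
          using lt by (simp add: Suc_diff_Suc flip: power_Suc)
        then show ?thesis by (simp add: c_def mult_ac)
      qed
      ultimately show ?thesis using False by simp
    qed
  qed
  define c where "c u = ?w u $ Cx * ?w u $ Cy ^ (2 - \<beta> j) * ?w u $ Cs ^ (N - a j - 1) * remainder (?w u) j" for u
  have "cdiff_at (\<lambda>u. remainder (?w u) j) 0"
    unfolding remainder_def
  proof (intro cdiff_at_sum cdiff_at_mult)
    show "cdiff_at (\<lambda>u. proj_coord (?w u) k) 0" for k
      unfolding proj_coord_def by (intro rules)
    then show "cdiff_at (\<lambda>u. proj_coord (?w u) k) 0" for k .
    show "cdiff_at (\<lambda>u. Q j k i (blow_down (?w u))) 0" for k i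
      by (rule cdiff_at_compose[where g = "Q j k i" and f = "\<lambda>u. blow_down (?w u)", OF cdiff_Q[OF base_in_polydisc]])
         (unfold blow_down_def vec_lambda_beta, intro rules)
  qed
  then have "cdiff_at c 0" unfolding c_def[abs_def] by (intro rules)
  moreover have "c 0 = 0" using local_exceptional_divisor[OF j(3)] by (simp add: c_def)
  ultimately have "((\<lambda>u. ?w u $ Cs * c u) has_derivative (\<lambda>v. 0)) (at 0)"
    using has_derivative_mult_vanishing[OF s, of c] by simp
  moreover have "?w u $ Cs * c u = ?w u $ Cx * ?w u $ Cy ^ (2 - \<beta> j) * ?w u $ Cs ^ (N - a j) * remainder (?w u) j" for u
  proof -
    have "?w u $ Cs ^ (N - a j) = ?w u $ Cs * ?w u $ Cs ^ (N - a j - 1)"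
      using a_less_N[of j] by (simp add: Suc_diff_Suc flip: power_Suc)
    then show ?thesis by (simp add: c_def mult_ac)
  qed
  ultimately have rem: "((\<lambda>u. ?w u $ Cx * ?w u $ Cy ^ (2 - \<beta> j) * ?w u $ Cs ^ (N - a j) * remainder (?w u) j)
      has_derivative (\<lambda>v. 0)) (at 0)" by simp
  have "((\<lambda>u. lift_vertex (?w u) j) has_derivative
      (\<lambda>v. (\<Sum>k\<in>UNIV. if k = j then A $ j $ j * v $ j else 0) + 0)) (at 0)"
    unfolding lift_vertex_def by (intro has_derivative_add has_derivative_sum summand rem)
  then show ?thesis by simp
qed

lemma local_derivative:
  "((\<lambda>u. coords Last (local_lift u)) has_derivative (\<lambda>v. diagonal_matrix multiplier *v v)) (at 0)"
  unfolding has_derivative_vec_iff diagonal_matrix_mult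
proof
  fix j
  note scales = cdiff_at_local_scale
  show "((\<lambda>u. coords Last (local_lift u) $ j) has_derivative (\<lambda>v. multiplier j * v $ j)) (at 0)"
  proof -
    consider "j = q" | "j = p" "proper" | "j = p" "\<not> proper" | "j = b" "proper" | "j \<noteq> p" "j \<noteq> q" "j \<notin> B"
      using in_B by blast
    then show ?thesis
    proof cases
      case 1
      have "((\<lambda>u. u $ q * scale_s Last (local_lift u)) has_derivative
          (\<lambda>v. v $ q * scale_s Last (local_lift 0))) (at 0)"
        by (rule has_derivative_mult_vanishing[OF has_derivative_coord _ scales(1)]) simp
      then show ?thesis
        using 1 p_neq_q diag_nonzero[of p]
        by (simp add: coords_Last slice_Last_simps scale_base multiplier_def diag_p_q)
    next
      case 2
      have "((\<lambda>u. u $ p * scale_x Last (local_lift u)) has_derivative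
          (\<lambda>v. v $ p * scale_x Last (local_lift 0))) (at 0)"
        by (rule has_derivative_mult_vanishing[OF has_derivative_coord _ scales(3)]) simp
      then show ?thesis
        using 2 by (simp add: coords_Last slice_Last_simps scale_base multiplier_def mult.commute)
    next
      case 3
      have "((\<lambda>u. u $ p * scale_y Last (local_lift u)) has_derivative
          (\<lambda>v. v $ p * scale_y Last (local_lift 0))) (at 0)"
        by (rule has_derivative_mult_vanishing[OF has_derivative_coord _ scales(2)]) simp
      then show ?thesis
        using 3 by (simp add: coords_Last slice_Last_simps scale_base multiplier_def mult.commute)
    next
      case 4
      have "((\<lambda>u. u $ b * scale_y Last (local_lift u)) has_derivative
          (\<lambda>v. v $ b * scale_y Last (local_lift 0))) (at 0)"
        by (rule has_derivative_mult_vanishing[OF has_derivative_coord _ scales(2)]) simp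
      then show ?thesis
        using 4 b_neq by (simp add: coords_Last slice_Last_simps scale_base multiplier_def mult.commute)
    next
      case 5
      define E where "E u = scale_x Last (local_lift u) * scale_y Last (local_lift u) *
          scale_s Last (local_lift u) ^ (N + a j)" for u
      have E0: "E 0 = A $ p $ p"
        using diag_nonzero by (simp add: E_def scale_base power2_eq_square)
      have "cdiff_at (\<lambda>u. 1 / E u) 0"
        using E0 diag_nonzero[of p] unfolding E_def
        by (intro cdiff_at_divide cdiff_at_const cdiff_at_mult cdiff_at_power scales) simp
      from has_derivative_mult_vanishing[OF lift_vertex_derivative[OF 5] _ this]
      have "((\<lambda>u. lift_vertex (slice_embed Last u) j * (1 / E u)) has_derivative
          (\<lambda>v. A $ j $ j * v $ j * (1 / E 0))) (at 0)"
        using 5 by (simp add: lift_vertex_base slice_Last_simps)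
      then show ?thesis
        using 5 by (simp add: coords_Last E0 multiplier_def) (simp add: E_def)
    qed
  qed
qed

lemma local_lift_0: "coords Last (local_lift 0) = 0"
  unfolding cart_eq_iff
proof
  fix j
  consider "j = q" | "j = p" "proper" | "j = p" "\<not> proper" | "j = b" "proper" | "j \<noteq> p" "j \<noteq> q" "j \<notin> B"
    using in_B by blast
  then show "coords Last (local_lift 0) $ j = 0 $ j"
    by cases (simp_all add: coords_Last slice_Last_simps lift_vertex_base)
qed

text \<open>
  The distinguished point is the origin of the chart \<open>Last\<close>, where the lift is \<open>coords Last \<circ> local_lift\<close>.
\<close>

theorem differential_at_base_point:
  "differential_at_fixed_point quotient_space induced (orbit base_point) (diagonal_matrix multiplier)"
  unfolding differential_at_fixed_point_def
proof (intro conjI bexI[of _ "(dom Last, chart Last)"])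
  have "orbit (lift base_point) = orbit (slice_embed Last (coords Last (lift base_point)))"
    using slice[OF index_simps(2) lift_base_domain] by (simp add: base_point_def)
  then show "induced (orbit base_point) = orbit base_point"
    unfolding induced_orbit using local_lift_0 by (simp add: base_point_def)
  show "(dom Last, chart Last) \<in> atlas quotient_space"
    using index_simps(2) by (simp add: quotient_space_def)
  have sl: "slice_embed Last u \<in> domain Last" for u by (rule slice_embed_in_domain) simp
  have e: "orbit base_point \<in> dom Last" using base_point_domain by (simp add: dom_def)
  have c0: "chart Last (orbit base_point) = 0"
    unfolding base_point_def by (rule chart_\<iota>[OF index_simps(2) sl])
  define S where "S = {u. blow_down (slice_embed Last u) \<in> polydisc \<rho> \<and> local_lift u \<in> domain Last}"
  have "open ({h. blow_down h \<in> polydisc \<rho>} \<inter> lift -` domain Last)"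
    by (rule continuous_open_preimage[OF continuous_lift open_blow_down_polydisc open_domain])
  from open_vimage[OF this continuous_\<iota>[OF index_simps(2)]]
  have oS: "open S" unfolding S_def by (simp add: vimage_def Int_def)
  have S0: "0 \<in> S" using base_in_polydisc lift_base_domain by (simp add: S_def)
  have eq: "coords Last (local_lift u) = (chart Last \<circ> induced \<circ> inv_into (dom Last) (chart Last)) u"
    if "u \<in> S" for u
  proof -
    have "local_lift u \<in> domain Last" using that by (simp add: S_def)
    then show ?thesis
      by (simp add: inv_chart[OF index_simps(2) sl] induced_orbit chart_class[OF index_simps(2)])
  qed
  have "((chart Last \<circ> induced \<circ> inv_into (dom Last) (chart Last)) has_derivative
      (\<lambda>v. diagonal_matrix multiplier *v v)) (at 0)"
    by (rule has_derivative_transform_within_open[OF local_derivative oS S0 eq])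
  then show "case (dom Last, chart Last) of (U, \<phi>) \<Rightarrow> orbit base_point \<in> U \<and>
      (\<phi> \<circ> induced \<circ> inv_into U \<phi> has_derivative (*v) (diagonal_matrix multiplier)) (at (\<phi> (orbit base_point)))"
    using e c0 by simp
qed

end

section \<open>Jordan normal form and the adapted frame\<close>

context cox_germ
begin

theorem diagonalization_quotient:
  assumes "diagonalizable (diagonal_matrix multiplier)"
  shows "diagonalization F quotient_space projection (orbit base_point) induced (diagonal_matrix multiplier)"
  unfolding diagonalization_def
proof (intro conjI)
  have "base_point \<in> Tot" using regularI[OF index_simps(2) base_point_domain] by (simp add: Tot_iff)
  then show "orbit base_point \<in> fibre_over_0 quotient_space projection"
    unfolding fibre_eq using blow_down_base_point by blast
qed (rule complex_manifold_quotient, rule projection_over_0_quotient, rule germ_lift_induced,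
     rule differential_at_base_point, rule assms)

end

definition enum :: "nat \<Rightarrow> 'n :: finite" where "enum = from_nat_into UNIV"

text \<open>
  The position of an index in the enumeration on which \<open>jnf_mat\<close> is based.
\<close>

definition idx :: "'n :: finite \<Rightarrow> nat" where "idx = inv_into {..<CARD('n)} enum"

lemma bij_enum: "bij_betw (enum :: nat \<Rightarrow> 'n :: finite) {..<CARD('n)} UNIV"
  unfolding enum_def by (rule bij_betw_from_nat_into_finite) simp

lemma idx_less: "idx (j :: 'n :: finite) < CARD('n)"
  and enum_idx [simp]: "enum (idx j) = j"
proof -
  have j: "j \<in> enum ` {..<CARD('n)}" using bij_enum[where 'n = 'n] by (simp add: bij_betw_def)
  show "idx j < CARD('n)" using inv_into_into[OF j] by (simp add: idx_def)
  show "enum (idx j) = j" unfolding idx_def by (rule f_inv_into_f[OF j])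
qed

lemma idx_enum [simp]: "i < CARD('n) \<Longrightarrow> idx (enum i :: 'n :: finite) = i"
  unfolding idx_def using bij_enum[where 'n = 'n] by (intro inv_into_f_f) (auto simp: bij_betw_def)

lemma idx_eq_iff [simp]: "idx i = idx j \<longleftrightarrow> i = j"
  by (metis enum_idx)

text \<open>
  The inverse of \<open>jnf_mat\<close>; both are ring homomorphisms, so similarity can be moved between the two
  representations of matrices.
\<close>

definition of_jnf :: "complex Matrix.mat \<Rightarrow> complex ^ 'n ^ 'n" where
  "of_jnf M = (\<chi> j k. M $$ (idx j, idx k))"

lemma jnf_mat_index: "i < CARD('n) \<Longrightarrow> j < CARD('n) \<Longrightarrow>
    jnf_mat (A :: complex ^ 'n ^ 'n) $$ (i, j) = A $ enum i $ enum j"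
  by (simp add: jnf_mat_def enum_def)

lemma jnf_mat_carrier: "jnf_mat (A :: complex ^ 'n ^ 'n) \<in> carrier_mat CARD('n) CARD('n)"
  by (simp add: jnf_mat_def)

lemma of_jnf_jnf_mat: "of_jnf (jnf_mat A) = (A :: complex ^ 'n ^ 'n)"
  by (simp add: of_jnf_def cart_eq_iff jnf_mat_index idx_less)

lemma of_jnf_mult:
  assumes "M \<in> carrier_mat CARD('n) CARD('n)" "M' \<in> carrier_mat CARD('n) CARD('n)"
  shows "(of_jnf (M * M') :: complex ^ 'n ^ 'n) = of_jnf M ** of_jnf M'"
proof -
  have "(M * M') $$ (idx j, idx k) = (\<Sum>l\<in>(UNIV :: 'n set). M $$ (idx j, idx l) * M' $$ (idx l, idx k))"
    for j k :: 'n
  proof -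
    have "(M * M') $$ (idx j, idx k) = (\<Sum>i\<in>{..<CARD('n)}. M $$ (idx j, i) * M' $$ (i, idx k))"
      using assms idx_less[of j] idx_less[of k]
      by (simp add: scalar_prod_def lessThan_atLeast0)
    also have "\<dots> = (\<Sum>l\<in>(UNIV :: 'n set). M $$ (idx j, idx l) * M' $$ (idx l, idx k))"
      by (subst sum.reindex_bij_betw[OF bij_enum, symmetric]) simp
    finally show ?thesis .
  qed
  then show ?thesis
    by (simp add: of_jnf_def matrix_matrix_mult_def cart_eq_iff)
qed

lemma of_jnf_one: "(of_jnf (1\<^sub>m CARD('n)) :: complex ^ 'n ^ 'n) = identity_matrix"
  by (simp add: of_jnf_def Finite_Cartesian_Product.mat_def cart_eq_iff idx_less)

lemma jnf_mat_mult: "jnf_mat (A ** A') = jnf_mat A * jnf_mat (A' :: complex ^ 'n ^ 'n)"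
proof (rule eq_matI)
  fix i j assume "i < dim_row (jnf_mat A * jnf_mat A')" "j < dim_col (jnf_mat A * jnf_mat A')"
  then have ij: "i < CARD('n)" "j < CARD('n)" by (simp_all add: jnf_mat_def)
  have "(A ** A') $ enum i $ enum j = (\<Sum>k\<in>UNIV. A $ enum i $ k * A' $ k $ enum j)"
    by (simp add: matrix_matrix_mult_def)
  also have "\<dots> = (\<Sum>k\<in>{..<CARD('n)}. A $ enum i $ enum k * A' $ enum k $ enum j)"
    by (subst sum.reindex_bij_betw[OF bij_enum, symmetric]) simp
  also have "\<dots> = (jnf_mat A * jnf_mat A') $$ (i, j)"
    using ij by (simp add: scalar_prod_def lessThan_atLeast0 jnf_mat_def enum_def)
  finally show "jnf_mat (A ** A') $$ (i, j) = (jnf_mat A * jnf_mat A') $$ (i, j)"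
    using ij by (simp add: jnf_mat_index)
qed (simp_all add: jnf_mat_def)

lemma jnf_mat_one: "jnf_mat (identity_matrix :: complex ^ 'n ^ 'n) = 1\<^sub>m CARD('n)"
proof (rule eq_matI)
  fix i j assume "i < dim_row (1\<^sub>m CARD('n) :: complex Matrix.mat)" "j < dim_col (1\<^sub>m CARD('n) :: complex Matrix.mat)"
  then have ij: "i < CARD('n)" "j < CARD('n)" by simp_all
  then have "(enum i :: 'n) = enum j \<longleftrightarrow> i = j" by (metis idx_enum)
  then show "jnf_mat (identity_matrix :: complex ^ 'n ^ 'n) $$ (i, j) = 1\<^sub>m CARD('n) $$ (i, j)"
    using ij by (simp add: jnf_mat_index Finite_Cartesian_Product.mat_def)
qed (simp_all add: jnf_mat_def)

lemma det_jnf_mat_nonzero: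
  assumes "invertible (A :: complex ^ 'n ^ 'n)" shows "Determinant.det (jnf_mat A) \<noteq> 0"
proof -
  obtain A' where A': "A ** A' = identity_matrix" using assms unfolding invertible_def by blast
  have "Determinant.det (jnf_mat A * jnf_mat A') = Determinant.det (jnf_mat A) * Determinant.det (jnf_mat A')"
    by (rule det_mult[OF jnf_mat_carrier jnf_mat_carrier])
  moreover have "jnf_mat A * jnf_mat A' = 1\<^sub>m CARD('n)"
    using jnf_mat_mult[of A A'] A' jnf_mat_one by metis
  ultimately show ?thesis by auto
qed

lemma proots_linear_factors: "proots (\<Prod>x\<leftarrow>xs. [:- x, 1:]) = mset (xs :: complex list)"
proof (induction xs)
  case (Cons x xs)
  have nz: "(\<Prod>x\<leftarrow>xs. [:- x, 1:]) \<noteq> 0" by (auto simp: prod_list_zero_iff)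
  have 1: "proots [:- x, 1:] = {#x#}"
    by (rule multiset_eqI) (simp add: order_linear')
  have "proots ([:- x, 1:] * (\<Prod>x\<leftarrow>xs. [:- x, 1:])) =
      proots [:- x, 1:] + proots (\<Prod>x\<leftarrow>xs. [:- x, 1:])"
    by (rule proots_mult) (use nz in auto)
  also have "\<dots> = {#x#} + mset xs" unfolding 1 Cons.IH ..
  also have "\<dots> = mset (x # xs)" by simp
  finally show ?case by (simp only: list.map prod_list.Cons)
qed simp

lemma mset_diag_mat:
  assumes "M \<in> carrier_mat n n" shows "mset (diag_mat M) = image_mset (\<lambda>i. M $$ (i, i)) (mset_set {..<n})"
  using assms by (simp add: diag_mat_def lessThan_atLeast0 flip: mset_upt)

lemma diagonal_matrix_jnf:
  "i < CARD('n) \<Longrightarrow> j < CARD('n) \<Longrightarrow>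
    jnf_mat (diagonal_matrix d :: complex ^ 'n ^ 'n) $$ (i, j) = (if i = j then d (enum i) else 0)"
  using idx_enum[where 'n = 'n] by (auto simp: jnf_mat_index diagonal_matrix_def) (metis idx_enum)

lemma diagonalizable_diagonal_matrix: "diagonalizable (diagonal_matrix d :: complex ^ 'n ^ 'n)"
  unfolding diagonalizable_def
proof (intro exI conjI)
  show "similar_mat (jnf_mat (diagonal_matrix d :: complex ^ 'n ^ 'n)) (jnf_mat (diagonal_matrix d :: complex ^ 'n ^ 'n))"
    by (rule similar_mat_refl[OF jnf_mat_carrier])
  show "diagonal_mat (jnf_mat (diagonal_matrix d :: complex ^ 'n ^ 'n))"
    unfolding diagonal_mat_def using jnf_mat_carrier[of "diagonal_matrix d :: complex ^ 'n ^ 'n"]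
    by (auto simp: diagonal_matrix_jnf)
qed

lemma eigenvalue_mset_diagonal_matrix:
  "eigenvalue_mset (diagonal_matrix d :: complex ^ 'n ^ 'n) = image_mset (\<lambda>i. d (enum i)) (mset_set {..<CARD('n)})"
proof -
  let ?M = "jnf_mat (diagonal_matrix d :: complex ^ 'n ^ 'n)"
  have c: "?M \<in> carrier_mat CARD('n) CARD('n)" by (rule jnf_mat_carrier)
  have "upper_triangular ?M" using c by (auto simp: diagonal_matrix_jnf)
  then have "char_poly ?M = (\<Prod>x\<leftarrow>diag_mat ?M. [:- x, 1:])" by (rule char_poly_upper_triangular[OF c])
  then have "eigenvalue_mset (diagonal_matrix d :: complex ^ 'n ^ 'n) = mset (diag_mat ?M)"
    unfolding eigenvalue_mset_def by (simp only: proots_linear_factors)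
  also have "\<dots> = image_mset (\<lambda>i. ?M $$ (i, i)) (mset_set {..<CARD('n)})" by (rule mset_diag_mat[OF c])
  also have "\<dots> = image_mset (\<lambda>i. d (enum i)) (mset_set {..<CARD('n)})"
    by (rule image_mset_cong) (simp add: diagonal_matrix_jnf)
  finally show ?thesis .
qed

lemma jordan_matrix_Cons_index:
  assumes "i < n + sum_list (map fst xs)" "j < n + sum_list (map fst xs)"
  shows "jordan_matrix ((n, c) # xs) $$ (i, j) =
    (if i < n then if j < n then if i = j then c else if Suc i = j then 1 else 0 else 0
     else if j < n then 0 else jordan_matrix xs $$ (i - n, j - n))"
  unfolding jordan_matrix_Cons using assms by auto

text \<open>
  Off the diagonal, a Jordan matrix has entries only within a block and just above the diagonal.
\<close>

lemma jordan_matrix_off_diagonal: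
  fixes xs :: "(nat \<times> complex) list"
  assumes "i < sum_list (map fst xs)" "j < sum_list (map fst xs)" "i \<noteq> j" "jordan_matrix xs $$ (i, j) \<noteq> 0"
  shows "j = Suc i \<and> jordan_matrix xs $$ (i, i) = jordan_matrix xs $$ (j, j)"
  using assms
proof (induction xs arbitrary: i j)
  case (Cons x xs)
  obtain n c where x: "x = (n, c)" by (cases x)
  have ij: "i < n + sum_list (map fst xs)" "j < n + sum_list (map fst xs)" using Cons.prems x by simp_all
  have nz: "jordan_matrix ((n, c) # xs) $$ (i, j) \<noteq> 0" using Cons.prems x by simp
  show ?case
  proof (cases "i < n")
    case True
    then have "j < n \<and> j = Suc i"
      using nz Cons.prems(3) unfolding jordan_matrix_Cons_index[OF ij] by (simp split: if_splits)
    then show ?thesis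
      using True unfolding x jordan_matrix_Cons_index[OF ij(1,1)] jordan_matrix_Cons_index[OF ij(2,2)] by simp
  next
    case False
    then have jn: "\<not> j < n" and nz': "jordan_matrix xs $$ (i - n, j - n) \<noteq> 0"
      using nz unfolding jordan_matrix_Cons_index[OF ij] by (simp_all split: if_splits)
    have "j - n = Suc (i - n) \<and> jordan_matrix xs $$ (i - n, i - n) = jordan_matrix xs $$ (j - n, j - n)"
      by (rule Cons.IH[OF _ _ _ nz']) (use ij False jn Cons.prems(3) in auto)
    then show ?thesis
      using False jn unfolding x jordan_matrix_Cons_index[OF ij(1,1)] jordan_matrix_Cons_index[OF ij(2,2)] by auto
  qed
qed simp

text \<open>
  Both sides are the multiset of roots of the characteristic polynomial, computed from the diagonal
  and from the blocks.
\<close>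

lemma mset_diag_jordan_matrix:
  fixes xs :: "(nat \<times> complex) list"
  shows "image_mset (\<lambda>i. jordan_matrix xs $$ (i, i)) (mset_set {..<sum_list (map fst xs)}) =
    (\<Sum>(n, c)\<leftarrow>xs. replicate_mset n c)"
proof -
  have c: "jordan_matrix xs \<in> carrier_mat (sum_list (map fst xs)) (sum_list (map fst xs))" by simp
  have ut: "upper_triangular (jordan_matrix xs)" using jordan_matrix_upper_triangular[of _ xs] by auto
  have "mset (diag_mat (jordan_matrix xs)) = proots (char_poly (jordan_matrix xs))"
    unfolding char_poly_upper_triangular[OF c ut] by (rule proots_linear_factors[symmetric])
  also have "\<dots> = (\<Sum>(n, c)\<leftarrow>xs. replicate_mset n c)"
    unfolding jordan_matrix_char_poly
  proof (induction xs)
    case (Cons x xs)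
    obtain n c where x: "x = (n, c)" by (cases x)
    have nz: "(\<Prod>(n, a)\<leftarrow>xs. [:- a, 1:] ^ n) \<noteq> 0" by (auto simp: prod_list_zero_iff)
    have "proots ([:- c, 1:] ^ n) = replicate_mset n c"
      by (rule multiset_eqI) (simp add: proots_power order_linear')
    moreover have "proots ([:- c, 1:] ^ n * (\<Prod>(n, a)\<leftarrow>xs. [:- a, 1:] ^ n)) =
        proots ([:- c, 1:] ^ n) + proots (\<Prod>(n, a)\<leftarrow>xs. [:- a, 1:] ^ n)"
      by (rule proots_mult) (use nz in auto)
    ultimately show ?case using Cons by (simp only: x list.map prod_list.Cons sum_list.Cons prod.case)
  qed simp
  finally show ?thesis using mset_diag_mat[OF c] by simp
qed

text \<open>
  Hadamard's lemma provides the expansions required by the locale \<open>cox_germ\<close>; the radius is the smallest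
  one of those for the finitely many components.
\<close>

lemma diagonalization_in_triangular_frame:
  fixes F :: "complex ^ 'n \<Rightarrow> complex ^ 'n" and dF L L' :: "complex ^ 'n ^ 'n"
  assumes F: "holomorphic_germ_fixing_0 F" and dF: "(F has_derivative (\<lambda>v. dF *v v)) (at 0)"
    and L: "L ** L' = identity_matrix" "L' ** L = identity_matrix"
    and A: "A = L' ** dF ** L"
    and data: "cox_data a p q b B N"
    and triangular: "\<And>j k. A $ j $ k \<noteq> 0 \<Longrightarrow> j \<noteq> k \<Longrightarrow> a j < a k"
    and diag_nonzero: "\<And>j. A $ j $ j \<noteq> 0"
    and diag_p_q: "A $ q $ q = A $ p $ p"
    and invariant_hyperplane: "\<And>j k. j \<in> B \<Longrightarrow> k \<noteq> j \<Longrightarrow> A $ j $ k = 0"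
  shows "\<exists>(M :: ('n manifold_point, 'n) charted_space) \<pi> e G. diagonalization F M \<pi> e G
    (diagonal_matrix (\<lambda>j. if j = p then if B \<noteq> {} then (A $ p $ p)\<^sup>2 / A $ b $ b else A $ p $ p
                          else A $ j $ j / A $ p $ p))"
proof -
  obtain D where D: "open D" "0 \<in> D" "holomorphic_vec F D" and F0: "F 0 = 0"
    using F unfolding holomorphic_germ_fixing_0_def by blast
  define f where "f j z = (L' *v F (L *v z)) $ j" for j z
  define D' where "D' = {z. L *v z \<in> D}"
  have "continuous_on UNIV (\<lambda>z. L *v z)"
    by (rule cdiff_at_imp_continuous_on_vec) (rule cdiff_at_matrix_vector_mult, rule cdiff_at_coord)
  from open_vimage[OF D(1) this] have D'_open: "open D'" by (simp add: D'_def vimage_def)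
  have D'_0: "0 \<in> D'" using D(2) by (simp add: D'_def)
  have f_cdiff: "cdiff_at (f j) z" if "z \<in> D'" for j z
    unfolding f_def
  proof (rule cdiff_at_matrix_vector_mult)
    fix k
    have "cdiff_at (\<lambda>w. F w $ k) (L *v z)" using D(3) that unfolding holomorphic_vec_iff D'_def by blast
    then show "cdiff_at (\<lambda>z. F (L *v z) $ k) z"
      by (rule cdiff_at_compose) (rule cdiff_at_matrix_vector_mult, rule cdiff_at_coord)
  qed
  have f_0: "f j 0 = 0" for j by (simp add: f_def F0)
  have f_deriv: "(f j has_derivative (\<lambda>h. \<Sum>k\<in>UNIV. A $ j $ k * h $ k)) (at 0)" for j
  proof -
    have lin: "bounded_linear (\<lambda>z. M *v z)" for M :: "complex ^ 'n ^ 'n"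
      by (rule matrix_vector_mul_bounded_linear)
    have "((\<lambda>z. L *v z) has_derivative (\<lambda>z. L *v z)) (at 0)"
      by (rule bounded_linear_imp_has_derivative[OF lin])
    from has_derivative_compose[OF this, of F "\<lambda>v. dF *v v"] dF
    have "((\<lambda>z. F (L *v z)) has_derivative (\<lambda>v. dF *v (L *v v))) (at 0)"
      by (simp only: matrix_vector_mult_0_right)
    from bounded_linear.has_derivative[OF lin[of L'] this]
    have "((\<lambda>z. L' *v F (L *v z)) has_derivative (\<lambda>v. A *v v)) (at 0)"
      by (simp only: A matrix_vector_mul_assoc matrix_mul_assoc)
    then have "((\<lambda>z. (L' *v F (L *v z)) $ j) has_derivative (\<lambda>v. (A *v v) $ j)) (at 0)"
      unfolding has_derivative_vec_iff by (rule spec)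
    then show ?thesis
      unfolding f_def by (simp only: matrix_vector_mult_def[of A] vec_lambda_beta)
  qed
  have "\<exists>r q. r > 0 \<and> (\<forall>i k. \<forall>z\<in>polydisc r. cdiff_at (q i k) z) \<and>
    (\<forall>z\<in>polydisc r. f j z = (\<Sum>k\<in>UNIV. A $ j $ k * z $ k) +
       (\<Sum>k\<in>UNIV. \<Sum>i\<in>UNIV. z $ k * z $ i * q k i z))" for j
    by (rule hadamard_second_order[OF D'_open D'_0 _ f_0 f_deriv]) (rule f_cdiff)
  then have "\<forall>j. \<exists>r. \<exists>q. r > 0 \<and> (\<forall>i k. \<forall>z\<in>polydisc r. cdiff_at (q i k) z) \<and>
    (\<forall>z\<in>polydisc r. f j z = (\<Sum>k\<in>UNIV. A $ j $ k * z $ k) +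
       (\<Sum>k\<in>UNIV. \<Sum>i\<in>UNIV. z $ k * z $ i * q k i z))" by (rule allI)
  from choice[OF this] obtain r where "\<forall>j. \<exists>q. r j > 0 \<and> (\<forall>i k. \<forall>z\<in>polydisc (r j). cdiff_at (q i k) z) \<and>
    (\<forall>z\<in>polydisc (r j). f j z = (\<Sum>k\<in>UNIV. A $ j $ k * z $ k) +
       (\<Sum>k\<in>UNIV. \<Sum>i\<in>UNIV. z $ k * z $ i * q k i z))" ..
  from choice[OF this] obtain Q where rQ: "\<forall>j. r j > 0 \<and> (\<forall>i k. \<forall>z\<in>polydisc (r j). cdiff_at (Q j i k) z) \<and>
    (\<forall>z\<in>polydisc (r j). f j z = (\<Sum>k\<in>UNIV. A $ j $ k * z $ k) +
       (\<Sum>k\<in>UNIV. \<Sum>i\<in>UNIV. z $ k * z $ i * Q j k i z))" ..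
  have r: "r j > 0" for j by (rule conjunct1[OF spec[OF rQ]])
  have Q: "cdiff_at (Q j i k) z" if "z \<in> polydisc (r j)" for j i k z
    by (rule bspec[OF spec[OF spec[OF conjunct1[OF conjunct2[OF spec[OF rQ]]]]] that])
  have fQ: "f j z = (\<Sum>k\<in>UNIV. A $ j $ k * z $ k) +
       (\<Sum>k\<in>UNIV. \<Sum>i\<in>UNIV. z $ k * z $ i * Q j k i z)" if "z \<in> polydisc (r j)" for j z
    by (rule bspec[OF conjunct2[OF conjunct2[OF spec[OF rQ]]] that])
  define \<rho> where "\<rho> = Min (range r)"
  have \<rho>: "\<rho> > 0" using r by (simp add: \<rho>_def)
  have sub: "z \<in> polydisc (r j)" if "z \<in> polydisc \<rho>" for z j
  proof -
    have "\<rho> \<le> r j" by (simp add: \<rho>_def)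
    then show ?thesis using that polydisc_mono by blast
  qed
  interpret cox_data a p q b B N by (rule data)
  interpret cox_germ a p q b B N L L' A F Q \<rho>
  proof unfold_locales
    show "L ** L' = identity_matrix" "L' ** L = identity_matrix"
      by (rule L)+
    show "a j < a k" if "A $ j $ k \<noteq> 0" "j \<noteq> k" for j k by (rule triangular[OF that])
    show "A $ j $ j \<noteq> 0" for j by (rule diag_nonzero)
    show "A $ q $ q = A $ p $ p" by (rule diag_p_q)
    show "A $ j $ k = 0" if "j \<in> B" "k \<noteq> j" for j k by (rule invariant_hyperplane[OF that])
    show "\<rho> > 0" by (rule \<rho>)
    show "cdiff_at (Q j k i) z" if "z \<in> polydisc \<rho>" for z j k i by (rule Q[OF sub[OF that]])
    show "(L' *v F (L *v z)) $ j = (\<Sum>k\<in>UNIV. A $ j $ k * z $ k) +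
        (\<Sum>k\<in>UNIV. \<Sum>i\<in>UNIV. z $ k * z $ i * Q j k i z)" if "z \<in> polydisc \<rho>" for z j
      using fQ[OF sub[OF that], of j] unfolding f_def .
  qed
  have "multiplier = (\<lambda>j. if j = p then if B \<noteq> {} then (A $ p $ p)\<^sup>2 / A $ b $ b else A $ p $ p
                          else A $ j $ j / A $ p $ p)"
    by (rule ext) (simp add: multiplier_def proper_def)
  with diagonalization_quotient[OF diagonalizable_diagonal_matrix]
  have "diagonalization F quotient_space projection (orbit base_point) induced
      (diagonal_matrix (\<lambda>j. if j = p then if B \<noteq> {} then (A $ p $ p)\<^sup>2 / A $ b $ b else A $ p $ p
                          else A $ j $ j / A $ p $ p))" by (simp only:)
  then show ?thesis by (intro exI)
qed

text \<open>
  The construction in terms of positions in the Jordan matrix. The position \<open>s\<close> starts a Jordan block of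
  length at least two; if the hyperplane is blown up (\<open>hyp\<close>), then \<open>m\<close> ends another block.
\<close>

lemma diagonalization_of_jordan_form:
  fixes F :: "complex ^ 'n \<Rightarrow> complex ^ 'n" and dF :: "complex ^ 'n ^ 'n"
  assumes F: "holomorphic_germ_fixing_0 F" and dF: "(F has_derivative (\<lambda>v. dF *v v)) (at 0)"
    and inv: "invertible dF" and sim: "similar_mat (jnf_mat dF) J" and J: "J = jordan_matrix xs"
    and s: "Suc s < CARD('n)" "J $$ (s, Suc s) \<noteq> 0" "\<And>i. Suc i = s \<Longrightarrow> J $$ (i, s) = 0"
    and m: "hyp \<Longrightarrow> m < CARD('n) \<and> m \<noteq> s \<and> m \<noteq> Suc s \<and> (\<forall>k<CARD('n). k \<noteq> m \<longrightarrow> J $$ (m, k) = 0)"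
  shows "\<exists>(M :: ('n manifold_point, 'n) charted_space) \<pi> e G. diagonalization F M \<pi> e G
    (diagonal_matrix (\<lambda>j. if idx j = s then if hyp then (J $$ (s, s))\<^sup>2 / J $$ (m, m) else J $$ (s, s)
                          else J $$ (idx j, idx j) / J $$ (s, s)))"
proof -
  let ?n = "CARD('n)"
  obtain P P' where "similar_mat_wit (jnf_mat dF) J P P'" using sim unfolding similar_mat_def by blast
  then have c: "J \<in> carrier_mat ?n ?n" "P \<in> carrier_mat ?n ?n" "P' \<in> carrier_mat ?n ?n"
    and PP: "P * P' = 1\<^sub>m ?n" "P' * P = 1\<^sub>m ?n" and dJ: "jnf_mat dF = P * J * P'"
    using jnf_mat_carrier[of dF] unfolding similar_mat_wit_def by (auto simp: Let_def)
  define L L' A :: "complex ^ 'n ^ 'n" where "L = of_jnf P" and "L' = of_jnf P'" and "A = of_jnf J"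
  have L: "L ** L' = identity_matrix" "L' ** L = identity_matrix"
    unfolding L_def L'_def of_jnf_mult[OF c(2,3), symmetric] of_jnf_mult[OF c(3,2), symmetric] PP
    by (rule of_jnf_one)+
  have dF_eq: "dF = L ** A ** L'"
    unfolding L_def L'_def A_def of_jnf_mult[OF c(2,1), symmetric]
      of_jnf_mult[OF mult_carrier_mat[OF c(2,1)] c(3), symmetric] dJ[symmetric] of_jnf_jnf_mat ..
  have "L' ** dF ** L = (L' ** L) ** A ** (L' ** L)"
    unfolding dF_eq by (simp only: matrix_mul_assoc)
  then have A: "A = L' ** dF ** L" by (simp add: L(2))
  have n: "sum_list (map fst xs) = ?n" using c(1) J by auto
  have Aij: "A $ j $ k = J $$ (idx j, idx k)" for j k by (simp add: A_def of_jnf_def)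
  have off: "idx k = Suc (idx j) \<and> J $$ (idx j, idx j) = J $$ (idx k, idx k)" if "A $ j $ k \<noteq> 0" "j \<noteq> k" for j k
    using jordan_matrix_off_diagonal[of "idx j" xs "idx k"] that idx_less[of j] idx_less[of k]
    unfolding Aij J n by simp
  have ut: "upper_triangular J" using jordan_matrix_upper_triangular[of _ xs] J by auto
  have "prod_list (diag_mat J) \<noteq> 0"
    using det_jnf_mat_nonzero[OF inv] unfolding det_similar[OF sim] det_upper_triangular[OF ut c(1)] .
  then have Jii: "J $$ (i, i) \<noteq> 0" if "i < ?n" for i
    using that c(1) unfolding prod_list_zero_iff diag_mat_def by force
  define p q b :: 'n where "p = enum s" and "q = enum (Suc s)" and "b = enum m"
  have ip: "idx p = s" "idx q = Suc s" using s(1) by (simp_all add: p_def q_def)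
  have ib: "idx b = m" if hyp using m[OF that] by (simp add: b_def)
  \<comment> \<open>Positions increase along Jordan chains; the offset leaves the weights \<open>0\<close> and \<open>1\<close> to \<open>p\<close> and \<open>q\<close>,
    which may sit in the middle of the enumeration.\<close>
  define a where "a j = (if j = p then 0 else if j = q then 1 else idx j + 2)" for j
  define B where "B = (if hyp then {b} else {})"
  have pq: "p \<noteq> q" using ip by auto
  have bpq: "b \<noteq> p \<and> b \<noteq> q" if hyp using ib[OF that] m[OF that] ip by auto
  have "cox_data a p q b B (?n + 2)"
  proof
    show "a j < ?n + 2" for j using idx_less[of j] by (simp add: a_def)
  qed (use pq bpq in \<open>auto simp: a_def B_def\<close>)
  moreover have "a j < a k" if jk: "A $ j $ k \<noteq> 0" "j \<noteq> k" for j k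
  proof -
    have k: "idx k = Suc (idx j)" using off[OF jk] by blast
    have kp: "k \<noteq> p"
    proof
      assume "k = p"
      then have "J $$ (idx j, s) = 0" using s(3)[of "idx j"] k ip by simp
      then show False using jk(1) ip \<open>k = p\<close> unfolding Aij by simp
    qed
    show ?thesis
    proof (cases "k = q")
      case True
      then have "idx j = idx p" using k ip by simp
      then have "j = p" by simp
      then show ?thesis using True pq by (simp add: a_def)
    next
      case False
      then show ?thesis using kp k by (simp add: a_def)
    qed
  qed
  moreover have "A $ j $ j \<noteq> 0" for j unfolding Aij by (rule Jii[OF idx_less])
  moreover have "A $ q $ q = A $ p $ p"
    using off[of p q] s(2) pq unfolding Aij ip by simp
  moreover have "A $ j $ k = 0" if "j \<in> B" "k \<noteq> j" for j k
  proof -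
    have h: hyp and jb: "j = b" using that(1) by (auto simp: B_def split: if_splits)
    have "idx k \<noteq> m" using that(2) ib[OF h] jb by (metis idx_eq_iff)
    then show ?thesis using m[OF h] idx_less[of k] ib[OF h] unfolding Aij jb by simp
  qed
  ultimately have "\<exists>(M :: ('n manifold_point, 'n) charted_space) \<pi> e G. diagonalization F M \<pi> e G
    (diagonal_matrix (\<lambda>j. if j = p then if B \<noteq> {} then (A $ p $ p)\<^sup>2 / A $ b $ b else A $ p $ p
                          else A $ j $ j / A $ p $ p))"
    by (rule diagonalization_in_triangular_frame[OF F dF L A])
  moreover have "(\<lambda>j. if j = p then if B \<noteq> {} then (A $ p $ p)\<^sup>2 / A $ b $ b else A $ p $ p
                          else A $ j $ j / A $ p $ p) =
      (\<lambda>j. if idx j = s then if hyp then (J $$ (s, s))\<^sup>2 / J $$ (m, m) else J $$ (s, s)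
                          else J $$ (idx j, idx j) / J $$ (s, s))"
  proof (rule ext)
    fix j
    have "j = p \<longleftrightarrow> idx j = s" using ip by (metis idx_eq_iff)
    then show "(if j = p then if B \<noteq> {} then (A $ p $ p)\<^sup>2 / A $ b $ b else A $ p $ p else A $ j $ j / A $ p $ p) =
      (if idx j = s then if hyp then (J $$ (s, s))\<^sup>2 / J $$ (m, m) else J $$ (s, s)
                          else J $$ (idx j, idx j) / J $$ (s, s))"
      using ib by (cases hyp) (simp_all add: Aij ip B_def)
  qed
  ultimately show ?thesis by simp
qed

section \<open>The diagonalization theorem\<close>

lemma diagonalizable_if_diagonal_jordan_form:
  assumes sim: "similar_mat (jnf_mat (A :: complex ^ 'n ^ 'n)) (jordan_matrix xs)"
    and n: "sum_list (map fst xs) = CARD('n)"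
    and z: "\<And>i. Suc i < CARD('n) \<Longrightarrow> jordan_matrix xs $$ (i, Suc i) = 0"
  shows "diagonalizable A"
  unfolding diagonalizable_def
proof (intro exI conjI)
  show "diagonal_mat (jordan_matrix xs)"
    unfolding diagonal_mat_def
  proof (intro allI impI)
    fix i j assume "i < dim_row (jordan_matrix xs)" "j < dim_col (jordan_matrix xs)" "i \<noteq> j"
    then show "jordan_matrix xs $$ (i, j) = 0"
      using jordan_matrix_off_diagonal[of i xs j] z[of i] n by auto
  qed
qed (rule sim)

lemma image_mset_sum: "image_mset g (\<Sum>i\<in>I. M i) = (\<Sum>i\<in>I. image_mset g (M i))"
  by (induction I rule: infinite_finite_induct) simp_all

theorem theorem0p1:
  fixes F :: "complex ^ 'n \<Rightarrow> complex ^ 'n" and dF :: "complex ^ 'n ^ 'n"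
  assumes "holomorphic_germ_fixing_0 F"
    and "(F has_derivative (\<lambda>v. dF *v v)) (at 0)"
    and "invertible dF"
    and "\<not> diagonalizable dF"
  shows "(\<exists>(M :: ('n manifold_point, 'n) charted_space) \<pi> e G dG. diagonalization F M \<pi> e G dG) \<and>
    (\<forall>(\<rho> :: nat) (\<mu> :: nat \<Rightarrow> nat) (ev :: nat \<Rightarrow> complex).
       \<rho> \<ge> 1 \<and> (\<forall>i\<in>{1..<\<rho>}. \<mu> i \<ge> \<mu> (i + 1)) \<and> \<mu> \<rho> \<ge> 1 \<and>
       jordan_nf (jnf_mat dF) (map (\<lambda>i. (\<mu> i, ev i)) [1..<\<rho> + 1]) \<longrightarrow>
       (\<exists>(M :: ('n manifold_point, 'n) charted_space) \<pi> e G dG.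
          diagonalization F M \<pi> e G dG \<and>
          eigenvalue_mset dG =
            {# if \<rho> = 1 \<or> \<mu> 1 > \<mu> 2 then ev 1 else (ev 1)\<^sup>2 / ev 2 #} +
            replicate_mset (\<mu> 1 - 1) 1 +
            (\<Sum>i = 2..\<rho>. replicate_mset (\<mu> i) (ev i / ev 1))))"
proof (intro conjI allI impI)
  let ?n = "CARD('n)"
  have size: "sum_list (map fst xs) = ?n" if "similar_mat (jnf_mat dF) (jordan_matrix xs)"
    for xs :: "(nat \<times> complex) list"
  proof -
    note sim = that
    obtain k P Q where "{jnf_mat dF, jordan_matrix xs, P, Q} \<subseteq> carrier_mat k k"
      using similar_matD[OF sim] by (elim exE conjE)
    then have "dim_row (jnf_mat dF) = k" "dim_row (jordan_matrix xs) = k" by auto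
    then show ?thesis by (simp add: jnf_mat_def)
  qed
  show "\<exists>(M :: ('n manifold_point, 'n) charted_space) \<pi> e G dG. diagonalization F M \<pi> e G dG"
  proof -
    obtain as where "char_poly (jnf_mat dF) = (\<Prod>x\<leftarrow>as. [:- x, 1:])"
      using char_poly_factorized[OF jnf_mat_carrier] by blast
    then obtain xs where "jordan_nf (jnf_mat dF) xs" using jordan_nf_exists[OF jnf_mat_carrier] by blast
    then have sim: "similar_mat (jnf_mat dF) (jordan_matrix xs)" by (simp add: jordan_nf_def)
    define P where "P s \<longleftrightarrow> Suc s < ?n \<and> jordan_matrix xs $$ (s, Suc s) \<noteq> 0" for s
    have "\<exists>s. P s"
    proof (rule ccontr)
      assume "\<nexists>s. P s"
      then have "jordan_matrix xs $$ (i, Suc i) = 0" if "Suc i < ?n" for i using that unfolding P_def by simp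
      from diagonalizable_if_diagonal_jordan_form[OF sim size[OF sim] this] assms(4) show False by simp
    qed
    then have s: "P (LEAST s. P s)" by (rule LeastI_ex)
    \<comment> \<open>the least position with an entry above the diagonal starts its block\<close>
    define s where "s = (LEAST s. P s)"
    have s1: "Suc s < ?n" and s2: "jordan_matrix xs $$ (s, Suc s) \<noteq> 0" using s unfolding P_def s_def by blast+
    have s3: "jordan_matrix xs $$ (i, s) = 0" if i: "Suc i = s" for i
    proof -
      have "\<not> P i" by (rule not_less_Least) (use i in \<open>simp add: s_def\<close>)
      then show ?thesis using s1 i unfolding P_def by simp
    qed
    have "\<exists>(M :: ('n manifold_point, 'n) charted_space) \<pi> e G. diagonalization F M \<pi> e G
      (diagonal_matrix (\<lambda>j. if idx j = s then if False
          then (jordan_matrix xs $$ (s, s))\<^sup>2 / jordan_matrix xs $$ (0, 0) else jordan_matrix xs $$ (s, s)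
        else jordan_matrix xs $$ (idx j, idx j) / jordan_matrix xs $$ (s, s)))"
      by (rule diagonalization_of_jordan_form[OF assms(1-3) sim refl s1 s2 s3]) simp_all
    then show ?thesis by (elim exE) (intro exI)
  qed
  fix \<rho> :: nat and \<mu> :: "nat \<Rightarrow> nat" and ev :: "nat \<Rightarrow> complex"
  assume asm: "\<rho> \<ge> 1 \<and> (\<forall>i\<in>{1..<\<rho>}. \<mu> i \<ge> \<mu> (i + 1)) \<and> \<mu> \<rho> \<ge> 1 \<and>
       jordan_nf (jnf_mat dF) (map (\<lambda>i. (\<mu> i, ev i)) [1..<\<rho> + 1])"
  then have \<rho>1: "1 \<le> \<rho>" and desc: "\<And>i. i \<in> {1..<\<rho>} \<Longrightarrow> \<mu> (i + 1) \<le> \<mu> i"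
    and jnf: "jordan_nf (jnf_mat dF) (map (\<lambda>i. (\<mu> i, ev i)) [1..<\<rho> + 1])"
    by blast+
  define blocks where "blocks k = map (\<lambda>i. (\<mu> i, ev i)) [k..<\<rho> + 1]" for k
  define J where "J = jordan_matrix (blocks 1)"
  have sim: "similar_mat (jnf_mat dF) J" 
    using jnf unfolding J_def blocks_def jordan_nf_def by (rule conjunct2)
  have n: "sum_list (map fst (blocks 1)) = ?n" using size sim by (simp add: J_def)
  have blocks_Cons: "blocks k = (\<mu> k, ev k) # blocks (Suc k)" if "k \<le> \<rho>" for k
    using that by (simp add: blocks_def upt_conv_Cons del: upt_Suc)
  have mono: "\<mu> i \<le> \<mu> 1" if "1 \<le> i" "i \<le> \<rho>" for i
    using that
  proof (induction i rule: dec_induct)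
    case (step i)
    then have "\<mu> (i + 1) \<le> \<mu> i" by (intro desc) simp
    then show ?case using step by simp
  qed simp
  define n1 where "n1 = sum_list (map fst (blocks 2))"
  have B1: "blocks 1 = (\<mu> 1, ev 1) # blocks 2"
    using blocks_Cons[OF \<rho>1] by (simp add: numeral_2_eq_2)
  have n_eq: "?n = \<mu> 1 + n1" using n unfolding B1 by (simp add: n1_def)
  have J_index: "J $$ (i, j) = (if i < \<mu> 1 then if j < \<mu> 1 then if i = j then ev 1 else if Suc i = j then 1 else 0 else 0
     else if j < \<mu> 1 then 0 else jordan_matrix (blocks 2) $$ (i - \<mu> 1, j - \<mu> 1))" if "i < ?n" "j < ?n" for i j
    unfolding J_def B1 by (rule jordan_matrix_Cons_index) (use that n_eq in \<open>simp_all add: n1_def\<close>)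
  have \<mu>1: "\<mu> 1 \<ge> 2"
  proof (rule ccontr)
    assume "\<not> \<mu> 1 \<ge> 2"
    then have small: "\<mu> i \<le> 1" if "1 \<le> i" "i \<le> \<rho>" for i using mono[OF that] by simp
    have "jordan_matrix (blocks k) $$ (i, Suc i) = 0"
      if "1 \<le> k" "k \<le> Suc \<rho>" "Suc i < sum_list (map fst (blocks k))" for k i
      using that(2,1,3)
    proof (induction k arbitrary: i rule: inc_induct)
      case base
      then show ?case by (simp add: blocks_def)
    next
      case (step k)
      have k: "k \<le> \<rho>" using step.hyps by simp
      have m: "\<mu> k \<le> 1" using small step.prems k by simp
      have i: "Suc i < \<mu> k + sum_list (map fst (blocks (Suc k)))" using step.prems blocks_Cons[OF k] by simp
      have "jordan_matrix (blocks (Suc k)) $$ (i - \<mu> k, Suc i - \<mu> k) = 0" if "\<not> i < \<mu> k"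
      proof -
        have "Suc i - \<mu> k = Suc (i - \<mu> k)" using that by simp
        then show ?thesis using step.IH[of "i - \<mu> k"] i that by simp
      qed
      then show ?case
        unfolding blocks_Cons[OF k] using i m by (simp add: jordan_matrix_Cons_index)
    qed
    then show False
      using diagonalizable_if_diagonal_jordan_form[OF sim[unfolded J_def] n] assms(4) n \<rho>1 by simp
  qed
  have s: "Suc 0 < ?n" "J $$ (0, Suc 0) \<noteq> 0" "J $$ (0, 0) = ev 1"
    using \<mu>1 n_eq by (simp_all add: J_index)
  define hyp where "hyp \<longleftrightarrow> \<not> (\<rho> = 1 \<or> \<mu> 1 > \<mu> 2)"
  \<comment> \<open>the last position of the second block\<close>
  define m where "m = \<mu> 1 + \<mu> 2 - 1"
  have m: "m < ?n \<and> m \<noteq> 0 \<and> m \<noteq> Suc 0 \<and> (\<forall>k<?n. k \<noteq> m \<longrightarrow> J $$ (m, k) = 0) \<and> J $$ (m, m) = ev 2" if hyp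
  proof -
    have r: "2 \<le> \<rho>" "\<mu> 2 = \<mu> 1" 
    proof -
      show "2 \<le> \<rho>" using that \<rho>1 by (simp add: hyp_def)
      then show "\<mu> 2 = \<mu> 1" using that mono[of 2] by (simp add: hyp_def)
    qed
    define n2 where "n2 = sum_list (map fst (blocks 3))"
    have B2: "blocks 2 = (\<mu> 2, ev 2) # blocks 3" using blocks_Cons[of 2] r by (simp add: numeral_3_eq_3 numeral_2_eq_2)
    have n1: "n1 = \<mu> 2 + n2" by (simp add: n1_def B2 n2_def)
    have m': "m < ?n" "\<not> m < \<mu> 1" "m - \<mu> 1 = \<mu> 2 - 1" using \<mu>1 r n_eq n1 by (auto simp: m_def)
    have row: "J $$ (m, k) = (if k = m then ev 2 else 0)" if "k < ?n" for k
    proof (cases "k < \<mu> 1")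
      case True
      then show ?thesis using m' that by (simp add: J_index)
    next
      case False
      have 1: "\<mu> 2 - 1 < \<mu> 2 + n2" "k - \<mu> 1 < \<mu> 2 + n2" using that n_eq n1 False \<mu>1 r by auto
      have "J $$ (m, k) = jordan_matrix (blocks 2) $$ (\<mu> 2 - 1, k - \<mu> 1)"
        using J_index[OF m'(1) that] m' False by simp
      also have "\<dots> = (if \<mu> 2 - 1 = k - \<mu> 1 then ev 2 else 0)"
        unfolding B2 using 1 \<mu>1 r by (subst jordan_matrix_Cons_index) (auto simp: n2_def)
      also have "\<mu> 2 - 1 = k - \<mu> 1 \<longleftrightarrow> k = m" using False \<mu>1 r by (auto simp: m_def)
      finally show ?thesis .
    qed
    then show ?thesis using m' \<mu>1 r row[OF m'(1)] by (auto simp: m_def)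
  qed
  define d where "d i = (if i = 0 then if hyp then (J $$ (0, 0))\<^sup>2 / J $$ (m, m) else J $$ (0, 0)
                         else J $$ (i, i) / J $$ (0, 0))" for i
  obtain M :: "('n manifold_point, 'n) charted_space" and \<pi> e G
    where diag: "diagonalization F M \<pi> e G (diagonal_matrix (\<lambda>j. d (idx j)))"
  proof -
    have "\<exists>(M :: ('n manifold_point, 'n) charted_space) \<pi> e G.
        diagonalization F M \<pi> e G (diagonal_matrix (\<lambda>j. d (idx j)))"
      unfolding d_def
      by (rule diagonalization_of_jordan_form[OF assms(1-3) sim J_def s(1,2)]) (use m in simp_all)
    then show ?thesis using that by (elim exE)
  qed
  have eig: "eigenvalue_mset (diagonal_matrix (\<lambda>j. d (idx j)) :: complex ^ 'n ^ 'n) =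
      {# if \<rho> = 1 \<or> \<mu> 1 > \<mu> 2 then ev 1 else (ev 1)\<^sup>2 / ev 2 #} +
      replicate_mset (\<mu> 1 - 1) 1 + (\<Sum>i = 2..\<rho>. replicate_mset (\<mu> i) (ev i / ev 1))"
  proof -
    have split: "mset_set {..<?n} = add_mset 0 (mset_set ({..<?n} - {0}))"
      using mset_set.remove[of "{..<?n}" 0] by simp
    have "image_mset (\<lambda>i. J $$ (i, i)) (mset_set {..<?n}) = (\<Sum>(n, c)\<leftarrow>blocks 1. replicate_mset n c)"
      using mset_diag_jordan_matrix[of "blocks 1"] unfolding n J_def .
    also have "\<dots> = (\<Sum>i\<leftarrow>[1..<\<rho> + 1]. replicate_mset (\<mu> i) (ev i))"
      by (simp add: blocks_def o_def del: upt_Suc)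
    also have "\<dots> = (\<Sum>i = 1..\<rho>. replicate_mset (\<mu> i) (ev i))"
      by (simp add: interv_sum_list_conv_sum_set_nat atLeastLessThanSuc_atLeastAtMost del: upt_Suc)
    also have "\<dots> = replicate_mset (\<mu> 1) (ev 1) + (\<Sum>i = 2..\<rho>. replicate_mset (\<mu> i) (ev i))"
      using \<rho>1 by (simp add: sum.atLeast_Suc_atMost numeral_2_eq_2)
    also have "replicate_mset (\<mu> 1) (ev 1) = add_mset (ev 1) (replicate_mset (\<mu> 1 - 1) (ev 1))"
    proof -
      have "\<mu> 1 = Suc (\<mu> 1 - 1)" using \<mu>1 by simp
      then show ?thesis using replicate_mset_Suc[of "\<mu> 1 - 1" "ev 1"] by (simp only:)
    qed
    finally have "image_mset (\<lambda>i. J $$ (i, i)) (mset_set ({..<?n} - {0})) =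
        replicate_mset (\<mu> 1 - 1) (ev 1) + (\<Sum>i = 2..\<rho>. replicate_mset (\<mu> i) (ev i))"
      by (simp add: split s(3))
    then have "image_mset (\<lambda>x. x / ev 1) (image_mset (\<lambda>i. J $$ (i, i)) (mset_set ({..<?n} - {0}))) =
        image_mset (\<lambda>x. x / ev 1) (replicate_mset (\<mu> 1 - 1) (ev 1) + (\<Sum>i = 2..\<rho>. replicate_mset (\<mu> i) (ev i)))"
      by (rule arg_cong)
    moreover have "ev 1 \<noteq> 0"
    proof -
      have "upper_triangular J" using jordan_matrix_upper_triangular[of _ "blocks 1"] unfolding J_def by auto
      moreover have "J \<in> carrier_mat ?n ?n" using n unfolding J_def by auto
      ultimately have "prod_list (diag_mat J) \<noteq> 0"
        using det_jnf_mat_nonzero[OF assms(3)] det_similar[OF sim] det_upper_triangular by metis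
      then show ?thesis
        using s(1,3) \<open>J \<in> carrier_mat ?n ?n\<close> unfolding prod_list_zero_iff diag_mat_def by force
    qed
    ultimately have rest: "image_mset (\<lambda>i. J $$ (i, i) / ev 1) (mset_set ({..<?n} - {0})) =
        replicate_mset (\<mu> 1 - 1) 1 + (\<Sum>i = 2..\<rho>. replicate_mset (\<mu> i) (ev i / ev 1))"
      by (simp add: multiset.map_comp o_def image_mset_sum)
    have "eigenvalue_mset (diagonal_matrix (\<lambda>j. d (idx j)) :: complex ^ 'n ^ 'n) = image_mset d (mset_set {..<?n})"
      unfolding eigenvalue_mset_diagonal_matrix by (rule image_mset_cong) simp
    also have "\<dots> = add_mset (d 0) (image_mset d (mset_set ({..<?n} - {0})))" by (simp add: split)
    also have "image_mset d (mset_set ({..<?n} - {0})) = image_mset (\<lambda>i. J $$ (i, i) / ev 1) (mset_set ({..<?n} - {0}))"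
      by (rule image_mset_cong) (simp add: d_def s(3))
    also have "d 0 = (if \<rho> = 1 \<or> \<mu> 1 > \<mu> 2 then ev 1 else (ev 1)\<^sup>2 / ev 2)"
      using m unfolding d_def hyp_def s(3) by auto
    finally show ?thesis unfolding rest by simp
  qed
  show "\<exists>(M :: ('n manifold_point, 'n) charted_space) \<pi> e G dG.
          diagonalization F M \<pi> e G dG \<and>
          eigenvalue_mset dG =
            {# if \<rho> = 1 \<or> \<mu> 1 > \<mu> 2 then ev 1 else (ev 1)\<^sup>2 / ev 2 #} +
            replicate_mset (\<mu> 1 - 1) 1 +
            (\<Sum>i = 2..\<rho>. replicate_mset (\<mu> i) (ev i / ev 1))"
    using diag eig by (intro exI conjI)
qed

end
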